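(* Let $k\ge 1$ and $m\ge 2$ be integers, let $(H,\Phi)$ be a gluing data with parameters $k,m$, and let $\mathcal R=\mathcal R_{(H,\Phi)}:\mathcal G_k\to\mathcal G_k$ be the associated graph recursion operator. Let $G_0\in\mathcal G_k$ and define $G_{n+1}=\mathcal R(G_n)$ for $n\ge 0$. Suppose that (i) the maximal vertex degrees of the graphs $G_n$ are uniformly bounded in $n$, and (ii) the minimal graph distance between pairs of distinct labeled vertices in $G_n$ diverges to $\infty$ as $n\to\infty$. Then the limit $$\rho(\lambda)=\lim_{n\to\infty}\frac{\log Z_{G_n}(\lambda)}{\#V(G_n)}$$ exists for every $\lambda\in\mathbb R_+=(0,\infty)$, and the function $\rho$ is real-analytic on all of $\mathbb R_+$.
   Context: Graphs are finite and undirected; multiple edges are allowed, loops are not. The graph distance between two vertices is the length of a shortest path connecting them, or $\infty$ if there is none. The independence polynomial of a graph $G$ is $Z_G(\lambda)=\sum_I\lambda^{\#I}$, the sum over all independent sets $I\subset V(G)$ (sets of pairwise non-adjacent vertices). $\mathcal G_k$ is the set of graphs with $k$ distinct marked (labeled) vertices, labeled $1,\dots,k$. A hypergraph has a finite vertex set and a finite multiset of edges, each a nonempty subset of the vertex set. A gluing data with parameters $k,m$ is a pair $(H,\Phi)$, where $H$ is a hypergraph with $V(H)=\{1,\dots,m\}$ whose edges $e\in E(H)$ each carry a label $\ell(e)\in\{1,\dots,k\}$ such that, for each $j\in\{1,\dots,k\}$, the edges labeled $j$ form a partition of $V(H)$; and $\Phi:\{1,\dots,k\}\to E(H)$ is an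 injective map. The graph recursion $\mathcal R=\mathcal R_{(H,\Phi)}:\mathcal G_k\to\mathcal G_k$ is defined as follows. Given $G\in\mathcal G_k$, take $m$ disjoint copies $G(1),\dots,G(m)$ of $G$; for each edge $e=\{i_1,\dots,i_s\}\in E(H)$ identify the vertices labeled $\ell(e)$ in the copies $G(i_1),\dots,G(i_s)$ into one vertex; finally, assign $k$ new labels: label $j$ is given to the vertex corresponding to the edge $\Phi(j)$ (old labels are forgotten). The result is $\mathcal R(G)\in\mathcal G_k$. *)

theory Defs
  imports "HOL-Analysis.Analysis" "HOL-Library.Multiset" "HOL-Library.Disjoint_Sets"
begin

section \<open>Marked multigraphs\<close>

text \<open>
  An edge is the two-element set of its ends, so loops are excluded; multiplicities are
  recorded by the multiset. The marked vertices are \<open>mark G 1, \<dots>, mark G k\<close>; the values of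
  \<open>mark G\<close> outside \<open>{1..k}\<close> are irrelevant.
\<close>

record 'v marked_graph =
  verts :: "'v set"
  edges :: "'v set multiset"
  mark :: "nat \<Rightarrow> 'v"

definition marked_graphs :: "nat \<Rightarrow> 'v marked_graph set" where
  "marked_graphs k = {G. finite (verts G)
     \<and> (\<forall>e\<in>#edges G. e \<subseteq> verts G \<and> card e = 2)
     \<and> mark G ` {1..k} \<subseteq> verts G \<and> inj_on (mark G) {1..k}}"

definition adjacent :: "'v marked_graph \<Rightarrow> 'v \<Rightarrow> 'v \<Rightarrow> bool" where
  "adjacent G u v \<longleftrightarrow> {u, v} \<in># edges G"

text \<open>Degrees count parallel edges with multiplicity.\<close>

definition degree :: "'v marked_graph \<Rightarrow> 'v \<Rightarrow> nat" where
  "degree G v = size {#e \<in># edges G. v \<in> e#}"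

definition max_degree :: "'v marked_graph \<Rightarrow> nat" where
  "max_degree G = Max (degree G ` verts G)"

definition paths :: "'v marked_graph \<Rightarrow> 'v \<Rightarrow> 'v \<Rightarrow> 'v list set" where
  "paths G u v = {p. p \<noteq> [] \<and> hd p = u \<and> last p = v \<and> distinct p \<and> set p \<subseteq> verts G
     \<and> successively (adjacent G) p}"

text \<open>The infimum over the empty set is \<open>\<infinity>\<close>, here and in \<open>min_mark_distance\<close>.\<close>

definition distance :: "'v marked_graph \<Rightarrow> 'v \<Rightarrow> 'v \<Rightarrow> enat" where
  "distance G u v = (INF p\<in>paths G u v. enat (length p - 1))"

definition min_mark_distance :: "nat \<Rightarrow> 'v marked_graph \<Rightarrow> enat" where
  "min_mark_distance k G =
     Inf {distance G (mark G i) (mark G j) | i j. i \<in> {1..k} \<and> j \<in> {1..k} \<and> i \<noteq> j}"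

definition independent_sets :: "'v marked_graph \<Rightarrow> 'v set set" where
  "independent_sets G = {I. I \<subseteq> verts G \<and> pairwise (\<lambda>u v. \<not> adjacent G u v) I}"

definition independence_poly :: "'v marked_graph \<Rightarrow> real \<Rightarrow> real" where
  "independence_poly G x = (\<Sum>I\<in>independent_sets G. x ^ card I)"


section \<open>Gluing data\<close>

text \<open>
  Edges of a hypergraph are abstract elements with a vertex set \<open>ends H e\<close>, so that several
  edges may have the same vertex set.
\<close>

record ('v, 'e) hypergraph =
  hverts :: "'v set"
  hedges :: "'e set"
  ends :: "'e \<Rightarrow> 'v set"

definition is_hypergraph :: "('v, 'e) hypergraph \<Rightarrow> bool" where
  "is_hypergraph H \<longleftrightarrow> finite (hverts H) \<and> finite (hedges H)
     \<and> (\<forall>e\<in>hedges H. ends H e \<noteq> {} \<and> ends H e \<subseteq> hverts H)"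

text \<open>
  Injectivity of \<open>ends H\<close> on each label class says that no block of the partition is repeated
  in the multiset of edges with that label.
\<close>

definition gluing_data ::
    "nat \<Rightarrow> nat \<Rightarrow> (nat, 'e) hypergraph \<Rightarrow> ('e \<Rightarrow> nat) \<Rightarrow> (nat \<Rightarrow> 'e) \<Rightarrow> bool" where
  "gluing_data k m H l \<Phi> \<longleftrightarrow> is_hypergraph H \<and> hverts H = {1..m}
     \<and> l ` hedges H \<subseteq> {1..k}
     \<and> (\<forall>j\<in>{1..k}. partition_on (hverts H) (ends H ` {e \<in> hedges H. l e = j})
                  \<and> inj_on (ends H) {e \<in> hedges H. l e = j})
     \<and> \<Phi> ` {1..k} \<subseteq> hedges H \<and> inj_on \<Phi> {1..k}"


section \<open>The graph recursion\<close>

text \<open>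
  To iterate the recursion within one type, vertices live in a type closed under forming copies
  and gluing: \<open>Copy i v\<close> is the vertex \<open>v\<close> of the \<open>i\<close>-th copy, and \<open>Glued e\<close> is the
  vertex obtained by identifying the vertices labelled \<open>l e\<close> in the copies \<open>i \<in> ends H e\<close>.
  As each label class is a partition, every marked vertex of every copy becomes exactly one
  \<open>Glued e\<close>. The constructor \<open>Orig\<close> embeds an arbitrary vertex type for the initial graph.
\<close>

datatype ('a, 'e) vertex = Orig 'a | Copy nat "('a, 'e) vertex" | Glued 'e

definition place :: "nat \<Rightarrow> (nat, 'e) hypergraph \<Rightarrow> ('e \<Rightarrow> nat) \<Rightarrow>
    ('a, 'e) vertex marked_graph \<Rightarrow> nat \<Rightarrow> ('a, 'e) vertex \<Rightarrow> ('a, 'e) vertex" where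
  "place k H l G i v =
     (if v \<in> mark G ` {1..k}
      then Glued (THE e. e \<in> hedges H \<and> i \<in> ends H e \<and> mark G (l e) = v)
      else Copy i v)"

definition recursion :: "nat \<Rightarrow> (nat, 'e) hypergraph \<Rightarrow> ('e \<Rightarrow> nat) \<Rightarrow> (nat \<Rightarrow> 'e) \<Rightarrow>
    ('a, 'e) vertex marked_graph \<Rightarrow> ('a, 'e) vertex marked_graph" where
  "recursion k H l \<Phi> G =
     \<lparr> verts = (\<Union>i\<in>hverts H. place k H l G i ` verts G),
       edges = (\<Sum>i\<in>hverts H. image_mset (image (place k H l G i)) (edges G)),
       mark = (\<lambda>j. Glued (\<Phi> j)) \<rparr>"

text \<open>
  The next facts confirm that \<open>place\<close> realises the intended quotient of the disjoint union of
  the copies and that the recursion maps marked graphs to marked graphs.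
\<close>

lemma gluing_dataD:
  assumes "gluing_data k m H l \<Phi>" "e \<in> hedges H"
  shows "l e \<in> {1..k}" and "i \<in> ends H e \<Longrightarrow> i \<in> {1..m}"
proof -
  show "l e \<in> {1..k}" using assms unfolding gluing_data_def by blast
  have "is_hypergraph H" and "hverts H = {1..m}"
    using assms(1) unfolding gluing_data_def by blast+
  moreover from this have "ends H e \<subseteq> hverts H"
    using assms(2) unfolding is_hypergraph_def by blast
  ultimately have "ends H e \<subseteq> {1..m}" by simp
  then show "i \<in> {1..m}" if "i \<in> ends H e" using that by (rule subsetD)
qed

lemma ex1_edge:
  assumes "gluing_data k m H l \<Phi>" "j \<in> {1..k}" "i \<in> {1..m}"
  shows "\<exists>!e. e \<in> hedges H \<and> i \<in> ends H e \<and> l e = j"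
proof -
  let ?E = "{e \<in> hedges H. l e = j}"
  have P: "partition_on {1..m} (ends H ` ?E)" and I: "inj_on (ends H) ?E"
    using assms unfolding gluing_data_def by auto
  have "i \<in> \<Union>(ends H ` ?E)" using assms(3) unfolding partition_onD1[OF P, symmetric] .
  then obtain e where e: "e \<in> ?E" "i \<in> ends H e" by auto
  have "e' = e" if "e' \<in> ?E" "i \<in> ends H e'" for e'
  proof -
    have "ends H e' = ends H e"
      using partition_onD2[OF P] that e unfolding disjoint_def by blast
    then show ?thesis using I that e by (auto dest: inj_onD)
  qed
  then show ?thesis using e by auto
qed

lemma place_marked:
  assumes g: "gluing_data k m H l \<Phi>" and G: "G \<in> marked_graphs k"
    and e: "e \<in> hedges H" "i \<in> ends H e"
  shows "place k H l G i (mark G (l e)) = Glued e"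
proof -
  have l: "\<And>e. e \<in> hedges H \<Longrightarrow> l e \<in> {1..k}" and i: "i \<in> {1..m}"
    using gluing_dataD[OF g] e by metis+
  have inj: "inj_on (mark G) {1..k}" using G unfolding marked_graphs_def by auto
  have "(THE e'. e' \<in> hedges H \<and> i \<in> ends H e' \<and> mark G (l e') = mark G (l e)) = e"
  proof (rule the_equality)
    fix e' assume a: "e' \<in> hedges H \<and> i \<in> ends H e' \<and> mark G (l e') = mark G (l e)"
    then have "l e' = l e" using inj l e by (auto dest: inj_onD)
    then show "e' = e" using ex1_edge[OF g l[OF e(1)] i] a e by auto
  qed (use e in auto)
  then show ?thesis using l[OF e(1)] unfolding place_def by auto
qed

lemma place_unmarked: "v \<notin> mark G ` {1..k} \<Longrightarrow> place k H l G i v = Copy i v"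
  by (simp add: place_def)

lemma place_eq_iff:
  assumes g: "gluing_data k m H l \<Phi>" and G: "G \<in> marked_graphs k"
    and i: "i \<in> {1..m}" "i' \<in> {1..m}"
  shows "place k H l G i v = place k H l G i' v' \<longleftrightarrow>
    (i = i' \<and> v = v') \<or>
    (\<exists>e\<in>hedges H. i \<in> ends H e \<and> i' \<in> ends H e \<and> v = mark G (l e) \<and> v' = mark G (l e))"
    (is "?L \<longleftrightarrow> ?R")
proof
  have *: "\<exists>e\<in>hedges H. i \<in> ends H e \<and> w = mark G (l e) \<and> place k H l G i w = Glued e"
    if w: "w \<in> mark G ` {1..k}" and i: "i \<in> {1..m}" for w i
  proof -
    obtain j where j: "j \<in> {1..k}" "w = mark G j" using w by blast
    obtain e where "e \<in> hedges H" "i \<in> ends H e" "l e = j"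
      using ex1_edge[OF g j(1) i] by auto
    then show ?thesis using place_marked[OF g G] j by metis
  qed
  assume L: ?L
  show ?R
  proof (cases "v \<in> mark G ` {1..k} \<or> v' \<in> mark G ` {1..k}")
    case True
    have "v \<in> mark G ` {1..k}" "v' \<in> mark G ` {1..k}"
      using True L by (auto simp: place_def split: if_splits)
    then show ?thesis using *[of v i] *[of v' i'] i L by auto
  next
    case False
    then show ?thesis using L by (simp add: place_unmarked)
  qed
next
  assume ?R
  then show ?L using place_marked[OF g G] by auto
qed

lemma recursion_marked_graphs:
  fixes H :: "(nat, 'e) hypergraph" and G :: "('a, 'e) vertex marked_graph"
  assumes g: "gluing_data k m H l \<Phi>" and G: "G \<in> marked_graphs k"
  shows "recursion k H l \<Phi> G \<in> marked_graphs k"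
proof -
  have H: "finite (hverts H)" "hverts H = {1..m}" "\<Phi> ` {1..k} \<subseteq> hedges H" "inj_on \<Phi> {1..k}"
    and ends: "\<And>e. e \<in> hedges H \<Longrightarrow> ends H e \<noteq> {} \<and> ends H e \<subseteq> hverts H \<and> l e \<in> {1..k}"
    using g unfolding gluing_data_def is_hypergraph_def by auto
  have V: "finite (verts G)" "mark G ` {1..k} \<subseteq> verts G" "inj_on (mark G) {1..k}"
    and E: "\<And>e. e \<in># edges G \<Longrightarrow> e \<subseteq> verts G \<and> card e = 2"
    using G unfolding marked_graphs_def by auto
  have inj: "inj_on (place k H l G i) (verts G)" if "i \<in> {1..m}" for i
    by (rule inj_onI) (use place_eq_iff[OF g G that that] in auto)
  have mem: "\<exists>i\<in>hverts H. \<exists>d. d \<in># edges G \<and> e = place k H l G i ` d"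
    if "e \<in># (\<Sum>i\<in>hverts H. image_mset (image (place k H l G i)) (edges G))" for e
    using that by (auto simp: set_mset_sum H(1))
  have ed: "e \<subseteq> (\<Union>i\<in>hverts H. place k H l G i ` verts G) \<and> card e = 2"
    if e: "e \<in># (\<Sum>i\<in>hverts H. image_mset (image (place k H l G i)) (edges G))" for e
  proof -
    obtain i d where d: "i \<in> hverts H" "d \<in># edges G" "e = place k H l G i ` d"
      using mem[OF e] by blast
    have "inj_on (place k H l G i) (verts G)" using inj d(1) H(2) by simp
    then have "inj_on (place k H l G i) d" using E[OF d(2)] inj_on_subset by blast
    then have "card e = 2" using E[OF d(2)] d(3) by (simp add: card_image)
    moreover have "e \<subseteq> (\<Union>i\<in>hverts H. place k H l G i ` verts G)"
      using E[OF d(2)] d(1,3) by blast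
    ultimately show ?thesis by simp
  qed
  have mk: "Glued (\<Phi> j) \<in> (\<Union>i\<in>hverts H. place k H l G i ` verts G)" if "j \<in> {1..k}" for j
  proof -
    have e: "\<Phi> j \<in> hedges H" using H(3) that by auto
    then obtain i where i: "i \<in> ends H (\<Phi> j)" "i \<in> hverts H" using ends by blast
    have "Glued (\<Phi> j) = place k H l G i (mark G (l (\<Phi> j)))"
      using place_marked[OF g G e i(1)] by simp
    then show ?thesis using i(2) V(2) ends[OF e] by blast
  qed
  have "finite (\<Union>i\<in>hverts H. place k H l G i ` verts G)"
    using H(1) V(1) by simp
  moreover have "inj_on (\<lambda>j. Glued (\<Phi> j) :: ('a, 'e) vertex) {1..k}"
    using H(4) unfolding inj_on_def vertex.inject .
  moreover have "(\<lambda>j. Glued (\<Phi> j)) ` {1..k} \<subseteq> (\<Union>i\<in>hverts H. place k H l G i ` verts G)"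
    using mk by (rule image_subsetI)
  ultimately show ?thesis
    unfolding marked_graphs_def recursion_def marked_graph.simps mem_Collect_eq
    using ed by (intro conjI ballI) simp_all
qed


section \<open>Real-analytic functions\<close>

text \<open>Intended for open \<open>S\<close>.\<close>

definition real_analytic_on :: "(real \<Rightarrow> real) \<Rightarrow> real set \<Rightarrow> bool" where
  "real_analytic_on f S \<longleftrightarrow>
     (\<forall>x\<in>S. \<exists>r>0. \<exists>a. \<forall>y. \<bar>y - x\<bar> < r \<longrightarrow> (\<lambda>n. a n * (y - x) ^ n) sums f y)"

end

theory Submission
  imports Defs "HOL-Complex_Analysis.Complex_Analysis"
begin

text \<open>
  Why the theorem holds. Let \<open>W\<^sub>n(S)\<close> be the sum of \<open>z\<close> to the number of unmarked vertices over all
  independent sets of \<open>G n\<close> whose marked vertices are exactly those with label in \<open>S\<close>. As the copies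
  of \<open>G n\<close> in \<open>G (Suc n)\<close> meet only in glued vertices, \<open>W\<^sub>n\<^sub>+\<^sub>1\<close> is a polynomial in \<open>W\<^sub>n\<close>
  (\<open>boundary_poly_recursion\<close>): one sums over the occupied glued vertices that are not marked again and
  multiplies over the copies. The ratios \<open>r\<^sub>n(j; S) = W\<^sub>n(S \<union> {j}) / W\<^sub>n(S)\<close> measure how a marked vertex
  feels the other ones. Vectors for which they do not depend on \<open>S\<close> form an invariant manifold,
  and the proof shows that the recursion is attracted to it, for positive \<open>z\<close> and then also for
  complex \<open>z\<close> nearby.

  Both hypotheses enter through the labels. Let \<open>\<phi> j\<close> be the old label of the vertex that receives
  the new label \<open>j\<close>. Along \<open>\<phi>\<close> degrees are multiplied by the number of identified copies, so bounded
  degrees force every label to reach, after boundedly many applications of \<open>\<phi>\<close>, a \<^emph>\<open>stable\<close> label,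
  which is inherited from a single copy forever, or a \<^emph>\<open>dead\<close> one, which marks an isolated vertex
  (\<open>uniform_depth\<close>). Two labels inherited from a common copy cannot move apart; as marked vertices
  do move apart, two labels that are inherited from common copies throughout \<open>R\<close> steps come from
  vertices in different components (\<open>ex_separating\<close>) and do not influence each other.

  For a stable label \<open>j\<close>, \<open>r\<^sub>n\<^sub>+\<^sub>1(j; S)\<close> is an average of \<open>r\<^sub>n(\<phi> j; _)\<close>. For positive \<open>z\<close> the event that
  no unmarked glued vertex is occupied has a probability that is bounded below, because occupying
  vertices only lowers \<open>W\<^sub>n\<close>. On this event the copy that contains the marked vertex sees \<open>S\<close> only
  through labels in that same copy. After \<open>R\<close> steps no such label is left, and the oscillation of
  \<open>S \<mapsto> r\<^sub>n(j; S)\<close> has contracted by a fixed factor (\<open>osc_add\<close>). This is a Doeblin argument; it needs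
  only that the weights of the average are close to probabilities, hence applies to complex \<open>z\<close> as
  long as all ratios are relatively close to \<open>{0<..1}\<close> (\<open>good\<close>). Conversely, the geometric decay of
  the oscillations bounds the total movement of the ratios of stable labels, so that they never
  leave a small neighbourhood of \<open>{0<..1}\<close>; the ratios of other labels are approximate products of
  ratios of stable and dead ones. Hence the ratios stay under control for all large \<open>n\<close>, uniformly
  for \<open>z\<close> near a given \<open>x > 0\<close> (\<open>uniform_good\<close>).

  It follows that \<open>W\<^sub>n\<^sub>+\<^sub>1({}) / W\<^sub>n({}) ^ m\<close> lies in a fixed compact subset of the right half plane. So
  \<open>ln (W\<^sub>n({})) / m ^ n\<close> converges uniformly near \<open>x\<close>, as a series of holomorphic functions with geometric
  bounds (\<open>local_free_energy\<close>). The independence polynomial differs from \<open>W\<^sub>n({})\<close> by a factor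
  between \<open>1\<close> and \<open>(1 + x) ^ k\<close>, and the number of vertices is asymptotic to a constant times
  \<open>m ^ n\<close>. If that constant is \<open>0\<close>, then all vertices are marked, there are eventually no edges, and
  the limit is \<open>ln (1 + x)\<close>.
\<close>

section \<open>Boundary polynomials\<close>

definition indep :: "'v marked_graph \<Rightarrow> 'v set \<Rightarrow> bool" where
  "indep G X \<longleftrightarrow> (\<forall>d\<in>#edges G. \<not> d \<subseteq> X)"

text \<open>
  Only the unmarked part \<open>I\<close> of an independent set is recorded, so that a glued vertex, which
  belongs to several copies, is not counted several times.
\<close>

definition boundary_sets :: "nat \<Rightarrow> 'v marked_graph \<Rightarrow> nat set \<Rightarrow> 'v set set" where
  "boundary_sets k G S = {I. I \<subseteq> verts G - mark G ` {1..k} \<and> indep G (I \<union> mark G ` S)}"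

definition boundary_poly :: "nat \<Rightarrow> 'v marked_graph \<Rightarrow> nat set \<Rightarrow> 'b::comm_semiring_1 \<Rightarrow> 'b" where
  "boundary_poly k G S x = (\<Sum>I\<in>boundary_sets k G S. x ^ card I)"

lemma indep_subset: "indep G X \<Longrightarrow> Y \<subseteq> X \<Longrightarrow> indep G Y"
  unfolding indep_def by blast

lemma marked_graphsD:
  assumes "G \<in> marked_graphs k"
  shows "finite (verts G)" "\<And>d. d \<in># edges G \<Longrightarrow> d \<subseteq> verts G" "\<And>d. d \<in># edges G \<Longrightarrow> card d = 2"
    "\<And>j. j \<in> {1..k} \<Longrightarrow> mark G j \<in> verts G" "inj_on (mark G) {1..k}"
  using assms unfolding marked_graphs_def by auto

lemma independent_sets_eq:
  assumes "G \<in> marked_graphs k"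
  shows "independent_sets G = {I. I \<subseteq> verts G \<and> indep G I}"
proof -
  have "pairwise (\<lambda>u v. \<not> adjacent G u v) I \<longleftrightarrow> indep G I" for I
  proof
    assume p: "pairwise (\<lambda>u v. \<not> adjacent G u v) I"
    show "indep G I"
      unfolding indep_def
    proof (intro ballI notI)
      fix d assume d: "d \<in># edges G" "d \<subseteq> I"
      obtain u v where "d = {u, v}" "u \<noteq> v"
        using marked_graphsD(3)[OF assms d(1)] card_2_iff by metis
      then show False using p d unfolding pairwise_def adjacent_def by auto
    qed
  next
    assume "indep G I"
    then show "pairwise (\<lambda>u v. \<not> adjacent G u v) I"
      unfolding pairwise_def adjacent_def indep_def by auto
  qed
  then show ?thesis unfolding independent_sets_def by simp
qed

lemma finite_boundary_sets: "G \<in> marked_graphs k \<Longrightarrow> finite (boundary_sets k G S)"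
  unfolding boundary_sets_def
  by (rule finite_subset[of _ "Pow (verts G)"]) (auto dest: marked_graphsD(1))

lemma independence_poly_eq:
  assumes G: "G \<in> marked_graphs k"
  shows "independence_poly G x = (\<Sum>S\<in>Pow {1..k}. x ^ card S * boundary_poly k G S x)"
proof -
  let ?M = "mark G ` {1..k}"
  let ?f = "\<lambda>(S, I). I \<union> mark G ` S"
  let ?A = "Sigma (Pow {1..k}) (boundary_sets k G)"
  note g = marked_graphsD[OF G]
  have bij: "bij_betw ?f ?A (independent_sets G)"
    unfolding independent_sets_eq[OF G]
  proof (rule bij_betwI[where g = "\<lambda>I. ({j \<in> {1..k}. mark G j \<in> I}, I - ?M)"])
    show "?f \<in> ?A \<rightarrow> {I. I \<subseteq> verts G \<and> indep G I}"
      using g(4) unfolding boundary_sets_def by auto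
  next
    show "(\<lambda>I. ({j \<in> {1..k}. mark G j \<in> I}, I - ?M)) \<in> {I. I \<subseteq> verts G \<and> indep G I} \<rightarrow> ?A"
    proof (rule funcsetI)
      fix I assume I: "I \<in> {I. I \<subseteq> verts G \<and> indep G I}"
      have "I - ?M \<union> mark G ` {j \<in> {1..k}. mark G j \<in> I} = I" by auto
      then show "({j \<in> {1..k}. mark G j \<in> I}, I - ?M) \<in> ?A"
        using I unfolding boundary_sets_def by auto
    qed
  next
    fix y assume y: "y \<in> ?A"
    obtain S I where SI: "y = (S, I)" "S \<subseteq> {1..k}" "I \<inter> ?M = {}"
      using y unfolding boundary_sets_def by blast
    have "mark G j \<in> mark G ` S \<longleftrightarrow> j \<in> S" if "j \<in> {1..k}" for j
      using inj_on_image_mem_iff[OF g(5) that SI(2)] .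
    then have "{j \<in> {1..k}. mark G j \<in> I \<union> mark G ` S} = S" using SI(2,3) by auto
    moreover have "(I \<union> mark G ` S) - ?M = I" using SI(2,3) by auto
    ultimately show "({j \<in> {1..k}. mark G j \<in> ?f y}, ?f y - ?M) = y" using SI(1) by simp
  next
    fix I assume "I \<in> {I. I \<subseteq> verts G \<and> indep G I}"
    show "?f ({j \<in> {1..k}. mark G j \<in> I}, I - ?M) = I" by auto
  qed
  have crd: "x ^ card (?f y) = x ^ card (fst y) * x ^ card (snd y)" if y: "y \<in> ?A" for y
  proof -
    obtain S I where SI: "y = (S, I)" "S \<subseteq> {1..k}" "I \<inter> ?M = {}" "I \<subseteq> verts G"
      using y unfolding boundary_sets_def by blast
    have "finite I" "finite S" using SI g(1) by (auto intro: finite_subset)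
    moreover have "I \<inter> mark G ` S = {}" using SI by auto
    moreover have "card (mark G ` S) = card S"
      using g(5) SI(2) by (simp add: card_image inj_on_subset)
    ultimately show ?thesis using SI by (simp add: card_Un_disjoint power_add)
  qed
  have "independence_poly G x = (\<Sum>y\<in>?A. x ^ card (?f y))"
    unfolding independence_poly_def using sum.reindex_bij_betw[OF bij, of "\<lambda>I. x ^ card I"] by simp
  also have "\<dots> = (\<Sum>y\<in>?A. x ^ card (fst y) * x ^ card (snd y))"
    by (rule sum.cong) (use crd in auto)
  also have "\<dots> = (\<Sum>S\<in>Pow {1..k}. \<Sum>I\<in>boundary_sets k G S. x ^ card S * x ^ card I)"
    by (subst sum.Sigma) (auto simp: finite_boundary_sets[OF G] case_prod_unfold)
  finally show ?thesis by (simp add: boundary_poly_def sum_distrib_left)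
qed

lemma boundary_poly_antimono:
  assumes "G \<in> marked_graphs k" "S \<subseteq> S'" "0 \<le> (x::real)"
  shows "boundary_poly k G S' x \<le> boundary_poly k G S x"
  unfolding boundary_poly_def
proof (rule sum_mono2)
  show "boundary_sets k G S' \<subseteq> boundary_sets k G S"
    unfolding boundary_sets_def
    by (intro Collect_mono conjI impI; elim conjE)
       (assumption, erule indep_subset, use assms(2) in auto)
qed (use assms in \<open>auto simp: finite_boundary_sets\<close>)

lemma boundary_poly_ge_1:
  fixes G :: "'v marked_graph"
  assumes G: "G \<in> marked_graphs k" and "0 \<le> (x::real)" "indep G (mark G ` S)"
  shows "1 \<le> boundary_poly k G S x"
proof -
  have "{} \<in> boundary_sets k G S" using assms(3) unfolding boundary_sets_def by simp
  then have "(\<Sum>I\<in>{{} :: 'v set}. x ^ card I) \<le> boundary_poly k G S x"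
    unfolding boundary_poly_def
    using assms(2) finite_boundary_sets[OF G] by (intro sum_mono2) auto
  then show ?thesis by simp
qed

lemma boundary_poly_nonneg: "0 \<le> (x::real) \<Longrightarrow> 0 \<le> boundary_poly k G S x"
  unfolding boundary_poly_def by (simp add: sum_nonneg)

lemma boundary_poly_of_real:
  "boundary_poly k G S (of_real x :: 'b::{real_algebra_1,comm_ring_1}) = of_real (boundary_poly k G S x)"
  unfolding boundary_poly_def by simp

lemma indep_empty: "G \<in> marked_graphs k \<Longrightarrow> indep G {}"
  unfolding indep_def using marked_graphsD(3) by fastforce

text \<open>
  A set \<open>C\<close> that no edge leaves is a union of components, and the choices inside and outside of it
  are independent.
\<close>

lemma boundary_poly_split:
  assumes G: "G \<in> marked_graphs k"
    and C: "C \<subseteq> verts G" "\<And>d. d \<in># edges G \<Longrightarrow> d \<subseteq> C \<or> d \<inter> C = {}"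
  shows "\<exists>A B :: nat set \<Rightarrow> 'b::comm_semiring_1. \<forall>S\<subseteq>{1..k}.
    boundary_poly k G S x = A {j \<in> S. mark G j \<in> C} * B {j \<in> S. mark G j \<notin> C}"
proof -
  let ?U = "verts G - mark G ` {1..k}"
  let ?P = "\<lambda>S. {I. I \<subseteq> ?U \<inter> C \<and> indep G (I \<union> mark G ` S)}"
  let ?Q = "\<lambda>S. {I. I \<subseteq> ?U - C \<and> indep G (I \<union> mark G ` S)}"
  let ?A = "\<lambda>S. \<Sum>I\<in>?P S. x ^ card I"
  let ?B = "\<lambda>S. \<Sum>I\<in>?Q S. x ^ card I"
  note g = marked_graphsD[OF G]
  have key: "boundary_poly k G S x = ?A {j \<in> S. mark G j \<in> C} * ?B {j \<in> S. mark G j \<notin> C}"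
    if S: "S \<subseteq> {1..k}" for S
  proof -
    let ?S1 = "{j \<in> S. mark G j \<in> C}" and ?S2 = "{j \<in> S. mark G j \<notin> C}"
    have ind: "indep G (I \<union> J \<union> mark G ` S) \<longleftrightarrow> indep G (I \<union> mark G ` ?S1) \<and> indep G (J \<union> mark G ` ?S2)"
      if "I \<subseteq> C" "J \<inter> C = {}" for I J
    proof -
      have 1: "(d \<subseteq> I \<union> J \<union> mark G ` S) = (d \<subseteq> I \<union> mark G ` ?S1)" if "d \<subseteq> C" for d
        using that \<open>J \<inter> C = {}\<close> by blast
      have 2: "(d \<subseteq> I \<union> J \<union> mark G ` S) = (d \<subseteq> J \<union> mark G ` ?S2)" if "d \<inter> C = {}" for d
        using that \<open>I \<subseteq> C\<close> by blast
      have ne: "\<not> d \<subseteq> {}" if "d \<in># edges G" for d using g(3)[OF that] by auto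
      have 3: "\<not> d \<subseteq> J \<union> mark G ` ?S2" if "d \<in># edges G" "d \<subseteq> C" for d
        using that ne[OF that(1)] \<open>J \<inter> C = {}\<close> by blast
      have 4: "\<not> d \<subseteq> I \<union> mark G ` ?S1" if "d \<in># edges G" "d \<inter> C = {}" for d
        using that ne[OF that(1)] \<open>I \<subseteq> C\<close> by blast
      have key: "d \<subseteq> I \<union> J \<union> mark G ` S \<longleftrightarrow> d \<subseteq> I \<union> mark G ` ?S1 \<or> d \<subseteq> J \<union> mark G ` ?S2"
        if "d \<in># edges G" for d
        using C(2)[OF that] 1[of d] 2[of d] 3[OF that] 4[OF that] by argo
      show ?thesis unfolding indep_def by (simp only: key ball_conj_distrib de_Morgan_disj cong: ball_cong)
    qed
    have bij: "bij_betw (\<lambda>(I, J). I \<union> J) (?P ?S1 \<times> ?Q ?S2) (boundary_sets k G S)"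
    proof (rule bij_betwI[where g = "\<lambda>I. (I \<inter> C, I - C)"])
      show "(\<lambda>(I, J). I \<union> J) \<in> ?P ?S1 \<times> ?Q ?S2 \<rightarrow> boundary_sets k G S"
      proof (rule funcsetI, clarify)
        fix I J assume "I \<subseteq> ?U \<inter> C" "indep G (I \<union> mark G ` ?S1)" "J \<subseteq> ?U - C" "indep G (J \<union> mark G ` ?S2)"
        then show "I \<union> J \<in> boundary_sets k G S"
          unfolding boundary_sets_def using ind[of I J] by blast
      qed
      show "(\<lambda>I. (I \<inter> C, I - C)) \<in> boundary_sets k G S \<rightarrow> ?P ?S1 \<times> ?Q ?S2"
      proof (rule funcsetI)
        fix I assume "I \<in> boundary_sets k G S"
        then have I: "I \<subseteq> ?U" "indep G (I \<union> mark G ` S)" unfolding boundary_sets_def by auto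
        moreover have "I \<inter> C \<union> (I - C) = I" by blast
        ultimately show "(I \<inter> C, I - C) \<in> ?P ?S1 \<times> ?Q ?S2"
          using ind[of "I \<inter> C" "I - C"] by auto
      qed
    qed auto
    have "boundary_poly k G S x = (\<Sum>y\<in>?P ?S1 \<times> ?Q ?S2. x ^ card (fst y \<union> snd y))"
      unfolding boundary_poly_def using sum.reindex_bij_betw[OF bij, of "\<lambda>I. x ^ card I"]
      by (simp add: case_prod_unfold)
    also have "\<dots> = (\<Sum>y\<in>?P ?S1 \<times> ?Q ?S2. x ^ card (fst y) * x ^ card (snd y))"
    proof (rule sum.cong)
      fix y assume y: "y \<in> ?P ?S1 \<times> ?Q ?S2"
      then have "fst y \<subseteq> verts G" "snd y \<subseteq> verts G" "fst y \<subseteq> C" "snd y \<inter> C = {}"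
        by auto
      then have "finite (fst y)" "finite (snd y)" "fst y \<inter> snd y = {}"
        using g(1) finite_subset by blast+
      then show "x ^ card (fst y \<union> snd y) = x ^ card (fst y) * x ^ card (snd y)"
        by (simp add: card_Un_disjoint power_add)
    qed simp
    also have "\<dots> = ?A ?S1 * ?B ?S2"
      by (simp add: sum_product sum.cartesian_product case_prod_unfold)
    finally show "boundary_poly k G S x = ?A ?S1 * ?B ?S2" .
  qed
  show ?thesis by (intro exI[of _ ?A] exI[of _ ?B] allI impI) (rule key)
qed

lemma boundary_poly_insert_isolated:
  assumes "\<And>d. d \<in># edges G \<Longrightarrow> mark G j \<notin> d"
  shows "boundary_poly k G (insert j S) x = boundary_poly k G S x"
proof -
  have "d \<subseteq> insert (mark G j) X \<longleftrightarrow> d \<subseteq> X" if "d \<in># edges G" for d X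
    using assms[OF that] by blast
  then have "indep G (insert (mark G j) X) = indep G X" for X
    unfolding indep_def by auto
  then show ?thesis unfolding boundary_poly_def boundary_sets_def by simp
qed

section \<open>Gluing and boundary polynomials\<close>

locale gluing =
  fixes k m :: nat and H :: "(nat, 'e) hypergraph" and l :: "'e \<Rightarrow> nat" and \<Phi> :: "nat \<Rightarrow> 'e"
  assumes k_pos: "1 \<le> k" and m_ge_2: "2 \<le> m" and gluing_data: "gluing_data k m H l \<Phi>"
begin

text \<open>
  The edges whose glued vertices receive no new mark.
\<close>

definition inner_edges :: "'e set" where "inner_edges = hedges H - \<Phi> ` {1..k}"

text \<open>
  The labels that the \<open>i\<close>-th copy sees as occupied when exactly the glued vertices \<open>\<tau>\<close> are.
\<close>

definition occupied :: "nat \<Rightarrow> 'e set \<Rightarrow> nat set" where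
  "occupied i \<tau> = l ` {e \<in> \<tau>. i \<in> ends H e}"

text \<open>
  The vertex that receives the new label \<open>j\<close> had the old label \<open>\<phi> j\<close> in each copy it comes from.
\<close>

definition \<phi> :: "nat \<Rightarrow> nat" where "\<phi> j = l (\<Phi> j)"

lemma hverts: "hverts H = {1..m}"
  and finite_hedges: "finite (hedges H)"
  and ends_sub: "e \<in> hedges H \<Longrightarrow> ends H e \<subseteq> {1..m}"
  and ends_ne: "e \<in> hedges H \<Longrightarrow> ends H e \<noteq> {}"
  and l_mem: "e \<in> hedges H \<Longrightarrow> l e \<in> {1..k}"
  and Phi_mem: "j \<in> {1..k} \<Longrightarrow> \<Phi> j \<in> hedges H"
  and Phi_inj: "inj_on \<Phi> {1..k}"
  using gluing_data unfolding gluing_data_def is_hypergraph_def by auto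

lemma l_inj:
  assumes "e \<in> hedges H" "e' \<in> hedges H" "i \<in> ends H e" "i \<in> ends H e'" "l e = l e'"
  shows "e = e'"
proof -
  have "i \<in> {1..m}" using ends_sub[OF assms(1)] assms(3) by (rule subsetD)
  from ex1_edge[OF gluing_data l_mem[OF assms(1)] this] show ?thesis
    using assms by metis
qed

lemma finite_inner_edges: "finite inner_edges"
  unfolding inner_edges_def using finite_hedges by simp

lemma occupied_sub: "\<tau> \<subseteq> hedges H \<Longrightarrow> occupied i \<tau> \<subseteq> {1..k}"
  unfolding occupied_def using l_mem by blast

lemma occupied_edges_sub: "\<tau> \<subseteq> inner_edges \<Longrightarrow> T \<subseteq> {1..k} \<Longrightarrow> \<tau> \<union> \<Phi> ` T \<subseteq> hedges H"
  using Phi_mem unfolding inner_edges_def by blast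

text \<open>
  The typical set of vertices after gluing, seen from the \<open>i\<close>-th copy: the glued vertices \<open>\<tau>\<close>
  appear as marked vertices, and \<open>p i\<close> is the unmarked part.
\<close>

lemma place_mem_iff:
  assumes G: "G \<in> marked_graphs k" and i: "i \<in> {1..m}" and v: "v \<in> verts G"
  shows "place k H l G i v \<in> Glued ` \<tau> \<union> (\<Union>i\<in>{1..m}. Copy i ` p i)
    \<longleftrightarrow> (if v \<in> mark G ` {1..k} then v \<in> mark G ` l ` {e \<in> \<tau>. e \<in> hedges H \<and> i \<in> ends H e} else v \<in> p i)"
proof (cases "v \<in> mark G ` {1..k}")
  case True
  then obtain j where j: "j \<in> {1..k}" "v = mark G j" by blast
  obtain e where e: "e \<in> hedges H" "i \<in> ends H e" "l e = j"
    using ex1_edge[OF gluing_data j(1) i] by auto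
  have pl: "place k H l G i v = Glued e"
    using place_marked[OF gluing_data G e(1,2)] e(3) j(2) by simp
  have "v \<in> mark G ` l ` {e \<in> \<tau>. e \<in> hedges H \<and> i \<in> ends H e} \<longleftrightarrow> e \<in> \<tau>"
  proof
    assume "v \<in> mark G ` l ` {e \<in> \<tau>. e \<in> hedges H \<and> i \<in> ends H e}"
    then obtain e' where e': "e' \<in> \<tau>" "e' \<in> hedges H" "i \<in> ends H e'" "mark G (l e') = mark G j"
      using j(2) by auto
    then have "l e' = j" using inj_onD[OF marked_graphsD(5)[OF G]] l_mem j(1) by blast
    then show "e \<in> \<tau>" using l_inj e e' by blast
  qed (use e j in auto)
  then show ?thesis using True pl by auto
qed (use i in \<open>auto simp: place_unmarked\<close>)

context
  fixes G :: "('a, 'e) vertex marked_graph"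
  assumes G: "G \<in> marked_graphs k"
begin

abbreviation "RG \<equiv> recursion k H l \<Phi> G"
abbreviation "U \<equiv> verts G - mark G ` {1..k}"

lemma verts_recursion: "verts RG = Glued ` hedges H \<union> (\<Union>i\<in>{1..m}. Copy i ` U)"
proof -
  have "verts RG = (\<Union>i\<in>{1..m}. place k H l G i ` verts G)"
    unfolding recursion_def hverts by simp
  also have "\<dots> = (\<Union>i\<in>{1..m}. place k H l G i ` (mark G ` {1..k}) \<union> place k H l G i ` U)"
  proof -
    have "verts G = mark G ` {1..k} \<union> U" using marked_graphsD(4)[OF G] by blast
    then show ?thesis by (metis image_Un)
  qed
  also have "\<dots> = (\<Union>i\<in>{1..m}. place k H l G i ` (mark G ` {1..k})) \<union> (\<Union>i\<in>{1..m}. place k H l G i ` U)"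
    by blast
  also have "(\<Union>i\<in>{1..m}. place k H l G i ` U) = (\<Union>i\<in>{1..m}. Copy i ` U)"
    by (intro SUP_cong refl image_cong) (auto simp: place_unmarked)
  also have "(\<Union>i\<in>{1..m}. place k H l G i ` (mark G ` {1..k})) = Glued ` hedges H"
  proof (intro equalityI subsetI)
    fix w :: "('a, 'e) vertex" assume "w \<in> (\<Union>i\<in>{1..m}. place k H l G i ` (mark G ` {1..k}))"
    then obtain i j where ij: "i \<in> {1..m}" "j \<in> {1..k}" "w = place k H l G i (mark G j)" by blast
    obtain e where e: "e \<in> hedges H" "i \<in> ends H e" "l e = j"
      using ex1_edge[OF gluing_data ij(2,1)] by auto
    have "w = Glued e"
      using place_marked[OF gluing_data G e(1,2)] e(3) ij(3) by simp
    then show "w \<in> Glued ` hedges H" using e(1) by simp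
  next
    fix w :: "('a, 'e) vertex" assume "w \<in> Glued ` (hedges H)"
    then obtain e where e: "e \<in> hedges H" "w = Glued e" by blast
    obtain i where i: "i \<in> ends H e" using ends_ne[OF e(1)] by blast
    have "w = place k H l G i (mark G (l e))"
      using place_marked[OF gluing_data G e(1) i] e(2) by simp
    then show "w \<in> (\<Union>i\<in>{1..m}. place k H l G i ` (mark G ` {1..k}))"
      using ends_sub[OF e(1)] i l_mem[OF e(1)] by blast
  qed
  finally show ?thesis .
qed

lemma mark_recursion: "mark RG j = Glued (\<Phi> j)"
  unfolding recursion_def by simp

lemma unmarked_recursion: "verts RG - mark RG ` {1..k} = Glued ` inner_edges \<union> (\<Union>i\<in>{1..m}. Copy i ` U)"
  unfolding verts_recursion mark_recursion inner_edges_def by auto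

lemma edges_recursion:
  "set_mset (edges RG) = (\<Union>i\<in>{1..m}. image (place k H l G i) ` set_mset (edges G))"
  unfolding recursion_def hverts by (simp add: set_mset_sum)

lemma indep_recursion:
  assumes \<tau>: "\<tau> \<subseteq> hedges H" and p: "\<And>i. i \<in> {1..m} \<Longrightarrow> p i \<subseteq> U"
  shows "indep RG (Glued ` \<tau> \<union> (\<Union>i\<in>{1..m}. Copy i ` p i))
    \<longleftrightarrow> (\<forall>i\<in>{1..m}. indep G (p i \<union> mark G ` occupied i \<tau>))"
proof -
  have eq: "place k H l G i ` d \<subseteq> Glued ` \<tau> \<union> (\<Union>i\<in>{1..m}. Copy i ` p i)
      \<longleftrightarrow> d \<subseteq> p i \<union> mark G ` occupied i \<tau>" if i: "i \<in> {1..m}" and d: "d \<in># edges G" for i d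
  proof -
    have "place k H l G i v \<in> Glued ` \<tau> \<union> (\<Union>i\<in>{1..m}. Copy i ` p i)
      \<longleftrightarrow> v \<in> p i \<union> mark G ` occupied i \<tau>" if v: "v \<in> d" for v
    proof -
      have vv: "v \<in> verts G" using marked_graphsD(2)[OF G d] v by blast
      have "mark G ` occupied i \<tau> \<subseteq> mark G ` {1..k}" using occupied_sub[OF \<tau>] by blast
      moreover have "{e \<in> \<tau>. e \<in> hedges H \<and> i \<in> ends H e} = {e \<in> \<tau>. i \<in> ends H e}" using \<tau> by auto
      ultimately show ?thesis
        unfolding place_mem_iff[OF G i vv] occupied_def[symmetric] using p[OF i]
        by (auto simp: occupied_def[symmetric])
    qed
    note pt = this
    have "(\<forall>v\<in>d. place k H l G i v \<in> Glued ` \<tau> \<union> (\<Union>i\<in>{1..m}. Copy i ` p i))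
        \<longleftrightarrow> (\<forall>v\<in>d. v \<in> p i \<union> mark G ` occupied i \<tau>)"
      by (intro ball_cong refl) (rule pt)
    then show ?thesis by (simp only: image_subset_iff subset_eq[of d])
  qed
  show ?thesis
    unfolding indep_def edges_recursion by (simp only: ball_UN ball_simps eq cong: ball_cong)
qed

text \<open>
  An independent set of the glued graph consists of a set \<open>\<tau>\<close> of occupied inner glued vertices and
  of one independent set per copy that is compatible with the marked vertices which \<open>\<tau>\<close> and \<open>T\<close>
  occupy there. Given \<open>\<tau>\<close>, the copies are independent of each other.
\<close>

lemma boundary_poly_recursion:
  assumes T: "T \<subseteq> {1..k}"
  shows "boundary_poly k RG T x =
    (\<Sum>\<tau>\<in>Pow inner_edges. x ^ card \<tau> * (\<Prod>i\<in>{1..m}. boundary_poly k G (occupied i (\<tau> \<union> \<Phi> ` T)) x))"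
proof -
  let ?B = "\<lambda>\<tau> i. boundary_sets k G (occupied i (\<tau> \<union> \<Phi> ` T))"
  let ?A = "SIGMA \<tau>:Pow inner_edges. PiE {1..m} (?B \<tau>)"
  let ?f = "\<lambda>(\<tau>, p). Glued ` \<tau> \<union> (\<Union>i\<in>{1..m}. Copy i ` p i)"
  let ?g = "\<lambda>I. (Glued -` I, restrict (\<lambda>i. Copy i -` I) {1..m})"
  have B_sub: "p \<subseteq> U" if "p \<in> ?B \<tau> i" for p \<tau> i
    using that unfolding boundary_sets_def by blast
  have ind: "indep RG (?f (\<tau>, p) \<union> mark RG ` T) \<longleftrightarrow>
      (\<forall>i\<in>{1..m}. indep G (p i \<union> mark G ` occupied i (\<tau> \<union> \<Phi> ` T)))"
    if "\<tau> \<subseteq> inner_edges" "\<And>i. i \<in> {1..m} \<Longrightarrow> p i \<subseteq> U" for \<tau> p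
  proof -
    have "?f (\<tau>, p) \<union> mark RG ` T = Glued ` (\<tau> \<union> \<Phi> ` T) \<union> (\<Union>i\<in>{1..m}. Copy i ` p i)"
      unfolding mark_recursion by auto
    then show ?thesis using indep_recursion[OF occupied_edges_sub[OF that(1) T] that(2)] by simp
  qed
  have core: "?g I \<in> ?A \<and> ?f (?g I) = I" if "I \<in> boundary_sets k RG T" for I
  proof -
    have I: "I \<subseteq> Glued ` inner_edges \<union> (\<Union>i\<in>{1..m}. Copy i ` U)" "indep RG (I \<union> mark RG ` T)"
      using that unfolding boundary_sets_def unmarked_recursion by auto
    let ?\<tau> = "Glued -` I" and ?p = "restrict (\<lambda>i. Copy i -` I) {1..m}"
    have "x \<in> ?f (?\<tau>, ?p)" if x: "x \<in> I" for x
    proof -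
      from I(1) x have "x \<in> Glued ` inner_edges \<union> (\<Union>i\<in>{1..m}. Copy i ` U)" by (rule subsetD)
      then consider e where "x = Glued e" | i v where "i \<in> {1..m}" "x = Copy i v" by blast
      then show ?thesis
      proof cases
        case (2 i v)
        then have "x \<in> Copy i ` ?p i" using x by simp
        then show ?thesis using 2(1) by blast
      qed (use x in auto)
    qed
    then have eq: "?f (?\<tau>, ?p) = I" by auto
    have t: "?\<tau> \<subseteq> inner_edges" using I(1) by auto
    have pU: "?p i \<subseteq> U" if "i \<in> {1..m}" for i using I(1) that by auto
    have ii: "\<forall>i\<in>{1..m}. indep G (?p i \<union> mark G ` occupied i (?\<tau> \<union> \<Phi> ` T))"
    proof (rule ind[OF t pU, THEN iffD1])
      show "indep RG (?f (?\<tau>, ?p) \<union> mark RG ` T)" unfolding eq by (rule I(2))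
    qed
    have "?p i \<in> ?B ?\<tau> i" if "i \<in> {1..m}" for i
      unfolding boundary_sets_def mem_Collect_eq using pU[OF that] ii that by blast
    then have "?p \<in> PiE {1..m} (?B ?\<tau>)" unfolding PiE_iff by simp
    then have "(?\<tau>, ?p) \<in> ?A" using t by blast
    with eq show ?thesis by simp
  qed
  have bij: "bij_betw ?f ?A (boundary_sets k RG T)"
  proof (rule bij_betwI[where g = ?g])
    show "?f \<in> ?A \<rightarrow> boundary_sets k RG T"
    proof (rule funcsetI)
      fix y assume y: "y \<in> ?A"
      obtain \<tau> p where tp: "y = (\<tau>, p)" "\<tau> \<subseteq> inner_edges" "p \<in> PiE {1..m} (?B \<tau>)"
        using y by blast
      have p: "p i \<in> ?B \<tau> i" if "i \<in> {1..m}" for i using tp(3) that by blast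
      then have pU: "p i \<subseteq> U" if "i \<in> {1..m}" for i using B_sub that by blast
      have "indep RG (?f (\<tau>, p) \<union> mark RG ` T)"
      proof (rule ind[OF tp(2) pU, THEN iffD2])
        show "\<forall>i\<in>{1..m}. indep G (p i \<union> mark G ` occupied i (\<tau> \<union> \<Phi> ` T))"
          using p unfolding boundary_sets_def by blast
      qed
      moreover have "?f (\<tau>, p) \<subseteq> Glued ` inner_edges \<union> (\<Union>i\<in>{1..m}. Copy i ` U)"
        unfolding prod.case by (intro Un_mono image_mono UN_mono subset_refl tp(2) pU)
      ultimately show "?f y \<in> boundary_sets k RG T"
        unfolding boundary_sets_def unmarked_recursion tp(1) by blast
    qed
    show "?g \<in> boundary_sets k RG T \<rightarrow> ?A" using core by (intro funcsetI) blast
    show "?f (?g I) = I" if "I \<in> boundary_sets k RG T" for I using core[OF that] by blast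
  next
    fix y assume y: "y \<in> ?A"
    obtain \<tau> p where tp: "y = (\<tau>, p)" "\<tau> \<subseteq> inner_edges" "p \<in> PiE {1..m} (?B \<tau>)"
      using y by blast
    have "Copy i -` ?f (\<tau>, p) = p i" if "i \<in> {1..m}" for i
    proof
      show "p i \<subseteq> Copy i -` ?f (\<tau>, p)" unfolding prod.case using that by blast
    qed auto
    then have "restrict (\<lambda>i. Copy i -` ?f (\<tau>, p)) {1..m} = restrict p {1..m}"
      by (intro restrict_ext)
    then have "restrict (\<lambda>i. Copy i -` ?f (\<tau>, p)) {1..m} = p"
      using PiE_restrict[OF tp(3)] by simp
    moreover have "Glued -` ?f (\<tau>, p) = \<tau>" by auto
    ultimately show "?g (?f y) = y" using tp(1) by simp
  qed
  have crd: "x ^ card (?f y) = x ^ card (fst y) * (\<Prod>i\<in>{1..m}. x ^ card (snd y i))" if y: "y \<in> ?A" for y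
  proof -
    obtain \<tau> p where tp: "y = (\<tau>, p)" "\<tau> \<subseteq> inner_edges" "p \<in> PiE {1..m} (?B \<tau>)"
      using y by blast
    have pU: "p i \<subseteq> U" if "i \<in> {1..m}" for i using tp(3) B_sub that by blast
    have fin: "finite (p i)" if "i \<in> {1..m}" for i
      using pU[OF that] marked_graphsD(1)[OF G] finite_subset by blast
    have ft: "finite \<tau>" using tp(2) finite_inner_edges finite_subset by blast
    have "card (\<Union>i\<in>{1..m}. Copy i ` p i) = (\<Sum>i\<in>{1..m}. card (Copy i ` p i :: ('a, 'e) vertex set))"
      using fin by (intro card_UN_disjoint) auto
    also have "\<dots> = (\<Sum>i\<in>{1..m}. card (p i))"
      by (intro sum.cong refl card_image) (auto simp: inj_on_def)
    finally have c1: "card (\<Union>i\<in>{1..m}. Copy i ` p i) = (\<Sum>i\<in>{1..m}. card (p i))" .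
    have c2: "card (Glued ` \<tau> :: ('a, 'e) vertex set) = card \<tau>"
      by (intro card_image) (auto simp: inj_on_def)
    have "card (?f (\<tau>, p)) = card (Glued ` \<tau> :: ('a, 'e) vertex set) + card (\<Union>i\<in>{1..m}. Copy i ` p i)"
      unfolding prod.case by (rule card_Un_disjoint) (use ft fin in auto)
    then show ?thesis unfolding c1 c2 tp(1) by (simp add: power_add power_sum)
  qed
  have "boundary_poly k RG T x = (\<Sum>y\<in>?A. x ^ card (?f y))"
    unfolding boundary_poly_def using sum.reindex_bij_betw[OF bij, of "\<lambda>I. x ^ card I"] by simp
  also have "\<dots> = (\<Sum>y\<in>?A. x ^ card (fst y) * (\<Prod>i\<in>{1..m}. x ^ card (snd y i)))"
    by (rule sum.cong) (use crd in auto)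
  also have "\<dots> = (\<Sum>\<tau>\<in>Pow inner_edges. \<Sum>p\<in>PiE {1..m} (?B \<tau>). x ^ card \<tau> * (\<Prod>i\<in>{1..m}. x ^ card (p i)))"
    by (subst sum.Sigma) (auto simp: finite_inner_edges finite_boundary_sets[OF G] case_prod_unfold intro!: finite_PiE)
  also have "\<dots> = (\<Sum>\<tau>\<in>Pow inner_edges. x ^ card \<tau> * (\<Prod>i\<in>{1..m}. \<Sum>I\<in>?B \<tau> i. x ^ card I))"
    by (simp add: sum_distrib_left[symmetric] prod_sum_PiE finite_boundary_sets[OF G])
  finally show ?thesis unfolding boundary_poly_def .
qed

lemma card_unmarked_recursion:
  "card (verts RG - mark RG ` {1..k}) = card inner_edges + m * card U"
proof -
  have fin: "finite U" using marked_graphsD(1)[OF G] by simp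
  have "card (\<Union>i\<in>{1..m}. Copy i ` U) = (\<Sum>i\<in>{1..m}. card (Copy i ` U :: ('a, 'e) vertex set))"
    using fin by (intro card_UN_disjoint) auto
  also have "\<dots> = (\<Sum>i\<in>{1..m}. card U)"
    by (intro sum.cong refl card_image) (auto simp: inj_on_def)
  finally have c1: "card (\<Union>i\<in>{1..m}. Copy i ` U :: ('a, 'e) vertex set) = m * card U" by simp
  have c2: "card (Glued ` inner_edges :: ('a, 'e) vertex set) = card inner_edges"
    by (intro card_image) (auto simp: inj_on_def)
  have "card (Glued ` inner_edges \<union> (\<Union>i\<in>{1..m}. Copy i ` U) :: ('a, 'e) vertex set)
      = card (Glued ` inner_edges :: ('a, 'e) vertex set) + card (\<Union>i\<in>{1..m}. Copy i ` U :: ('a, 'e) vertex set)"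
    by (rule card_Un_disjoint) (use fin finite_inner_edges in auto)
  then show ?thesis unfolding unmarked_recursion c1 c2 .
qed

end

end

section \<open>Distances and degrees under gluing\<close>

lemma distance_le_adjacent:
  assumes G: "G \<in> marked_graphs k" and "u \<noteq> v" "adjacent G u v"
  shows "distance G u v \<le> 1"
proof -
  have "[u, v] \<in> paths G u v"
    using assms marked_graphsD(2)[OF G, of "{u, v}"] unfolding paths_def adjacent_def by auto
  then have "distance G u v \<le> enat (length [u, v] - 1)"
    unfolding distance_def by (rule INF_lower)
  then show ?thesis by (simp add: one_enat_def)
qed

lemma indep_marks:
  assumes G: "G \<in> marked_graphs k" and "min_mark_distance k G > 1" and S: "S \<subseteq> {1..k}"
  shows "indep G (mark G ` S)"
  unfolding indep_def
proof (intro ballI notI)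
  fix d assume d: "d \<in># edges G" "d \<subseteq> mark G ` S"
  obtain u v where uv: "d = {u, v}" "u \<noteq> v"
    using marked_graphsD(3)[OF G d(1)] card_2_iff by metis
  obtain i j where ij: "i \<in> S" "u = mark G i" "j \<in> S" "v = mark G j"
    using d(2) uv(1) by auto
  have "min_mark_distance k G \<le> distance G u v"
    unfolding min_mark_distance_def
  proof (rule Inf_lower, rule CollectI, intro exI conjI)
    show "distance G u v = distance G (mark G i) (mark G j)" using ij by simp
  qed (use ij uv(2) S in auto)
  also have "\<dots> \<le> 1"
    by (rule distance_le_adjacent[OF G uv(2)]) (use d uv in \<open>simp add: adjacent_def\<close>)
  finally show False using assms(2) by simp
qed

text \<open>
  Paths have distinct vertices, so a path that already visits \<open>w\<close> is cut there instead of being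
  prolonged.
\<close>

lemma path_extend:
  assumes G: "G \<in> marked_graphs k" and p: "p \<in> paths G u v" and a: "adjacent G v w"
  shows "paths G u w \<noteq> {}"
proof (cases "w \<in> set p")
  case True
  then obtain ys zs where s: "p = ys @ w # zs" by (meson split_list)
  then have "ys @ [w] \<in> paths G u w"
    using p unfolding paths_def by (auto simp: successively_append_iff hd_append)
  then show ?thesis by blast
next
  case False
  have "{v, w} \<subseteq> verts G" using marked_graphsD(2)[OF G] a unfolding adjacent_def by blast
  then have "p @ [w] \<in> paths G u w"
    using p a False unfolding paths_def by (auto simp: successively_append_iff hd_append)
  then show ?thesis by blast
qed

text \<open>
  Marked vertices in other components than that of \<open>j\<close> do not change the effect of occupying \<open>j\<close>.
  The statement is cross-multiplied because the polynomials may vanish at \<open>x\<close>.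
\<close>

lemma boundary_poly_far:
  fixes x :: "'b::comm_semiring_1"
  assumes G: "G \<in> marked_graphs k" and j: "j \<in> {1..k}"
    and \<sigma>: "\<sigma> \<subseteq> {1..k}" "\<sigma>' \<subseteq> {1..k}"
    and far: "\<And>b. b \<in> (\<sigma> - \<sigma>') \<union> (\<sigma>' - \<sigma>) \<Longrightarrow> distance G (mark G j) (mark G b) = \<infinity>"
  shows "boundary_poly k G (insert j \<sigma>) x * boundary_poly k G \<sigma>' x
       = boundary_poly k G (insert j \<sigma>') x * boundary_poly k G \<sigma> x"
proof -
  define C where "C = {v \<in> verts G. paths G (mark G j) v \<noteq> {}}"
  have "d \<subseteq> C \<or> d \<inter> C = {}" if d: "d \<in># edges G" for d
  proof -
    obtain u v where uv: "d = {u, v}" "u \<noteq> v"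
      using marked_graphsD(3)[OF G d(1)] card_2_iff by metis
    have "{u, v} \<subseteq> verts G" "adjacent G u v" "adjacent G v u"
      using marked_graphsD(2)[OF G d] d uv unfolding adjacent_def by (auto simp: insert_commute)
    then have "u \<in> C \<longleftrightarrow> v \<in> C" unfolding C_def using path_extend[OF G] by blast
    then show ?thesis using uv by auto
  qed
  moreover have "C \<subseteq> verts G" unfolding C_def by auto
  ultimately obtain A B :: "nat set \<Rightarrow> 'b" where AB: "\<And>S. S \<subseteq> {1..k} \<Longrightarrow>
      boundary_poly k G S x = A {j \<in> S. mark G j \<in> C} * B {j \<in> S. mark G j \<notin> C}"
    using boundary_poly_split[OF G, of C x] by blast
  have far': "mark G b \<notin> C" if "b \<in> (\<sigma> - \<sigma>') \<union> (\<sigma>' - \<sigma>)" for b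
  proof
    assume "mark G b \<in> C"
    then obtain p where "p \<in> paths G (mark G j) (mark G b)" unfolding C_def by blast
    then have "distance G (mark G j) (mark G b) \<le> enat (length p - 1)"
      unfolding distance_def by (rule INF_lower)
    then show False using far[OF that] by simp
  qed
  have "[mark G j] \<in> paths G (mark G j) (mark G j)"
    using marked_graphsD(4)[OF G j] unfolding paths_def by simp
  then have jC: "mark G j \<in> C" using marked_graphsD(4)[OF G j] unfolding C_def by blast
  have 1: "{b \<in> \<sigma>. mark G b \<in> C} = {b \<in> \<sigma>'. mark G b \<in> C}" using far' by blast
  then have 2: "{b \<in> insert j \<sigma>. mark G b \<in> C} = {b \<in> insert j \<sigma>'. mark G b \<in> C}" by blast
  have 3: "{b \<in> insert j \<sigma>. mark G b \<notin> C} = {b \<in> \<sigma>. mark G b \<notin> C}"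
    "{b \<in> insert j \<sigma>'. mark G b \<notin> C} = {b \<in> \<sigma>'. mark G b \<notin> C}" using jC by auto
  have 4: "insert j \<sigma> \<subseteq> {1..k}" "insert j \<sigma>' \<subseteq> {1..k}" using j \<sigma> by auto
  show ?thesis
    unfolding AB[OF 4(1)] AB[OF 4(2)] AB[OF \<sigma>(1)] AB[OF \<sigma>(2)] 1 2 3 by (simp add: mult_ac)
qed

context gluing
begin

text \<open>
  A path inside one copy survives the gluing. So two labels inherited from a common copy are at
  most as far apart as before; this is how the divergence of distances constrains the gluing data.
\<close>

lemma distance_recursion_le:
  assumes G: "G \<in> marked_graphs k" and j: "a \<in> {1..k}" "b \<in> {1..k}"
    and i: "i \<in> ends H (\<Phi> a)" "i \<in> ends H (\<Phi> b)"
  shows "distance (recursion k H l \<Phi> G) (Glued (\<Phi> a)) (Glued (\<Phi> b))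
    \<le> distance G (mark G (\<phi> a)) (mark G (\<phi> b))"
proof -
  let ?R = "recursion k H l \<Phi> G" and ?f = "place k H l G i"
  have im: "i \<in> {1..m}" using ends_sub[OF Phi_mem[OF j(1)]] i(1) by blast
  have ends: "?f (mark G (\<phi> a)) = Glued (\<Phi> a)" "?f (mark G (\<phi> b)) = Glued (\<Phi> b)"
    unfolding \<phi>_def using place_marked[OF gluing_data G Phi_mem] i j by blast+
  have inj: "inj_on ?f X" for X
    by (rule inj_onI) (use place_eq_iff[OF gluing_data G im im] in auto)
  have adj: "adjacent ?R (?f u) (?f v)" if "adjacent G u v" for u v
  proof -
    have "?f ` {u, v} \<in> set_mset (edges ?R)"
      unfolding edges_recursion[OF G] using that im unfolding adjacent_def by blast
    then show ?thesis unfolding adjacent_def by simp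
  qed
  have "map ?f p \<in> paths ?R (Glued (\<Phi> a)) (Glued (\<Phi> b))"
    if "p \<in> paths G (mark G (\<phi> a)) (mark G (\<phi> b))" for p
  proof -
    have p: "p \<noteq> []" "hd p = mark G (\<phi> a)" "last p = mark G (\<phi> b)" "distinct p" "set p \<subseteq> verts G"
      "successively (adjacent G) p" using that unfolding paths_def by auto
    have "successively (adjacent ?R) (map ?f p)"
      unfolding successively_map by (rule successively_mono[OF p(6)]) (use adj in auto)
    moreover have "set (map ?f p) \<subseteq> verts ?R"
    proof -
      have "?f ` verts G \<subseteq> verts ?R"
        unfolding recursion_def hverts marked_graph.simps using im by blast
      then show ?thesis using p(5) by auto
    qed
    ultimately show ?thesis
      using p ends inj unfolding paths_def by (auto simp: hd_map last_map distinct_map)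
  qed
  then show ?thesis
    unfolding distance_def
    by (intro INF_greatest) (metis INF_lower length_map)
qed

text \<open>
  Every edge at a glued vertex comes from one of the identified copies, each of which contributes
  its full degree.
\<close>

lemma degree_recursion_ge:
  assumes G: "G \<in> marked_graphs k" and j: "j \<in> {1..k}"
  shows "card (ends H (\<Phi> j)) * degree G (mark G (\<phi> j))
    \<le> degree (recursion k H l \<Phi> G) (Glued (\<Phi> j))"
proof -
  let ?f = "place k H l G" and ?v = "mark G (\<phi> j)"
  have "degree (recursion k H l \<Phi> G) (Glued (\<Phi> j))
      = (\<Sum>i\<in>{1..m}. size (filter_mset (\<lambda>e. Glued (\<Phi> j) \<in> e) (image_mset (image (?f i)) (edges G))))"
  proof -
    have f: "filter_mset P (\<Sum>i\<in>A. M i) = (\<Sum>i\<in>A. filter_mset P (M i))"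
      if "finite A" for P :: "'z \<Rightarrow> bool" and A :: "nat set" and M
      using that by (induction A) auto
    have s: "size (\<Sum>i\<in>A. M i) = (\<Sum>i\<in>A. size (M i))"
      if "finite A" for A :: "nat set" and M :: "nat \<Rightarrow> 'z multiset"
      using that by (induction A) auto
    show ?thesis unfolding degree_def recursion_def hverts by (simp add: f s)
  qed
  moreover have "\<dots> \<ge> (\<Sum>i\<in>ends H (\<Phi> j). size (filter_mset (\<lambda>e. Glued (\<Phi> j) \<in> e) (image_mset (image (?f i)) (edges G))))"
    by (rule sum_mono2) (use ends_sub[OF Phi_mem[OF j]] in auto)
  moreover have "(\<Sum>i\<in>ends H (\<Phi> j). size (filter_mset (\<lambda>e. Glued (\<Phi> j) \<in> e) (image_mset (image (?f i)) (edges G))))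
      \<ge> (\<Sum>i\<in>ends H (\<Phi> j). degree G ?v)"
  proof (rule sum_mono)
    fix i assume i: "i \<in> ends H (\<Phi> j)"
    have pl: "?f i ?v = Glued (\<Phi> j)"
      unfolding \<phi>_def using place_marked[OF gluing_data G Phi_mem[OF j] i] .
    have "degree G ?v \<le> size (filter_mset (\<lambda>e. Glued (\<Phi> j) \<in> ?f i ` e) (edges G))"
      unfolding degree_def
      by (intro size_mset_mono filter_mset_mono_strong) (use pl in \<open>auto intro: rev_image_eqI\<close>)
    also have "\<dots> = size (filter_mset (\<lambda>e. Glued (\<Phi> j) \<in> e) (image_mset (image (?f i)) (edges G)))"
      by (simp add: filter_mset_image_mset)
    finally show "degree G ?v \<le> size (filter_mset (\<lambda>e. Glued (\<Phi> j) \<in> e) (image_mset (image (?f i)) (edges G)))" .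
  qed
  ultimately show ?thesis by simp
qed

end

section \<open>Averages with nearly positive weights\<close>

text \<open>
  Relative closeness to a positive number. In this form the errors multiply when numbers do,
  see \<open>near_mult\<close>.
\<close>

definition near :: "real \<Rightarrow> complex \<Rightarrow> real \<Rightarrow> bool" where
  "near a z t \<longleftrightarrow> 0 < t \<and> norm (z - of_real t) \<le> (a - 1) * t"

lemma near_self: "0 < t \<Longrightarrow> 1 \<le> a \<Longrightarrow> near a (of_real t) t"
  unfolding near_def by simp

lemma near_ge_1: "near a z t \<Longrightarrow> 1 \<le> a"
  unfolding near_def by (metis diff_ge_0_iff_ge norm_ge_zero order_trans zero_le_mult_iff not_less)

lemma near_mono: "near a z t \<Longrightarrow> a \<le> b \<Longrightarrow> near b z t"
  unfolding near_def by (meson diff_right_mono mult_right_mono order.strict_implies_order order_trans)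

lemma near_mult:
  assumes "near a z t" "near b w s"
  shows "near (a * b) (z * w) (t * s)"
proof -
  have t: "0 < t" "0 < s" and n: "norm (z - of_real t) \<le> (a - 1) * t" "norm (w - of_real s) \<le> (b - 1) * s"
    using assms unfolding near_def by auto
  have "z * w - of_real (t * s)
      = (z - of_real t) * (w - of_real s) + (z - of_real t) * of_real s + of_real t * (w - of_real s)"
    by (simp add: algebra_simps)
  also have "norm \<dots> \<le> norm (z - of_real t) * norm (w - of_real s) + norm (z - of_real t) * s
      + t * norm (w - of_real s)"
    using t by (intro order_trans[OF norm_triangle_ineq] add_mono) (simp_all add: norm_mult)
  also have "\<dots> \<le> ((a - 1) * t) * ((b - 1) * s) + ((a - 1) * t) * s + t * ((b - 1) * s)"
    using n t order_trans[OF norm_ge_zero n(1)]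
    by (intro add_mono mult_mono) auto
  also have "\<dots> = (a * b - 1) * (t * s)" by (simp add: algebra_simps)
  finally show ?thesis unfolding near_def using t by simp
qed

lemma near_prod:
  assumes "finite A" "\<And>i. i \<in> A \<Longrightarrow> near a (f i) (t i)"
  shows "near (a ^ card A) (\<Prod>i\<in>A. f i) (\<Prod>i\<in>A. t i)"
  using assms
proof (induction A)
  case empty
  then show ?case by (simp add: near_def)
next
  case (insert i A)
  then show ?case using near_mult[of a "f i" "t i"] by simp
qed

lemma near_power: "near a z t \<Longrightarrow> near (a ^ n) (z ^ n) (t ^ n)"
  using near_prod[of "{..<n}" a "\<lambda>_. z" "\<lambda>_. t"] by simp

lemma near_nonzero: "near a z t \<Longrightarrow> a < 2 \<Longrightarrow> z \<noteq> 0"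
proof
  assume n: "near a z t" "a < 2" "z = 0"
  then have "t \<le> (a - 1) * t" "0 < t" unfolding near_def by auto
  then show False using n(2) by simp
qed

text \<open>
  Complex weights that imitate a probability distribution with mass at least \<open>c\<close> at \<open>y0\<close>: for
  \<open>e = 0\<close> the inequality says precisely that \<open>P\<close> is such a distribution; \<open>e\<close> is the
  tolerated excess of the total variation.
\<close>

definition weights :: "real \<Rightarrow> real \<Rightarrow> 'y set \<Rightarrow> 'y \<Rightarrow> ('y \<Rightarrow> complex) \<Rightarrow> bool" where
  "weights c e Y y0 P \<longleftrightarrow> (\<Sum>y\<in>Y. P y) = 1
     \<and> norm (P y0 - of_real c) + (\<Sum>y\<in>Y - {y0}. norm (P y)) \<le> 1 - c + e"

lemma weights_average:
  assumes w: "weights c e Y y0 P" and Y: "finite Y" "y0 \<in> Y" and c: "0 \<le> c" and M: "0 \<le> M"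
    and f: "\<And>y. y \<in> Y \<Longrightarrow> norm (f y - v) \<le> M"
  shows "norm ((\<Sum>y\<in>Y. P y * f y) - v) \<le> (1 + e) * M"
proof -
  have "(\<Sum>y\<in>Y. norm (P y)) = norm (P y0) + (\<Sum>y\<in>Y - {y0}. norm (P y))"
    using Y by (simp add: sum.remove)
  moreover have "norm (P y0) \<le> norm (P y0 - of_real c) + c"
    using norm_triangle_sub[of "P y0" "of_real c"] c by simp
  ultimately have S: "(\<Sum>y\<in>Y. norm (P y)) \<le> 1 + e" using w unfolding weights_def by linarith
  have "(\<Sum>y\<in>Y. P y * f y) - v = (\<Sum>y\<in>Y. P y * f y) - (\<Sum>y\<in>Y. P y) * v"
    using w unfolding weights_def by simp
  also have "\<dots> = (\<Sum>y\<in>Y. P y * (f y - v))"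
    by (simp add: algebra_simps sum_subtractf sum_distrib_left)
  also have "norm \<dots> \<le> (\<Sum>y\<in>Y. norm (P y) * M)"
    using f by (intro sum_norm_le) (simp add: norm_mult mult_left_mono)
  also have "\<dots> \<le> (1 + e) * M"
    using S M by (simp add: sum_distrib_right[symmetric] mult_right_mono)
  finally show ?thesis .
qed

text \<open>
  The common mass \<open>c\<close> at \<open>y0\<close> contributes only \<open>L\<close> (Doeblin's coupling). The remainders \<open>Q P\<close> and
  \<open>Q P'\<close> have the same total \<open>1 - c\<close>, so their difference can be written as a double sum over
  differences \<open>f y - f' y'\<close>.
\<close>

lemma weights_contract:
  assumes w: "weights c e Y y0 P" "weights c e Y y0 P'" and Y: "finite Y" "y0 \<in> Y"
    and c: "0 \<le> c" "c \<le> 1 / 2" and e: "0 \<le> e" "e \<le> 1" and M: "0 \<le> M"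
    and f: "\<And>y y'. y \<in> Y \<Longrightarrow> y' \<in> Y \<Longrightarrow> norm (f y - f' y') \<le> M"
    and L: "norm (f y0 - f' y0) \<le> L"
  shows "norm ((\<Sum>y\<in>Y. P y * f y) - (\<Sum>y\<in>Y. P' y * f' y)) \<le> c * L + (1 - c + 4 * e) * M"
proof -
  define Q where "Q = (\<lambda>P y. P y - (if y = y0 then of_real c else (0::complex)))"
  have Qsum: "(\<Sum>y\<in>Y. Q P y) = of_real (1 - c)" if "weights c e Y y0 P" for P
    using that Y unfolding Q_def weights_def by (simp add: sum_subtractf)
  have Qn: "(\<Sum>y\<in>Y. norm (Q P y)) \<le> 1 - c + e" if "weights c e Y y0 P" for P
  proof -
    have "(\<Sum>y\<in>Y. norm (Q P y)) = norm (Q P y0) + (\<Sum>y\<in>Y - {y0}. norm (Q P y))"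
      using Y by (simp add: sum.remove)
    also have "(\<Sum>y\<in>Y - {y0}. norm (Q P y)) = (\<Sum>y\<in>Y - {y0}. norm (P y))"
      by (intro sum.cong) (auto simp: Q_def)
    finally show ?thesis using that unfolding weights_def Q_def by simp
  qed
  \<comment> \<open>The mass \<open>c\<close> at \<open>y0\<close> is split off; \<open>Q P\<close> is the rest.\<close>
  have dec: "(\<Sum>y\<in>Y. P y * f y) = of_real c * f y0 + (\<Sum>y\<in>Y. Q P y * f y)" for P f
  proof -
    have "(\<Sum>y\<in>Y. (if y = y0 then of_real c else 0) * f y) = of_real c * f y0"
      using Y by (simp add: if_distrib[of "\<lambda>x. x * _"] cong: if_cong)
    then show ?thesis unfolding Q_def by (simp add: left_diff_distrib sum_subtractf)
  qed
  define D where "D = (\<Sum>y\<in>Y. Q P y * f y) - (\<Sum>y\<in>Y. Q P' y * f' y)"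
  have "of_real (1 - c) * D
      = (\<Sum>y\<in>Y. Q P y * f y) * (\<Sum>y'\<in>Y. Q P' y') - (\<Sum>y\<in>Y. Q P y) * (\<Sum>y'\<in>Y. Q P' y' * f' y')"
    unfolding D_def Qsum[OF w(1)] Qsum[OF w(2)] by (simp add: algebra_simps)
  also have "\<dots> = (\<Sum>y\<in>Y. \<Sum>y'\<in>Y. Q P y * Q P' y' * (f y - f' y'))"
    unfolding sum_product sum_subtractf[symmetric]
    by (intro sum.cong refl) (simp add: algebra_simps)
  finally have "norm (of_real (1 - c) * D) = norm (\<Sum>y\<in>Y. \<Sum>y'\<in>Y. Q P y * Q P' y' * (f y - f' y'))"
    by simp
  also have "\<dots> \<le> (\<Sum>y\<in>Y. \<Sum>y'\<in>Y. norm (Q P y) * norm (Q P' y') * M)"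
    using f by (intro sum_norm_le) (simp add: norm_mult mult_left_mono)
  also have "\<dots> = (\<Sum>y\<in>Y. norm (Q P y)) * (\<Sum>y\<in>Y. norm (Q P' y)) * M"
    unfolding sum_product unfolding sum_distrib_right ..
  also have "\<dots> \<le> (1 - c + e) * (1 - c + e) * M"
    using Qn[OF w(1)] Qn[OF w(2)] M c e by (intro mult_mono mult_nonneg_nonneg sum_nonneg) auto
  also have "\<dots> \<le> (1 - c) * ((1 - c + 4 * e) * M)"
  proof -
    have "e * e \<le> e" using e by (simp add: mult_left_le)
    then have "(1 - c + e) * (1 - c + e) \<le> (1 - c) * (1 - c) + 2 * (1 - c) * e + e"
      by (simp add: algebra_simps)
    also have "\<dots> \<le> (1 - c) * (1 - c) + 2 * (1 - c) * e + (2 * (1 - c)) * e"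
      using e c by (intro add_left_mono) (simp add: mult_le_cancel_right1)
    also have "\<dots> = (1 - c) * (1 - c + 4 * e)" by (simp add: algebra_simps)
    finally show ?thesis using M by (simp add: mult_right_mono mult.assoc[symmetric])
  qed
  finally have "(1 - c) * norm D \<le> (1 - c) * ((1 - c + 4 * e) * M)"
    using c by (simp add: norm_mult del: of_real_diff)
  then have "norm D \<le> (1 - c + 4 * e) * M" using c by (simp add: mult_le_cancel_left)
  moreover have "norm (of_real c * (f y0 - f' y0)) \<le> c * L"
    using c L by (simp add: norm_mult mult_left_mono)
  moreover have "(\<Sum>y\<in>Y. P y * f y) - (\<Sum>y\<in>Y. P' y * f' y) = of_real c * (f y0 - f' y0) + D"
    unfolding dec[of P] dec[of P'] D_def by (simp add: algebra_simps)
  ultimately show ?thesis by (smt (verit) norm_triangle_ineq)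
qed

text \<open>
  Weights close to positive numbers give, after normalisation, weights close to a probability
  distribution. In the latter the mass at \<open>y0\<close> is at least \<open>1 / X\<close>; half of this is used as the Doeblin constant, so
  that \<open>weights_contract\<close> applies with \<open>1 - c\<close> bounded away from \<open>0\<close>.
\<close>

lemma near_weights:
  assumes Y: "finite Y" "y0 \<in> Y" and g: "\<And>y. y \<in> Y \<Longrightarrow> near a (g y) (t y)" "g y0 = 1" "t y0 = 1"
    and X: "(\<Sum>y\<in>Y. t y) \<le> X" and a: "a \<le> 3 / 2"
  shows "1 / 2 \<le> Re (\<Sum>y\<in>Y. g y)" "norm (\<Sum>y\<in>Y. g y) \<le> 2 * X"
    "weights (1 / (2 * X)) (8 * (a - 1)) Y y0 (\<lambda>y. g y / (\<Sum>y\<in>Y. g y))"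
proof -
  define u where "u = a - 1"
  define G where "G = (\<Sum>y\<in>Y. g y)"
  define T where "T = (\<Sum>y\<in>Y. t y)"
  define c where "c = 1 / (2 * X)"
  have tp: "0 < t y" "norm (g y - of_real (t y)) \<le> u * t y" if "y \<in> Y" for y
    using g(1)[OF that] unfolding near_def u_def by auto
  have u: "0 \<le> u" "u \<le> 1 / 2" using near_ge_1[OF g(1)[OF Y(2)]] a unfolding u_def by auto
  have T1: "1 \<le> T" 
    unfolding T_def using member_le_sum[of y0 Y t] Y tp(1) g(3) by (simp add: less_imp_le)
  have TX: "T \<le> X" using X unfolding T_def .
  have GT: "norm (G - of_real T) \<le> u * T"
  proof -
    have "norm (G - of_real T) = norm (\<Sum>y\<in>Y. g y - of_real (t y))"
      unfolding G_def T_def by (simp add: sum_subtractf)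
    also have "\<dots> \<le> (\<Sum>y\<in>Y. u * t y)" using tp by (intro sum_norm_le) auto
    finally show ?thesis unfolding T_def by (simp add: sum_distrib_left)
  qed
  have "\<bar>Re (G - of_real T)\<bar> \<le> u * T" using GT abs_Re_le_cmod order_trans by blast
  then have "T - u * T \<le> Re G" by simp
  moreover have uT: "u * T \<le> T / 2" using u T1 mult_right_mono[of u "1/2" T] by simp
  ultimately show "1 / 2 \<le> Re (\<Sum>y\<in>Y. g y)" using T1 unfolding G_def by linarith
  have "norm G \<le> T + u * T" using GT norm_triangle_sub[of G "of_real T"] T1 by simp
  then show "norm (\<Sum>y\<in>Y. g y) \<le> 2 * X" using uT TX T1 unfolding G_def by linarith
  have Gl: "(1 - u) * T \<le> norm G"
    using GT norm_triangle_sub[of "of_real T" G] T1 by (simp add: norm_minus_commute algebra_simps)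
  moreover have half: "1 / 2 \<le> (1 - u) * T" using u T1 mult_mono[of "1/2" "1 - u" 1 T] by simp
  ultimately have Gp: "0 < norm G" by linarith
  then have G0: "G \<noteq> 0" by auto
  have sumP: "(\<Sum>y\<in>Y. norm (g y / G)) \<le> 1 + 4 * u"
  proof -
    have "(\<Sum>y\<in>Y. norm (g y)) \<le> (\<Sum>y\<in>Y. t y + u * t y)"
    proof (rule sum_mono)
      fix y assume "y \<in> Y"
      then show "norm (g y) \<le> t y + u * t y"
        using tp[of y] norm_triangle_sub[of "g y" "of_real (t y)"] by simp
    qed
    also have "\<dots> = (1 + u) * T" unfolding T_def by (simp add: algebra_simps sum.distrib sum_distrib_left)
    also have "\<dots> \<le> ((1 + 4 * u) * (1 - u)) * T"
    proof (rule mult_right_mono)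
      have "u * u \<le> u * (1 / 2)" using u by (intro mult_left_mono) auto
      then show "1 + u \<le> (1 + 4 * u) * (1 - u)" by (simp add: algebra_simps)
    qed (use T1 in auto)
    also have "\<dots> \<le> (1 + 4 * u) * norm G"
      using mult_left_mono[OF Gl, of "1 + 4 * u"] u by (simp add: mult.assoc)
    finally show ?thesis
      using Gp by (simp add: norm_divide sum_divide_distrib[symmetric] divide_le_eq)
  qed
  have c: "0 < c" "c \<le> 1 / T" "c \<le> 1 / 2"
    using T1 TX unfolding c_def by (auto simp: field_simps)
  have d: "norm (1 / G - of_real (1 / T)) \<le> 2 * u"
  proof -
    have "1 / G - of_real (1 / T) = (of_real T - G) / (G * of_real T)"
      using G0 T1 by (simp add: field_simps)
    then have "norm (1 / G - of_real (1 / T)) = norm (G - of_real T) / (norm G * T)"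
      using T1 by (simp add: norm_divide norm_mult norm_minus_commute)
    also have "\<dots> \<le> (u * T) / (1 / 2 * T)"
      using GT T1 Gl half u by (intro frac_le mult_right_mono) auto
    also have "\<dots> = 2 * u" using T1 by simp
    finally show ?thesis .
  qed
  have "norm (1 / G - of_real c) \<le> norm (1 / G - of_real (1 / T)) + norm (of_real (1 / T) - of_real c :: complex)"
    using norm_triangle_ineq[of "1 / G - of_real (1 / T)" "of_real (1 / T) - of_real c"] by simp
  also have "norm (of_real (1 / T) - of_real c :: complex) = 1 / T - c"
    using c by (simp only: of_real_diff[symmetric] norm_of_real)
  finally have "norm (1 / G - of_real c) \<le> norm (1 / G - of_real (1 / T)) + (1 / T - c)" .
  moreover have "1 / T \<le> norm (1 / G) + 2 * u"
  proof -
    have "norm (of_real (1 / T) :: complex) = 1 / T" using T1 by (simp only: norm_of_real) simp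
    then show ?thesis
      using d norm_triangle_sub[of "of_real (1 / T)" "1 / G"]
        norm_minus_commute[of "1 / G" "of_real (1 / T)"] by linarith
  qed
  ultimately have "norm (1 / G - of_real c) \<le> norm (1 / G) - c + 4 * u" using d by linarith
  moreover have "(\<Sum>y\<in>Y. norm (g y / G)) = norm (1 / G) + (\<Sum>y\<in>Y - {y0}. norm (g y / G))"
    using Y g(2) by (simp add: sum.remove)
  ultimately have "norm (g y0 / G - of_real c) + (\<Sum>y\<in>Y - {y0}. norm (g y / G)) \<le> 1 - c + 8 * u"
    using sumP g(2) by simp
  moreover have "(\<Sum>y\<in>Y. g y / G) = 1"
    using G0 unfolding G_def by (simp add: sum_divide_distrib[symmetric])
  ultimately show "weights (1 / (2 * X)) (8 * (a - 1)) Y y0 (\<lambda>y. g y / (\<Sum>y\<in>Y. g y))"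
    unfolding weights_def G_def c_def u_def by simp
qed

section \<open>One step of the recursion\<close>

definition ratio :: "(nat set \<Rightarrow> complex) \<Rightarrow> nat \<Rightarrow> nat set \<Rightarrow> complex" where
  "ratio W j \<sigma> = W (insert j \<sigma>) / W \<sigma>"

text \<open>
  The ratios are relatively close to \<open>{0<..1}\<close>, the range they have at positive activities. The
  bound \<open>t \<le> 1\<close> expresses that occupying a marked vertex lowers the weight.
\<close>

definition good :: "nat \<Rightarrow> real \<Rightarrow> (nat set \<Rightarrow> complex) \<Rightarrow> bool" where
  "good k a W \<longleftrightarrow> (\<forall>j\<in>{1..k}. \<forall>\<sigma>\<subseteq>{1..k} - {j}. \<exists>t\<le>1. near a (ratio W j \<sigma>) t)"

lemma goodE:
  assumes "good k a W" "j \<in> {1..k}" "\<sigma> \<subseteq> {1..k} - {j}"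
  obtains t where "t \<le> 1" "near a (ratio W j \<sigma>) t"
  using assms unfolding good_def by blast

text \<open>
  A vanishing value would make some ratio vanish, as division by zero also yields zero.
\<close>

lemma good_nonzero:
  assumes "good k a W" "a < 2" "1 \<le> k" "S \<subseteq> {1..k}"
  shows "W S \<noteq> 0"
proof (cases "1 \<in> S")
  case True
  then have "insert 1 (S - {1}) = S" by auto
  moreover obtain t where "near a (ratio W 1 (S - {1})) t"
    by (rule goodE[OF assms(1), of 1 "S - {1}"]) (use assms in auto)
  ultimately show ?thesis using near_nonzero assms(2) unfolding ratio_def by fastforce
next
  case False
  obtain t where "near a (ratio W 1 S) t"
    by (rule goodE[OF assms(1), of 1 S]) (use assms False in auto)
  then show ?thesis using near_nonzero assms(2) unfolding ratio_def by fastforce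
qed

text \<open>
  Occupying the labels in \<open>S' - S\<close> one at a time writes the quotient as a product of at most \<open>k\<close>
  ratios.
\<close>

lemma good_quotient:
  assumes W: "good k a W" "a < 2" "1 \<le> a" "1 \<le> k" and S: "S \<subseteq> S'" "S' \<subseteq> {1..k}"
  shows "\<exists>t\<le>1. near (a ^ k) (W S' / W S) t"
proof -
  have "\<exists>t\<le>1. near (a ^ card A) (W (S \<union> A) / W S) t" if "finite A" "S \<union> A \<subseteq> {1..k}" "A \<inter> S = {}" for A
    using that
  proof (induction A)
    case empty
    then show ?case using good_nonzero[OF W(1,2,4)] near_self[of 1 1] by (intro exI[of _ 1]) simp
  next
    case (insert j A)
    then obtain t where t: "t \<le> 1" "near (a ^ card A) (W (S \<union> A) / W S) t" by auto
    obtain s where s: "s \<le> 1" "near a (ratio W j (S \<union> A)) s"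
      by (rule goodE[OF W(1), of j "S \<union> A"]) (use insert in auto)
    have "W (S \<union> A) \<noteq> 0" using good_nonzero[OF W(1,2,4)] insert by auto
    then have eq: "ratio W j (S \<union> A) * (W (S \<union> A) / W S) = W (S \<union> insert j A) / W S"
      unfolding ratio_def by simp
    have "s * t \<le> 1" using s t unfolding near_def by (intro mult_le_one) auto
    moreover have "card (insert j A) = Suc (card A)" using insert by simp
    ultimately show ?case
      using near_mult[OF s(2) t(2)] unfolding eq by (intro exI[of _ "s * t"]) (simp only: power_Suc)
  qed
  from this[of "S' - S"] obtain t where t: "t \<le> 1" "near (a ^ card (S' - S)) (W S' / W S) t"
    using S by (metis Diff_disjoint Diff_subset Int_commute Un_Diff_cancel Un_absorb1 finite_atLeastAtMost finite_subset)
  have "card (S' - S) \<le> card {1..k}" by (intro card_mono) (use S in auto)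
  then have "a ^ card (S' - S) \<le> a ^ k" using W(3) by (intro power_increasing) auto
  then show ?thesis using t near_mono by blast
qed

context gluing
begin

text \<open>
  The contribution to the next boundary value \<open>\<sigma>\<close> of the configurations whose occupied inner
  glued vertices are \<open>\<tau>\<close>.
\<close>

definition weight :: "complex \<Rightarrow> (nat set \<Rightarrow> complex) \<Rightarrow> nat set \<Rightarrow> 'e set \<Rightarrow> complex" where
  "weight z W \<sigma> \<tau> = z ^ card \<tau> * (\<Prod>i\<in>{1..m}. W (occupied i (\<tau> \<union> \<Phi> ` \<sigma>)))"

definition step :: "complex \<Rightarrow> (nat set \<Rightarrow> complex) \<Rightarrow> nat set \<Rightarrow> complex" where
  "step z W \<sigma> = (\<Sum>\<tau>\<in>Pow inner_edges. weight z W \<sigma> \<tau>)"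

text \<open>
  A bound for the number of ratios and of factors \<open>z\<close> whose product is the quotient of the
  contributions of \<open>\<tau>\<close> and of \<open>{}\<close>.
\<close>

definition num_factors :: nat where "num_factors = m * k + card inner_edges"

definition weight_bound :: "real \<Rightarrow> real" where "weight_bound x = (\<Sum>\<tau>\<in>Pow inner_edges. x ^ card \<tau>)"

lemma weight_bound_ge_1: "0 \<le> x \<Longrightarrow> 1 \<le> weight_bound x"
proof -
  assume "0 \<le> x"
  then have "(\<Sum>\<tau>\<in>{{} :: 'e set}. x ^ card \<tau>) \<le> weight_bound x"
    unfolding weight_bound_def by (intro sum_mono2) (auto simp: finite_inner_edges)
  then show ?thesis by simp
qed

text \<open>
  Relative to \<open>\<tau> = {}\<close>, the contribution of \<open>\<tau>\<close> is \<open>z ^ card \<tau>\<close> times a product of ratios, hence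
  close to a number in \<open>{0<..x ^ card \<tau>}\<close>. So the empty configuration carries a definite part of
  the total, whatever the boundary condition \<open>\<sigma>\<close>.
\<close>

lemma good_weights:
  assumes W: "good k a W" and z: "near a z x" and a: "a < 2" "a ^ num_factors \<le> 3 / 2" and \<sigma>: "\<sigma> \<subseteq> {1..k}"
  shows "weight z W \<sigma> {} \<noteq> 0" "1 / 2 \<le> Re (step z W \<sigma> / weight z W \<sigma> {})"
    "norm (step z W \<sigma> / weight z W \<sigma> {}) \<le> 2 * weight_bound x"
    "weights (1 / (2 * weight_bound x)) (8 * (a ^ num_factors - 1)) (Pow inner_edges) {} (\<lambda>\<tau>. weight z W \<sigma> \<tau> / step z W \<sigma>)"
proof -
  have a1: "1 \<le> a" using near_ge_1[OF z] .
  have x: "0 < x" using z unfolding near_def by auto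
  have nz: "W (occupied i (\<tau> \<union> \<Phi> ` \<sigma>)) \<noteq> 0" if "\<tau> \<subseteq> inner_edges" for \<tau> i
    by (rule good_nonzero[OF W a(1) k_pos occupied_sub[OF occupied_edges_sub[OF that \<sigma>]]])
  show w0: "weight z W \<sigma> {} \<noteq> 0" using nz[of "{}"] unfolding weight_def by simp
  define g where "g = (\<lambda>\<tau>. weight z W \<sigma> \<tau> / weight z W \<sigma> {})"
  have "\<exists>t\<le>1. near (a ^ k) (W (occupied i (\<tau> \<union> \<Phi> ` \<sigma>)) / W (occupied i ({} \<union> \<Phi> ` \<sigma>))) t"
    if "\<tau> \<subseteq> inner_edges" for \<tau> i
    by (rule good_quotient[OF W a(1) a1 k_pos _ occupied_sub[OF occupied_edges_sub[OF that \<sigma>]]]) (auto simp: occupied_def)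
  then obtain t where t: "\<And>\<tau> i. \<tau> \<subseteq> inner_edges \<Longrightarrow> t \<tau> i \<le> 1"
    "\<And>\<tau> i. \<tau> \<subseteq> inner_edges \<Longrightarrow> near (a ^ k) (W (occupied i (\<tau> \<union> \<Phi> ` \<sigma>)) / W (occupied i ({} \<union> \<Phi> ` \<sigma>))) (t \<tau> i)"
    by metis
  define s where "s = (\<lambda>\<tau>. if \<tau> = {} then 1 else x ^ card \<tau> * (\<Prod>i\<in>{1..m}. t \<tau> i))"
  have near: "near (a ^ num_factors) (g \<tau>) (s \<tau>)" if \<tau>: "\<tau> \<in> Pow inner_edges" for \<tau>
  proof (cases "\<tau> = {}")
    case True
    then show ?thesis unfolding g_def s_def using w0 near_self[of 1 "a ^ num_factors"] a1 by simp
  next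
    case False
    have ge: "g \<tau> = z ^ card \<tau> * (\<Prod>i\<in>{1..m}. W (occupied i (\<tau> \<union> \<Phi> ` \<sigma>)) / W (occupied i ({} \<union> \<Phi> ` \<sigma>)))"
      unfolding g_def weight_def by (simp add: prod_dividef)
    have nr: "near (a ^ card \<tau> * (a ^ k) ^ card {1..m})
        (z ^ card \<tau> * (\<Prod>i\<in>{1..m}. W (occupied i (\<tau> \<union> \<Phi> ` \<sigma>)) / W (occupied i ({} \<union> \<Phi> ` \<sigma>))))
        (x ^ card \<tau> * (\<Prod>i\<in>{1..m}. t \<tau> i))"
      using \<tau> t(2) by (intro near_mult near_power[OF z] near_prod) auto
    have le: "a ^ card \<tau> * (a ^ k) ^ card {1..m} \<le> a ^ num_factors"
    proof -
      have "card \<tau> \<le> card inner_edges" using \<tau> finite_inner_edges by (intro card_mono) auto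
      then have "a ^ (card \<tau> + k * m) \<le> a ^ num_factors"
        unfolding num_factors_def using a1 by (intro power_increasing) (auto simp: mult.commute)
      then show ?thesis by (simp add: power_add power_mult)
    qed
    have se: "s \<tau> = x ^ card \<tau> * (\<Prod>i\<in>{1..m}. t \<tau> i)" unfolding s_def using False by simp
    show ?thesis unfolding ge se by (rule near_mono[OF nr le])
  qed
  have "s \<tau> \<le> x ^ card \<tau>" if "\<tau> \<in> Pow inner_edges" for \<tau>
  proof -
    have "(\<Prod>i\<in>{1..m}. t \<tau> i) \<le> 1"
      using t that unfolding near_def by (intro prod_le_1) (auto intro: less_imp_le)
    then show ?thesis unfolding s_def using x by (simp add: mult_left_le)
  qed
  then have S: "(\<Sum>\<tau>\<in>Pow inner_edges. s \<tau>) \<le> weight_bound x" unfolding weight_bound_def by (intro sum_mono)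
  have G: "(\<Sum>\<tau>\<in>Pow inner_edges. g \<tau>) = step z W \<sigma> / weight z W \<sigma> {}"
    unfolding g_def step_def by (simp add: sum_divide_distrib)
  have gw: "g \<tau> / (\<Sum>\<tau>\<in>Pow inner_edges. g \<tau>) = weight z W \<sigma> \<tau> / step z W \<sigma>" for \<tau>
    unfolding G unfolding g_def using w0 by simp
  have "finite (Pow inner_edges)" "{} \<in> Pow inner_edges" "g {} = 1" "s {} = 1"
    using finite_inner_edges w0 by (auto simp: g_def s_def)
  note nw = near_weights[OF this(1,2) near this(3,4) S a(2)]
  show "1 / 2 \<le> Re (step z W \<sigma> / weight z W \<sigma> {})" using nw(1) unfolding G .
  show "norm (step z W \<sigma> / weight z W \<sigma> {}) \<le> 2 * weight_bound x" using nw(2) unfolding G .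
  show "weights (1 / (2 * weight_bound x)) (8 * (a ^ num_factors - 1)) (Pow inner_edges) {} (\<lambda>\<tau>. weight z W \<sigma> \<tau> / step z W \<sigma>)"
    using nw(3) unfolding gw .
qed

text \<open>
  The only edge through \<open>i\<close> with the label of \<open>\<Phi> j\<close> is \<open>\<Phi> j\<close> itself.
\<close>

lemma fresh_mark:
  assumes "j \<in> {1..k}" "\<sigma> \<subseteq> {1..k} - {j}" "\<tau> \<subseteq> inner_edges" "i \<in> ends H (\<Phi> j)"
  shows "occupied i (\<tau> \<union> \<Phi> ` \<sigma>) \<subseteq> {1..k} - {\<phi> j}"
proof -
  have \<sigma>: "\<sigma> \<subseteq> {1..k}" using assms(2) by blast
  have "\<phi> j \<notin> occupied i (\<tau> \<union> \<Phi> ` \<sigma>)"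
  proof
    assume "\<phi> j \<in> occupied i (\<tau> \<union> \<Phi> ` \<sigma>)"
    then obtain e where "e \<in> {e \<in> \<tau> \<union> \<Phi> ` \<sigma>. i \<in> ends H e}" "l (\<Phi> j) = l e"
      unfolding occupied_def \<phi>_def by (elim imageE)
    then have e: "e \<in> \<tau> \<union> \<Phi> ` \<sigma>" "i \<in> ends H e" "l e = l (\<Phi> j)" by simp_all
    then have "e = \<Phi> j"
      using l_inj[OF _ Phi_mem[OF assms(1)], of e i] occupied_edges_sub[OF assms(3) \<sigma>] assms(4) by blast
    then consider "\<Phi> j \<in> inner_edges" | b where "b \<in> \<sigma>" "\<Phi> j = \<Phi> b" using e(1) assms(3) by auto
    then show False
    proof cases
      case 1
      then show False using assms(1) unfolding inner_edges_def by blast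
    next
      case 2
      then have "j = b" using inj_onD[OF Phi_inj] \<sigma> assms(1) by blast
      then show False using 2(1) assms(2) by blast
    qed
  qed
  then show ?thesis using occupied_sub[OF occupied_edges_sub[OF assms(3) \<sigma>]] by blast
qed

lemma step_insert:
  assumes nz: "\<And>S. S \<subseteq> {1..k} \<Longrightarrow> W S \<noteq> 0" and j: "j \<in> {1..k}" and \<sigma>: "\<sigma> \<subseteq> {1..k} - {j}"
  shows "step z W (insert j \<sigma>)
    = (\<Sum>\<tau>\<in>Pow inner_edges. weight z W \<sigma> \<tau> * (\<Prod>i\<in>ends H (\<Phi> j). ratio W (\<phi> j) (occupied i (\<tau> \<union> \<Phi> ` \<sigma>))))"
  unfolding step_def
proof (rule sum.cong)
  fix \<tau> assume \<tau>: "\<tau> \<in> Pow inner_edges"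
  let ?o = "\<lambda>i. occupied i (\<tau> \<union> \<Phi> ` \<sigma>)"
  have ends: "ends H (\<Phi> j) \<subseteq> {1..m}" using ends_sub[OF Phi_mem[OF j]] .
  have "W (occupied i (\<tau> \<union> \<Phi> ` insert j \<sigma>)) = W (?o i) * (if i \<in> ends H (\<Phi> j) then ratio W (\<phi> j) (?o i) else 1)"
    for i
  proof -
    have "W (?o i) \<noteq> 0" by (rule nz[OF occupied_sub[OF occupied_edges_sub]]) (use \<tau> \<sigma> in auto)
    moreover have "occupied i (\<tau> \<union> \<Phi> ` insert j \<sigma>) = (if i \<in> ends H (\<Phi> j) then insert (\<phi> j) (?o i) else ?o i)"
      unfolding occupied_def \<phi>_def by auto
    ultimately show ?thesis unfolding ratio_def by simp
  qed
  then have "(\<Prod>i\<in>{1..m}. W (occupied i (\<tau> \<union> \<Phi> ` insert j \<sigma>)))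
      = (\<Prod>i\<in>{1..m}. W (?o i)) * (\<Prod>i\<in>{1..m}. if i \<in> ends H (\<Phi> j) then ratio W (\<phi> j) (?o i) else 1)"
    by (simp add: prod.distrib)
  also have "(\<Prod>i\<in>{1..m}. if i \<in> ends H (\<Phi> j) then ratio W (\<phi> j) (?o i) else 1)
      = (\<Prod>i\<in>ends H (\<Phi> j). ratio W (\<phi> j) (?o i))"
    using ends by (simp add: prod.inter_restrict[symmetric] Int_absorb1)
  finally show "weight z W (insert j \<sigma>) \<tau> = weight z W \<sigma> \<tau> * (\<Prod>i\<in>ends H (\<Phi> j). ratio W (\<phi> j) (?o i))"
    unfolding weight_def by (simp add: mult_ac)
qed simp

text \<open>
  Occupying the new label \<open>j\<close> occupies the old label \<open>\<phi> j\<close> in each of the copies in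
  \<open>ends H (\<Phi> j)\<close> and changes nothing else. Hence the new ratio is a weighted average of products of
  old ratios.
\<close>

lemma ratio_step:
  assumes "\<And>S. S \<subseteq> {1..k} \<Longrightarrow> W S \<noteq> 0" and "j \<in> {1..k}" and "\<sigma> \<subseteq> {1..k} - {j}"
  shows "ratio (step z W) j \<sigma> = (\<Sum>\<tau>\<in>Pow inner_edges. weight z W \<sigma> \<tau> / step z W \<sigma>
           * (\<Prod>i\<in>ends H (\<Phi> j). ratio W (\<phi> j) (occupied i (\<tau> \<union> \<Phi> ` \<sigma>))))"
proof -
  have "ratio (step z W) j \<sigma> = step z W (insert j \<sigma>) / step z W \<sigma>" by (rule ratio_def)
  also have "step z W (insert j \<sigma>)
      = (\<Sum>\<tau>\<in>Pow inner_edges. weight z W \<sigma> \<tau> * (\<Prod>i\<in>ends H (\<Phi> j). ratio W (\<phi> j) (occupied i (\<tau> \<union> \<Phi> ` \<sigma>))))"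
    by (rule step_insert[OF assms])
  finally show ?thesis by (simp add: sum_divide_distrib)
qed

end

section \<open>Stable, dead and linked labels\<close>

locale recursive_sequence = gluing k m H l \<Phi>
  for k m :: nat and H :: "(nat, 'e) hypergraph" and l :: "'e \<Rightarrow> nat" and \<Phi> :: "nat \<Rightarrow> 'e" +
  fixes G :: "nat \<Rightarrow> ('a, 'e) vertex marked_graph"
  assumes G_0: "G 0 \<in> marked_graphs k"
    and G_Suc: "G (Suc n) = recursion k H l \<Phi> (G n)"
    and bounded_degree: "\<exists>D. \<forall>n. max_degree (G n) \<le> D"
    and marks_diverge: "(\<lambda>n. min_mark_distance k (G n)) \<longlonglongrightarrow> \<infinity>"
begin

lemma G_marked: "G n \<in> marked_graphs k"
  by (induction n) (auto simp: G_0 G_Suc recursion_marked_graphs[OF gluing_data])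

definition W :: "nat \<Rightarrow> complex \<Rightarrow> nat set \<Rightarrow> complex" where
  "W n z S = boundary_poly k (G n) S z"

lemma W_Suc: "S \<subseteq> {1..k} \<Longrightarrow> W (Suc n) z S = step z (W n z) S"
  unfolding W_def G_Suc boundary_poly_recursion[OF G_marked] step_def weight_def by simp

lemma ratio_Suc:
  assumes "j \<in> {1..k}" "\<sigma> \<subseteq> {1..k} - {j}"
  shows "ratio (W (Suc n) z) j \<sigma> = ratio (step z (W n z)) j \<sigma>"
proof -
  have "insert j \<sigma> \<subseteq> {1..k}" "\<sigma> \<subseteq> {1..k}" using assms by auto
  then show ?thesis unfolding ratio_def by (simp add: W_Suc)
qed

lemma mark_Suc: "mark (G (Suc n)) j = Glued (\<Phi> j)"
  unfolding G_Suc by (rule mark_recursion[OF G_marked])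

lemma \<phi>_mem: "j \<in> {1..k} \<Longrightarrow> \<phi> j \<in> {1..k}"
  unfolding \<phi>_def using l_mem Phi_mem by blast

lemma \<phi>_pow_mem: "j \<in> {1..k} \<Longrightarrow> (\<phi> ^^ t) j \<in> {1..k}"
proof (induction t)
  case (Suc t)
  then show ?case using \<phi>_mem by simp
qed simp

definition stable :: "nat set" where
  "stable = {j \<in> {1..k}. \<forall>t. card (ends H (\<Phi> ((\<phi> ^^ t) j))) = 1}"

definition dead :: "nat set" where
  "dead = {j \<in> {1..k}. \<forall>n. Defs.degree (G n) (mark (G n) j) = 0}"

lemma stable_mem: "j \<in> stable \<Longrightarrow> j \<in> {1..k}"
  and dead_mem: "j \<in> dead \<Longrightarrow> j \<in> {1..k}"
  unfolding stable_def dead_def by auto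

lemma stable_\<phi>: "j \<in> stable \<Longrightarrow> \<phi> j \<in> stable"
proof -
  assume j: "j \<in> stable"
  have "card (ends H (\<Phi> ((\<phi> ^^ t) (\<phi> j)))) = 1" for t
    using j unfolding stable_def by (metis (mono_tags, lifting) funpow_Suc_right mem_Collect_eq o_apply)
  then show ?thesis using \<phi>_mem[OF stable_mem[OF j]] unfolding stable_def by blast
qed

lemma stable_pow: "j \<in> stable \<Longrightarrow> (\<phi> ^^ t) j \<in> stable"
  by (induction t) (auto intro: stable_\<phi>)

lemma stable_ends: "j \<in> stable \<Longrightarrow> \<exists>i. ends H (\<Phi> j) = {i}"
  unfolding stable_def using card_1_singletonE[of "ends H (\<Phi> j)"]
  by (metis (mono_tags, lifting) funpow_0 mem_Collect_eq)

lemma degree_Suc_ge: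
  assumes "j \<in> {1..k}"
  shows "card (ends H (\<Phi> j)) * Defs.degree (G n) (mark (G n) (\<phi> j))
    \<le> Defs.degree (G (Suc n)) (mark (G (Suc n)) j)"
  using degree_recursion_ge[OF G_marked assms] mark_Suc unfolding G_Suc by simp

lemma ends_card_pos: "j \<in> {1..k} \<Longrightarrow> 1 \<le> card (ends H (\<Phi> j))"
  using ends_ne[OF Phi_mem] finite_subset[OF ends_sub[OF Phi_mem]]
  by (simp add: Suc_le_eq card_gt_0_iff)

lemma degree_pow_ge:
  assumes "j \<in> {1..k}"
  shows "Defs.degree (G n) (mark (G n) ((\<phi> ^^ t) j)) \<le> Defs.degree (G (n + t)) (mark (G (n + t)) j)"
  using assms
proof (induction t arbitrary: j)
  case (Suc t)
  have "Defs.degree (G n) (mark (G n) ((\<phi> ^^ Suc t) j)) = Defs.degree (G n) (mark (G n) ((\<phi> ^^ t) (\<phi> j)))"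
    by (simp add: funpow_swap1)
  also have "\<dots> \<le> Defs.degree (G (n + t)) (mark (G (n + t)) (\<phi> j))"
    by (rule Suc.IH[OF \<phi>_mem[OF Suc.prems]])
  also have "\<dots> \<le> Defs.degree (G (n + Suc t)) (mark (G (n + Suc t)) j)"
    using order_trans[OF mult_le_mono1[OF ends_card_pos[OF Suc.prems]] degree_Suc_ge[OF Suc.prems, of "n + t"]]
    by simp
  finally show ?case .
qed simp

text \<open>
  Otherwise the orbit of \<open>j\<close> under \<open>\<phi>\<close> passes infinitely often through identifications of at least
  two copies. After \<open>D\<close> of them a positive degree would become at least \<open>2 ^ D > D\<close>, so the label reached
  by then has degree \<open>0\<close> in all graphs.
\<close>

lemma eventually_base:
  assumes j: "j \<in> {1..k}"
  shows "\<exists>t. (\<phi> ^^ t) j \<in> stable \<union> dead"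
proof (rule ccontr)
  assume no: "\<nexists>t. (\<phi> ^^ t) j \<in> stable \<union> dead"
  have grow: "\<exists>t. \<forall>n. 2 ^ q * Defs.degree (G n) (mark (G n) ((\<phi> ^^ t) j))
      \<le> Defs.degree (G (n + t)) (mark (G (n + t)) j)" for q
  proof (induction q)
    case 0
    show ?case by (rule exI[of _ 0]) simp
  next
    case (Suc q)
    then obtain t where t: "\<And>n. 2 ^ q * Defs.degree (G n) (mark (G n) ((\<phi> ^^ t) j))
      \<le> Defs.degree (G (n + t)) (mark (G (n + t)) j)" by blast
    have tm: "(\<phi> ^^ t) j \<in> {1..k}" using \<phi>_pow_mem[OF j] .
    have "(\<phi> ^^ t) j \<notin> stable" using no by blast
    then obtain s where s: "card (ends H (\<Phi> ((\<phi> ^^ s) ((\<phi> ^^ t) j)))) \<noteq> 1"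
      using tm unfolding stable_def by blast
    let ?i = "(\<phi> ^^ s) ((\<phi> ^^ t) j)"
    have im: "?i \<in> {1..k}" using \<phi>_pow_mem[OF tm] .
    have c2: "2 \<le> card (ends H (\<Phi> ?i))" using s ends_card_pos[OF im] by linarith
    have eq: "\<phi> ?i = (\<phi> ^^ (t + Suc s)) j" by (simp add: funpow_add add.commute[of t])
    show ?case
    proof (intro exI allI)
      fix n
      have "2 ^ Suc q * Defs.degree (G n) (mark (G n) (\<phi> ?i))
          = 2 ^ q * (2 * Defs.degree (G n) (mark (G n) (\<phi> ?i)))" by simp
      also have "\<dots> \<le> 2 ^ q * (card (ends H (\<Phi> ?i)) * Defs.degree (G n) (mark (G n) (\<phi> ?i)))"
        using c2 by (intro mult_le_mono2 mult_le_mono1)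
      also have "\<dots> \<le> 2 ^ q * Defs.degree (G (Suc n)) (mark (G (Suc n)) ?i)"
        by (intro mult_le_mono2 degree_Suc_ge im)
      also have "\<dots> \<le> 2 ^ q * Defs.degree (G (Suc n + s)) (mark (G (Suc n + s)) ((\<phi> ^^ t) j))"
        by (intro mult_le_mono2 degree_pow_ge tm)
      also have "\<dots> \<le> Defs.degree (G (Suc n + s + t)) (mark (G (Suc n + s + t)) j)" by (rule t)
      also have "Suc n + s + t = n + (t + Suc s)" by simp
      finally show "2 ^ Suc q * Defs.degree (G n) (mark (G n) ((\<phi> ^^ (t + Suc s)) j))
          \<le> Defs.degree (G (n + (t + Suc s))) (mark (G (n + (t + Suc s))) j)" unfolding eq .
    qed
  qed
  obtain D where D: "\<And>n. max_degree (G n) \<le> D" using bounded_degree by blast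
  obtain t where t: "\<And>n. 2 ^ D * Defs.degree (G n) (mark (G n) ((\<phi> ^^ t) j))
      \<le> Defs.degree (G (n + t)) (mark (G (n + t)) j)" using grow[of D] by blast
  have "Defs.degree (G n) (mark (G n) ((\<phi> ^^ t) j)) = 0" for n
  proof (rule ccontr)
    assume "Defs.degree (G n) (mark (G n) ((\<phi> ^^ t) j)) \<noteq> 0"
    then have "2 ^ D * 1 \<le> 2 ^ D * Defs.degree (G n) (mark (G n) ((\<phi> ^^ t) j))"
      by (intro mult_le_mono2) simp
    also have "\<dots> \<le> Defs.degree (G (n + t)) (mark (G (n + t)) j)" by (rule t)
    also have "\<dots> \<le> max_degree (G (n + t))"
      unfolding max_degree_def
      using marked_graphsD(1,4)[OF G_marked[of "n + t"]] j by (intro Max_ge) auto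
    also have "\<dots> \<le> D" by (rule D)
    finally show False using less_exp[of D] by simp
  qed
  then have "(\<phi> ^^ t) j \<in> dead" unfolding dead_def using \<phi>_pow_mem[OF j] by blast
  then show False using no by blast
qed

lemma dead_\<phi>: "j \<in> dead \<Longrightarrow> \<phi> j \<in> dead"
proof -
  assume j: "j \<in> dead"
  have "Defs.degree (G n) (mark (G n) (\<phi> j)) = 0" for n
    using degree_pow_ge[OF dead_mem[OF j], of n 1] j unfolding dead_def by simp
  then show ?thesis using \<phi>_mem[OF dead_mem[OF j]] unfolding dead_def by blast
qed

lemma base_pow_mono: "(\<phi> ^^ t) j \<in> stable \<union> dead \<Longrightarrow> t \<le> s \<Longrightarrow> (\<phi> ^^ s) j \<in> stable \<union> dead"
proof (induction s)
  case (Suc s)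
  then show ?case using stable_\<phi> dead_\<phi> by (cases "t = Suc s") auto
qed simp

lemma uniform_depth: "\<exists>K. \<forall>j\<in>{1..k}. (\<phi> ^^ K) j \<in> stable \<union> dead"
proof -
  have "\<forall>\<^sub>F K in sequentially. \<forall>j\<in>{1..k}. (\<phi> ^^ K) j \<in> stable \<union> dead"
  proof (intro eventually_ball_finite ballI)
    fix j assume "j \<in> {1..k}"
    then obtain t where "(\<phi> ^^ t) j \<in> stable \<union> dead" using eventually_base by blast
    then show "\<forall>\<^sub>F K in sequentially. (\<phi> ^^ K) j \<in> stable \<union> dead"
      unfolding eventually_sequentially using base_pow_mono by blast
  qed simp
  then show ?thesis by (rule eventually_happens'[OF sequentially_bot])
qed

lemma ratio_dead:
  assumes "j \<in> dead" "W n z \<sigma> \<noteq> 0"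
  shows "ratio (W n z) j \<sigma> = 1"
proof -
  have "Defs.degree (G n) (mark (G n) j) = 0" using assms(1) unfolding dead_def by blast
  then have "mark (G n) j \<notin> d" if "d \<in># edges (G n)" for d
    using that unfolding Defs.degree_def by (auto simp: filter_mset_eq_mempty_iff)
  then have "W n z (insert j \<sigma>) = W n z \<sigma>"
    unfolding W_def by (rule boundary_poly_insert_isolated)
  then show ?thesis using assms(2) unfolding ratio_def by simp
qed

text \<open>
  The old labels of pairs of marked vertices that lie in a common copy throughout \<open>t\<close> steps of the
  recursion.
\<close>

fun linked :: "nat \<Rightarrow> (nat \<times> nat) set" where
  "linked 0 = {(a, b). a \<in> {1..k} \<and> b \<in> {1..k} \<and> a \<noteq> b}"
| "linked (Suc t) = {(\<phi> a, \<phi> b) | a b. (a, b) \<in> linked t \<and> ends H (\<Phi> a) \<inter> ends H (\<Phi> b) \<noteq> {}}"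

lemma \<phi>_separates:
  assumes "a \<in> {1..k}" "b \<in> {1..k}" "a \<noteq> b" "ends H (\<Phi> a) \<inter> ends H (\<Phi> b) \<noteq> {}"
  shows "\<phi> a \<noteq> \<phi> b"
proof
  assume eq: "\<phi> a = \<phi> b"
  obtain i where "i \<in> ends H (\<Phi> a)" "i \<in> ends H (\<Phi> b)" using assms(4) by blast
  then have "\<Phi> a = \<Phi> b"
    using l_inj[OF Phi_mem[OF assms(1)] Phi_mem[OF assms(2)]] eq unfolding \<phi>_def by blast
  then show False using inj_onD[OF Phi_inj] assms by blast
qed

lemma linked_Suc_sub: "linked (Suc t) \<subseteq> linked t"
proof (induction t)
  case 0
  show ?case
  proof
    fix y assume "y \<in> linked (Suc 0)"
    then obtain a b where "y = (\<phi> a, \<phi> b)" "a \<in> {1..k}" "b \<in> {1..k}" "a \<noteq> b"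
      "ends H (\<Phi> a) \<inter> ends H (\<Phi> b) \<noteq> {}" by auto
    then show "y \<in> linked 0" using \<phi>_separates \<phi>_mem by simp
  qed
next
  case (Suc t)
  then show ?case by (subst linked.simps(2), subst linked.simps(2)) blast
qed

lemma linked_antimono: "s \<le> t \<Longrightarrow> linked t \<subseteq> linked s"
  using lift_Suc_antimono_le[of linked s t] linked_Suc_sub by blast

text \<open>
  By \<open>distance_recursion_le\<close>, two marked vertices do not move apart during the \<open>t\<close> steps.
\<close>

lemma linked_distance:
  assumes "(a, b) \<in> linked t"
  shows "min_mark_distance k (G (n + t)) \<le> distance (G n) (mark (G n) a) (mark (G n) b)"
proof -
  have "\<exists>a0 b0. (a0, b0) \<in> linked 0 \<and>
      distance (G (n + t)) (mark (G (n + t)) a0) (mark (G (n + t)) b0)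
      \<le> distance (G n) (mark (G n) a) (mark (G n) b)"
    using assms
  proof (induction t arbitrary: a b n)
    case 0
    then show ?case by auto
  next
    case (Suc t)
    then obtain a' b' where ab: "a = \<phi> a'" "b = \<phi> b'" "(a', b') \<in> linked t"
      "ends H (\<Phi> a') \<inter> ends H (\<Phi> b') \<noteq> {}" by auto
    have "(a', b') \<in> linked 0" using linked_antimono[of 0 t] ab(3) by blast
    then have m: "a' \<in> {1..k}" "b' \<in> {1..k}" by auto
    obtain i where i: "i \<in> ends H (\<Phi> a')" "i \<in> ends H (\<Phi> b')" using ab(4) by blast
    have le: "distance (G (Suc n)) (mark (G (Suc n)) a') (mark (G (Suc n)) b')
        \<le> distance (G n) (mark (G n) a) (mark (G n) b)"
      unfolding mark_Suc unfolding G_Suc ab(1,2) by (rule distance_recursion_le[OF G_marked m i])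
    obtain a0 b0 where ab0: "(a0, b0) \<in> linked 0"
      "distance (G (Suc n + t)) (mark (G (Suc n + t)) a0) (mark (G (Suc n + t)) b0)
      \<le> distance (G (Suc n)) (mark (G (Suc n)) a') (mark (G (Suc n)) b')"
      using Suc.IH[OF ab(3), of "Suc n"] by blast
    have "distance (G (n + Suc t)) (mark (G (n + Suc t)) a0) (mark (G (n + Suc t)) b0)
        \<le> distance (G n) (mark (G n) a) (mark (G n) b)"
      using order_trans[OF ab0(2) le] by simp
    then show ?case using ab0(1) by blast
  qed
  then obtain a0 b0 where ab0: "(a0, b0) \<in> linked 0"
      "distance (G (n + t)) (mark (G (n + t)) a0) (mark (G (n + t)) b0)
      \<le> distance (G n) (mark (G n) a) (mark (G n) b)" by blast
  have "min_mark_distance k (G (n + t)) \<le> distance (G (n + t)) (mark (G (n + t)) a0) (mark (G (n + t)) b0)"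
    unfolding min_mark_distance_def by (rule Inf_lower) (use ab0(1) in auto)
  then show ?thesis using ab0(2) by (rule order_trans)
qed

definition separating :: "nat \<Rightarrow> bool" where
  "separating R \<longleftrightarrow> (\<forall>(a, b)\<in>linked R. \<forall>n. distance (G n) (mark (G n) a) (mark (G n) b) = \<infinity>)"

text \<open>
  The finite sets \<open>linked t\<close> decrease and hence become constant. A pair that belongs to all of them
  satisfies \<open>linked_distance\<close> for every \<open>t\<close>, and the lower bound there tends to infinity.
\<close>

lemma ex_separating: "\<exists>R>0. separating R"
proof -
  have "\<forall>\<^sub>F R in sequentially. \<forall>y\<in>linked 0. y \<in> linked R \<longrightarrow> (\<forall>t. y \<in> linked t)"
  proof (intro eventually_ball_finite ballI)
    show "finite (linked 0)"
      by (rule finite_subset[of _ "{1..k} \<times> {1..k}"]) auto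
    fix y
    show "\<forall>\<^sub>F R in sequentially. y \<in> linked R \<longrightarrow> (\<forall>t. y \<in> linked t)"
    proof (cases "\<forall>t. y \<in> linked t")
      case False
      then obtain t where "y \<notin> linked t" by blast
      then have "y \<notin> linked R" if "t \<le> R" for R using linked_antimono[OF that] by blast
      then show ?thesis unfolding eventually_sequentially by blast
    qed simp
  qed
  then have "\<exists>R. \<forall>y\<in>linked 0. y \<in> linked R \<longrightarrow> (\<forall>t. y \<in> linked t)"
    by (rule eventually_happens'[OF sequentially_bot])
  then obtain R where R: "\<And>y. y \<in> linked 0 \<Longrightarrow> y \<in> linked R \<Longrightarrow> \<forall>t. y \<in> linked t"
    by blast
  have "distance (G n) (mark (G n) a) (mark (G n) b) = \<infinity>" if ab: "(a, b) \<in> linked R" for a b n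
  proof -
    have all: "(a, b) \<in> linked t" for t using R[of "(a, b)"] ab linked_antimono[of 0 R] by blast
    have "(\<lambda>t. min_mark_distance k (G (n + t))) \<longlonglongrightarrow> \<infinity>"
      using marks_diverge by (subst add.commute) (rule LIMSEQ_ignore_initial_segment)
    then have "\<infinity> \<le> distance (G n) (mark (G n) a) (mark (G n) b)"
      by (rule LIMSEQ_le_const2) (use linked_distance[OF all] in blast)
    then show ?thesis by simp
  qed
  then have "separating (Suc R)"
    unfolding separating_def using linked_Suc_sub[of R] by blast
  then show ?thesis by blast
qed

lemma ratio_far:
  assumes R: "separating R" and nz: "\<And>S. S \<subseteq> {1..k} \<Longrightarrow> W n z S \<noteq> 0"
    and j: "j \<in> {1..k}" and \<sigma>: "\<sigma> \<subseteq> {1..k}" "\<sigma>' \<subseteq> {1..k}"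
    and diff: "(\<sigma> - \<sigma>') \<union> (\<sigma>' - \<sigma>) \<subseteq> {b. (j, b) \<in> linked R}"
  shows "ratio (W n z) j \<sigma> = ratio (W n z) j \<sigma>'"
proof -
  have "W n z (insert j \<sigma>) * W n z \<sigma>' = W n z (insert j \<sigma>') * W n z \<sigma>"
    unfolding W_def
  proof (rule boundary_poly_far[OF G_marked j \<sigma>])
    fix b assume "b \<in> (\<sigma> - \<sigma>') \<union> (\<sigma>' - \<sigma>)"
    then have "(j, b) \<in> linked R" using diff by blast
    then show "distance (G n) (mark (G n) j) (mark (G n) b) = \<infinity>"
      using R unfolding separating_def by blast
  qed
  then show ?thesis using nz \<sigma> unfolding ratio_def by (simp add: frac_eq_eq)
qed

end

section \<open>Decay of the dependence on the boundary\<close>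

text \<open>
  A sequence that contracts every \<open>R\<close> steps and at most doubles in each is summable with a bound
  proportional to its first term. The assumptions are restricted to indices up to \<open>T\<close> because the
  contraction will only be known up to the current stage of an induction; cutting the sequence off
  after \<open>T\<close> preserves them.
\<close>

lemma sum_contracting_le:
  fixes M :: "nat \<Rightarrow> real"
  assumes M0: "\<And>s. 0 \<le> M s" and M2: "\<And>s. Suc s \<le> T \<Longrightarrow> M (Suc s) \<le> 2 * M s"
    and MR: "\<And>s. s + R \<le> T \<Longrightarrow> M (s + R) \<le> q * M s" and q: "0 \<le> q" "q < 1"
    and n: "n \<le> Suc T"
  shows "(\<Sum>s<n. M s) \<le> real R * 2 ^ R / (1 - q) * M 0"
proof -
  define M' where "M' = (\<lambda>s. if s \<le> T then M s else 0)"
  have M'0: "0 \<le> M' s" for s using M0 unfolding M'_def by simp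
  have M'2: "M' (Suc s) \<le> 2 * M' s" for s using M2[of s] M'0[of s] unfolding M'_def by auto
  have M'R: "M' (s + R) \<le> q * M' s" for s
    using MR[of s] M0[of s] q unfolding M'_def by auto
  have pw: "M' s \<le> 2 ^ s * M 0" for s
  proof (induction s)
    case (Suc s)
    then show ?case using M'2[of s] by simp
  qed (simp add: M'_def M0)
  have "(\<Sum>s<n. M' s) \<le> (\<Sum>s<R + n. M' s)" using M'0 by (intro sum_mono2) auto
  also have "\<dots> = (\<Sum>s<R. M' s) + (\<Sum>s<n. M' (R + s))"
    by (induction n) (auto simp: algebra_simps)
  also have "(\<Sum>s<R. M' s) \<le> (\<Sum>s<R. 2 ^ R * M 0)"
  proof (rule sum_mono)
    fix s assume "s \<in> {..<R}"
    then have "(2::real) ^ s \<le> 2 ^ R" by (intro power_increasing) auto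
    then show "M' s \<le> 2 ^ R * M 0" using pw[of s] M0[of 0] mult_right_mono order_trans by blast
  qed
  also have "(\<Sum>s<n. M' (R + s)) \<le> (\<Sum>s<n. q * M' s)"
    using M'R by (intro sum_mono) (simp add: add.commute)
  finally have "(1 - q) * (\<Sum>s<n. M' s) \<le> real R * 2 ^ R * M 0"
    by (simp add: sum_distrib_left[symmetric] algebra_simps)
  moreover have "(\<Sum>s<n. M' s) = (\<Sum>s<n. M s)"
    using n unfolding M'_def by (intro sum.cong) auto
  ultimately show ?thesis using q by (simp add: field_simps)
qed

context gluing
begin

text \<open>
  The excess by which the recursion step can expand oscillations when ratios are known up to the
  relative error \<open>a - 1\<close>. The constant is the product of the factors \<open>8\<close> in \<open>near_weights\<close> and
  \<open>4\<close> in \<open>weights_contract\<close>.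
\<close>

definition slack :: "real \<Rightarrow> real" where "slack a = 32 * (a ^ num_factors - 1)"

text \<open>
  The guaranteed mass of the configuration without occupied inner glued vertices.
\<close>

definition doeblin :: "real \<Rightarrow> real" where "doeblin x = 1 / (2 * weight_bound x)"

text \<open>
  The last two bounds let \<open>near_weights\<close> apply and let oscillations at most double in each step.
\<close>

definition admissible :: "real \<Rightarrow> bool" where
  "admissible a \<longleftrightarrow> 1 \<le> a \<and> a < 2 \<and> a ^ num_factors \<le> 3 / 2 \<and> slack a \<le> 1"

definition prob :: "complex \<Rightarrow> (nat set \<Rightarrow> complex) \<Rightarrow> nat set \<Rightarrow> 'e set \<Rightarrow> complex" where
  "prob z V \<sigma> \<tau> = weight z V \<sigma> \<tau> / step z V \<sigma>"

lemma doeblin_bounds: "0 < x \<Longrightarrow> 0 < doeblin x" "0 < x \<Longrightarrow> doeblin x \<le> 1 / 2"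
  using weight_bound_ge_1[of x] unfolding doeblin_def by (auto simp: field_simps)

lemma slack_nonneg: "1 \<le> a \<Longrightarrow> 0 \<le> slack a"
  unfolding slack_def by simp

lemma prob_weights:
  assumes "good k a V" "near a z x" "admissible a" "\<sigma> \<subseteq> {1..k}"
  shows "weights (doeblin x) (slack a / 4) (Pow inner_edges) {} (prob z V \<sigma>)"
proof -
  have e: "slack a / 4 = 8 * (a ^ num_factors - 1)" unfolding slack_def by simp
  have "a < 2" "a ^ num_factors \<le> 3 / 2" using assms(3) unfolding admissible_def by auto
  from good_weights(4)[OF assms(1,2) this assms(4)] show ?thesis
    unfolding prob_def[abs_def] doeblin_def e .
qed

end

context recursive_sequence
begin

lemma W_Suc_nonzero:
  assumes "good k a (W n z)" "near a z x" "admissible a" "S \<subseteq> {1..k}"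
  shows "W (Suc n) z S \<noteq> 0"
proof
  assume "W (Suc n) z S = 0"
  then have "step z (W n z) S = 0" using W_Suc[OF assms(4)] by simp
  then show False
    using good_weights(2)[OF assms(1,2) _ _ assms(4)] assms(3) unfolding admissible_def by simp
qed

lemma ratio_Suc_average:
  assumes "good k a (W n z)" "admissible a" "j \<in> {1..k}" "\<sigma> \<subseteq> {1..k} - {j}"
  shows "ratio (W (Suc n) z) j \<sigma> = (\<Sum>\<tau>\<in>Pow inner_edges. prob z (W n z) \<sigma> \<tau>
           * (\<Prod>i\<in>ends H (\<Phi> j). ratio (W n z) (\<phi> j) (occupied i (\<tau> \<union> \<Phi> ` \<sigma>))))"
  unfolding ratio_Suc[OF assms(3,4)] prob_def
  by (rule ratio_step[OF good_nonzero[OF assms(1) _ k_pos] assms(3,4)])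
     (use assms(2) in \<open>simp_all add: admissible_def\<close>)

definition oscset :: "nat \<Rightarrow> complex \<Rightarrow> real set" where
  "oscset n z = insert 0 ((\<lambda>(j, \<sigma>, \<sigma>'). norm (ratio (W n z) j \<sigma> - ratio (W n z) j \<sigma>'))
     ` (SIGMA j:stable. Pow ({1..k} - {j}) \<times> Pow ({1..k} - {j})))"

definition osc :: "nat \<Rightarrow> complex \<Rightarrow> real" where "osc n z = Max (oscset n z)"

lemma finite_oscset: "finite (oscset n z)"
proof -
  have "finite stable" unfolding stable_def by simp
  then show ?thesis unfolding oscset_def by simp
qed

lemma osc_ge:
  assumes "j \<in> stable" "\<sigma> \<subseteq> {1..k} - {j}" "\<sigma>' \<subseteq> {1..k} - {j}"
  shows "norm (ratio (W n z) j \<sigma> - ratio (W n z) j \<sigma>') \<le> osc n z"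
  unfolding osc_def
proof (rule Max_ge[OF finite_oscset])
  have "(j, \<sigma>, \<sigma>') \<in> (SIGMA j:stable. Pow ({1..k} - {j}) \<times> Pow ({1..k} - {j}))" using assms by simp
  then show "norm (ratio (W n z) j \<sigma> - ratio (W n z) j \<sigma>') \<in> oscset n z"
    unfolding oscset_def by (intro insertI2 rev_image_eqI) (assumption, simp)
qed

lemma osc_nonneg: "0 \<le> osc n z"
  unfolding osc_def by (rule Max_ge[OF finite_oscset]) (simp add: oscset_def)

lemma osc_le:
  assumes "0 \<le> B" "\<And>j \<sigma> \<sigma>'. j \<in> stable \<Longrightarrow> \<sigma> \<subseteq> {1..k} - {j} \<Longrightarrow> \<sigma>' \<subseteq> {1..k} - {j}
      \<Longrightarrow> norm (ratio (W n z) j \<sigma> - ratio (W n z) j \<sigma>') \<le> B"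
  shows "osc n z \<le> B"
proof -
  have "oscset n z \<noteq> {}" unfolding oscset_def by simp
  moreover have "v \<le> B" if "v \<in> oscset n z" for v
    using that assms unfolding oscset_def by auto
  ultimately show ?thesis unfolding osc_def using Max_le_iff[OF finite_oscset] by blast
qed

text \<open>
  The variation is at most \<open>L\<close> when the boundary condition only changes at labels that are linked
  to \<open>j\<close> by \<open>t\<close> steps. For \<open>t = 0\<close> these are all labels other than \<open>j\<close>, and for large \<open>t\<close> they lie in
  other components.
\<close>

definition sensitive :: "nat \<Rightarrow> nat \<Rightarrow> complex \<Rightarrow> real \<Rightarrow> bool" where
  "sensitive t n z L \<longleftrightarrow> (\<forall>j\<in>stable. \<forall>\<sigma>\<subseteq>{1..k} - {j}. \<forall>\<sigma>'\<subseteq>{1..k} - {j}.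
     (\<sigma> - \<sigma>') \<union> (\<sigma>' - \<sigma>) \<subseteq> {b. (j, b) \<in> linked t}
     \<longrightarrow> norm (ratio (W n z) j \<sigma> - ratio (W n z) j \<sigma>') \<le> L)"

lemma sensitive_osc: "sensitive t n z (osc n z)"
  unfolding sensitive_def using osc_ge by blast

lemma sensitive_mono: "sensitive t n z L \<Longrightarrow> L \<le> L' \<Longrightarrow> sensitive t n z L'"
  unfolding sensitive_def by (meson order_trans)

lemma osc_le_sensitive:
  assumes "sensitive 0 n z L" "0 \<le> L"
  shows "osc n z \<le> L"
proof (rule osc_le[OF assms(2)])
  fix j \<sigma> \<sigma>' assume j: "j \<in> stable" and s: "\<sigma> \<subseteq> {1..k} - {j}" "\<sigma>' \<subseteq> {1..k} - {j}"
  have "(\<sigma> - \<sigma>') \<union> (\<sigma>' - \<sigma>) \<subseteq> {b. (j, b) \<in> linked 0}"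
    using s stable_mem[OF j] by auto
  then show "norm (ratio (W n z) j \<sigma> - ratio (W n z) j \<sigma>') \<le> L"
    using assms(1) j s unfolding sensitive_def by blast
qed

lemma sensitive_separating:
  assumes "separating R" "\<And>S. S \<subseteq> {1..k} \<Longrightarrow> W n z S \<noteq> 0"
  shows "sensitive R n z 0"
  unfolding sensitive_def
proof (intro ballI allI impI)
  fix j \<sigma> \<sigma>' assume j: "j \<in> stable" and s: "\<sigma> \<subseteq> {1..k} - {j}" "\<sigma>' \<subseteq> {1..k} - {j}"
    and d: "(\<sigma> - \<sigma>') \<union> (\<sigma>' - \<sigma>) \<subseteq> {b. (j, b) \<in> linked R}"
  have "ratio (W n z) j \<sigma> = ratio (W n z) j \<sigma>'"
    by (rule ratio_far[OF assms stable_mem[OF j] _ _ d]) (use s in auto)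
  then show "norm (ratio (W n z) j \<sigma> - ratio (W n z) j \<sigma>') \<le> 0" by simp
qed

context
  fixes a :: real and z :: complex and x :: real
  assumes z: "near a z x" and a: "admissible a"
begin

lemma x_pos: "0 < x"
  using z unfolding near_def by simp

text \<open>
  If no inner glued vertex is occupied, the copy that carries \<open>j\<close> sees a change of the boundary
  condition only at labels in the same copy, that is at labels linked to \<open>\<phi> j\<close> by one more step.
  In the remaining cases the variation is at most the full oscillation.
\<close>

lemma sensitive_Suc:
  assumes g: "good k a (W n z)" and L: "sensitive (Suc t) n z L"
  shows "sensitive t (Suc n) z (doeblin x * L + (1 - doeblin x + slack a) * osc n z)"
  unfolding sensitive_def
proof (intro ballI allI impI)
  fix j \<sigma> \<sigma>' assume j: "j \<in> stable" and s: "\<sigma> \<subseteq> {1..k} - {j}" "\<sigma>' \<subseteq> {1..k} - {j}"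
    and d: "(\<sigma> - \<sigma>') \<union> (\<sigma>' - \<sigma>) \<subseteq> {b. (j, b) \<in> linked t}"
  obtain i where i: "ends H (\<Phi> j) = {i}" using stable_ends[OF j] by blast
  have jk: "j \<in> {1..k}" using stable_mem[OF j] .
  let ?r = "ratio (W n z) (\<phi> j)" and ?o = "\<lambda>\<sigma> \<tau>. occupied i (\<tau> \<union> \<Phi> ` \<sigma>)"
  have sk: "\<sigma> \<subseteq> {1..k}" "\<sigma>' \<subseteq> {1..k}" using s by auto
  have avg: "ratio (W (Suc n) z) j \<sigma> = (\<Sum>\<tau>\<in>Pow inner_edges. prob z (W n z) \<sigma> \<tau> * ?r (?o \<sigma> \<tau>))"
    if "\<sigma> \<subseteq> {1..k} - {j}" for \<sigma>
    using ratio_Suc_average[OF g a jk that] unfolding i by simp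
  have om: "?o \<sigma> \<tau> \<subseteq> {1..k} - {\<phi> j}" if "\<sigma> \<subseteq> {1..k} - {j}" "\<tau> \<in> Pow inner_edges" for \<sigma> \<tau>
    by (rule fresh_mark[OF jk that(1)]) (use that(2) i in auto)
  have sub: "?o \<sigma> {} - ?o \<sigma>' {} \<subseteq> {b. (\<phi> j, b) \<in> linked (Suc t)}"
    if dd: "\<sigma> - \<sigma>' \<subseteq> {b. (j, b) \<in> linked t}" for \<sigma> \<sigma>'
  proof
    fix b assume "b \<in> ?o \<sigma> {} - ?o \<sigma>' {}"
    then obtain b' where b: "b' \<in> \<sigma>" "i \<in> ends H (\<Phi> b')" "b = \<phi> b'" "b' \<notin> \<sigma>'"
      unfolding occupied_def \<phi>_def by auto
    then have "(j, b') \<in> linked t" using dd by blast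
    moreover have "ends H (\<Phi> j) \<inter> ends H (\<Phi> b') \<noteq> {}" using b(2) i by auto
    ultimately show "b \<in> {b. (\<phi> j, b) \<in> linked (Suc t)}" using b(3) by auto
  qed
  have "norm ((\<Sum>\<tau>\<in>Pow inner_edges. prob z (W n z) \<sigma> \<tau> * ?r (?o \<sigma> \<tau>))
      - (\<Sum>\<tau>\<in>Pow inner_edges. prob z (W n z) \<sigma>' \<tau> * ?r (?o \<sigma>' \<tau>)))
      \<le> doeblin x * L + (1 - doeblin x + 4 * (slack a / 4)) * osc n z"
  proof (rule weights_contract[OF prob_weights[OF g z a sk(1)] prob_weights[OF g z a sk(2)]])
    show "0 \<le> doeblin x" "doeblin x \<le> 1 / 2" using doeblin_bounds[OF x_pos] by auto
    show "0 \<le> slack a / 4" "slack a / 4 \<le> 1"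
      using a slack_nonneg[of a] unfolding admissible_def by auto
    show "0 \<le> osc n z" by (rule osc_nonneg)
    show "norm (?r (?o \<sigma> \<tau>) - ?r (?o \<sigma>' \<tau>')) \<le> osc n z" if "\<tau> \<in> Pow inner_edges" "\<tau>' \<in> Pow inner_edges" for \<tau> \<tau>'
      using osc_ge[OF stable_\<phi>[OF j] om[OF s(1) that(1)] om[OF s(2) that(2)]] .
    have "(?o \<sigma> {} - ?o \<sigma>' {}) \<union> (?o \<sigma>' {} - ?o \<sigma> {}) \<subseteq> {b. (\<phi> j, b) \<in> linked (Suc t)}"
      using sub[of \<sigma> \<sigma>'] sub[of \<sigma>' \<sigma>] d by blast
    then show "norm (?r (?o \<sigma> {}) - ?r (?o \<sigma>' {})) \<le> L"
      using L stable_\<phi>[OF j] om[OF s(1), of "{}"] om[OF s(2), of "{}"] unfolding sensitive_def by blast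
  qed (auto simp: finite_inner_edges)
  then show "norm (ratio (W (Suc n) z) j \<sigma> - ratio (W (Suc n) z) j \<sigma>')
      \<le> doeblin x * L + (1 - doeblin x + slack a) * osc n z"
    unfolding avg[OF s(1)] avg[OF s(2)] by simp
qed

lemma osc_Suc:
  assumes "good k a (W n z)"
  shows "osc (Suc n) z \<le> (1 + slack a) * osc n z"
proof -
  have "sensitive 0 (Suc n) z (doeblin x * osc n z + (1 - doeblin x + slack a) * osc n z)"
    by (rule sensitive_Suc[OF assms sensitive_osc])
  then have "sensitive 0 (Suc n) z ((1 + slack a) * osc n z)" by (simp add: algebra_simps)
  moreover have "0 \<le> (1 + slack a) * osc n z"
    using osc_nonneg slack_nonneg[of a] a unfolding admissible_def by simp
  ultimately show ?thesis by (rule osc_le_sensitive)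
qed

text \<open>
  The contraction factor over \<open>R\<close> steps: with probability about \<open>doeblin x ^ R\<close> the influence of the
  boundary condition is lost.
\<close>

definition "rate R = (1 + slack a) ^ R - doeblin x ^ R"

text \<open>
  With \<open>b = 1 - c + slack a\<close> for \<open>c = doeblin x\<close>, the bounds \<open>y\<^sub>s * osc n z\<close> for \<open>sensitive (R - s)\<close> satisfy
  \<open>y\<^sub>s\<^sub>+\<^sub>1 = c * y\<^sub>s + b * (1 + slack a) ^ s\<close> and \<open>y\<^sub>0 = 0\<close>, whose solution is \<open>rate s\<close>.
\<close>

lemma osc_add:
  assumes R: "separating R" and g: "\<And>s. s < R \<Longrightarrow> good k a (W (n + s) z)"
    and nz: "\<And>S. S \<subseteq> {1..k} \<Longrightarrow> W n z S \<noteq> 0"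
  shows "osc (n + R) z \<le> rate R * osc n z"
proof -
  have e: "0 \<le> slack a" using a slack_nonneg unfolding admissible_def by simp
  have "osc (n + s) z \<le> (1 + slack a) ^ s * osc n z
      \<and> sensitive (R - s) (n + s) z (rate s * osc n z)" if "s \<le> R" for s
    using that
  proof (induction s)
    case 0
    then show ?case using sensitive_separating[OF R nz] by (simp add: rate_def)
  next
    case (Suc s)
    have gs: "good k a (W (n + s) z)" using g Suc.prems by simp
    have IH: "osc (n + s) z \<le> (1 + slack a) ^ s * osc n z"
      "sensitive (Suc (R - Suc s)) (n + s) z (rate s * osc n z)"
      using Suc by (auto simp: Suc_diff_Suc)
    have 1: "osc (n + Suc s) z \<le> (1 + slack a) ^ Suc s * osc n z"
      using order_trans[OF osc_Suc[OF gs] mult_left_mono[OF IH(1), of "1 + slack a"]] e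
      by (simp add: mult.assoc)
    have "doeblin x * (rate s * osc n z) + (1 - doeblin x + slack a) * osc (n + s) z
        \<le> doeblin x * (rate s * osc n z) + (1 - doeblin x + slack a) * ((1 + slack a) ^ s * osc n z)"
      using IH(1) e doeblin_bounds[OF x_pos] by (intro add_left_mono mult_left_mono) auto
    also have "\<dots> = rate (Suc s) * osc n z"
      unfolding rate_def by (simp add: algebra_simps)
    finally have "sensitive (R - Suc s) (n + Suc s) z (rate (Suc s) * osc n z)"
      using sensitive_mono[OF sensitive_Suc[OF gs IH(2)]] by simp
    then show ?case using 1 by blast
  qed
  from this[of R] have "sensitive 0 (n + R) z (rate R * osc n z)" by simp
  moreover have "0 \<le> rate R * osc n z"
  proof -
    have "doeblin x ^ R \<le> (1 + slack a) ^ R" using doeblin_bounds[OF x_pos] e by (intro power_mono) auto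
    then show ?thesis unfolding rate_def using osc_nonneg by simp
  qed
  ultimately show ?thesis by (rule osc_le_sensitive)
qed

lemma drift:
  assumes g: "good k a (W n z)" and j: "j \<in> stable"
  shows "norm (ratio (W (Suc n) z) j {} - ratio (W n z) (\<phi> j) {}) \<le> 2 * osc n z"
proof -
  obtain i where i: "ends H (\<Phi> j) = {i}" using stable_ends[OF j] by blast
  have jk: "j \<in> {1..k}" using stable_mem[OF j] .
  let ?r = "ratio (W n z) (\<phi> j)" and ?o = "\<lambda>\<tau>. occupied i (\<tau> \<union> \<Phi> ` {})"
  have avg: "ratio (W (Suc n) z) j {} = (\<Sum>\<tau>\<in>Pow inner_edges. prob z (W n z) {} \<tau> * ?r (?o \<tau>))"
    using ratio_Suc_average[OF g a jk, of "{}"] unfolding i by simp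
  have om: "?o \<tau> \<subseteq> {1..k} - {\<phi> j}" if "\<tau> \<in> Pow inner_edges" for \<tau>
    by (rule fresh_mark[OF jk]) (use that i in auto)
  have "norm ((\<Sum>\<tau>\<in>Pow inner_edges. prob z (W n z) {} \<tau> * ?r (?o \<tau>)) - ?r {}) \<le> (1 + slack a / 4) * osc n z"
  proof (rule weights_average[OF prob_weights[OF g z a]])
    show "norm (?r (?o \<tau>) - ?r {}) \<le> osc n z" if "\<tau> \<in> Pow inner_edges" for \<tau>
      using osc_ge[OF stable_\<phi>[OF j] om[OF that]] by simp
  qed (use doeblin_bounds[OF x_pos] osc_nonneg finite_inner_edges in auto)
  also have "\<dots> \<le> 2 * osc n z"
    using a osc_nonneg unfolding admissible_def by (intro mult_right_mono) auto
  finally show ?thesis unfolding avg .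
qed

text \<open>
  Following a stable label back in time along \<open>\<phi>\<close>, its ratio moves in each step by at most twice the
  current oscillation.
\<close>

lemma stable_tracking:
  assumes g: "\<And>n'. N \<le> n' \<Longrightarrow> n' < N + s \<Longrightarrow> good k a (W n' z)" and j: "j \<in> stable"
  shows "norm (ratio (W (N + s) z) j {} - ratio (W N z) ((\<phi> ^^ s) j) {}) \<le> 2 * (\<Sum>u<s. osc (N + u) z)"
  using assms
proof (induction s arbitrary: j)
  case (Suc s)
  have "norm (ratio (W (N + s) z) (\<phi> j) {} - ratio (W N z) ((\<phi> ^^ s) (\<phi> j)) {})
      \<le> 2 * (\<Sum>u<s. osc (N + u) z)"
    using Suc.prems by (intro Suc.IH stable_\<phi>) auto
  moreover have "norm (ratio (W (Suc (N + s)) z) j {} - ratio (W (N + s) z) (\<phi> j) {}) \<le> 2 * osc (N + s) z"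
    using Suc.prems by (intro drift) auto
  moreover have "(\<phi> ^^ s) (\<phi> j) = (\<phi> ^^ Suc s) j" by (simp add: funpow_swap1)
  ultimately show ?case
    using norm_triangle_ineq[of "ratio (W (Suc (N + s)) z) j {} - ratio (W (N + s) z) (\<phi> j) {}"
        "ratio (W (N + s) z) (\<phi> j) {} - ratio (W N z) ((\<phi> ^^ s) (\<phi> j)) {}"]
    by (simp add: algebra_simps)
qed simp

text \<open>
  The centre \<open>t\<close> does not depend on the boundary condition, in contrast to \<open>good\<close>. Products of such
  ratios are then close to a single number, which makes the property pass from \<open>\<phi> j\<close> to \<open>j\<close>.
\<close>

definition tube :: "real \<Rightarrow> nat \<Rightarrow> nat \<Rightarrow> bool" where
  "tube b n j \<longleftrightarrow> (\<exists>t\<le>1. \<forall>\<sigma>\<subseteq>{1..k} - {j}. near b (ratio (W n z) j \<sigma>) t)"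

lemma tube_Suc:
  assumes g: "good k a (W n z)" and j: "j \<in> {1..k}" and t: "tube b n (\<phi> j)"
  shows "tube (1 + 2 * (b ^ m - 1)) (Suc n) j"
proof -
  obtain t where t: "t \<le> 1" "\<And>\<sigma>. \<sigma> \<subseteq> {1..k} - {\<phi> j} \<Longrightarrow> near b (ratio (W n z) (\<phi> j) \<sigma>) t"
    using t unfolding tube_def by blast
  have t0: "0 < t" using t(2)[of "{}"] unfolding near_def by simp
  have b: "1 \<le> b" using near_ge_1 t(2)[of "{}"] by simp
  let ?E = "ends H (\<Phi> j)"
  have E: "?E \<subseteq> {1..m}" "finite ?E" using ends_sub[OF Phi_mem[OF j]] finite_subset by auto
  have "card ?E \<le> m" using card_mono[OF _ E(1)] by simp
  then have bm: "b ^ card ?E \<le> b ^ m" using b by (intro power_increasing)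
  have "near (1 + 2 * (b ^ m - 1)) (ratio (W (Suc n) z) j \<sigma>) (t ^ card ?E)"
    if s: "\<sigma> \<subseteq> {1..k} - {j}" for \<sigma>
  proof -
    have "norm (ratio (W (Suc n) z) j \<sigma> - of_real (t ^ card ?E)) \<le> (1 + slack a / 4) * ((b ^ m - 1) * t ^ card ?E)"
      unfolding ratio_Suc_average[OF g a j s]
    proof (rule weights_average[OF prob_weights[OF g z a]])
      fix \<tau> assume "\<tau> \<in> Pow inner_edges"
      then have "occupied i (\<tau> \<union> \<Phi> ` \<sigma>) \<subseteq> {1..k} - {\<phi> j}" if "i \<in> ?E" for i
        using fresh_mark[OF j s _ that] by blast
      then have "near (b ^ card ?E) (\<Prod>i\<in>?E. ratio (W n z) (\<phi> j) (occupied i (\<tau> \<union> \<Phi> ` \<sigma>))) (\<Prod>i\<in>?E. t)"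
        using t(2) by (intro near_prod E(2)) auto
      then have "near (b ^ m) (\<Prod>i\<in>?E. ratio (W n z) (\<phi> j) (occupied i (\<tau> \<union> \<Phi> ` \<sigma>))) (t ^ card ?E)"
        using near_mono[OF _ bm] by simp
      then show "norm ((\<Prod>i\<in>?E. ratio (W n z) (\<phi> j) (occupied i (\<tau> \<union> \<Phi> ` \<sigma>))) - of_real (t ^ card ?E))
          \<le> (b ^ m - 1) * t ^ card ?E"
        unfolding near_def by blast
    qed (use doeblin_bounds[OF x_pos] t0 b s finite_inner_edges in auto)
    also have "\<dots> \<le> 2 * ((b ^ m - 1) * t ^ card ?E)"
      using a t0 b unfolding admissible_def by (intro mult_right_mono) auto
    also have "\<dots> = (1 + 2 * (b ^ m - 1) - 1) * t ^ card ?E" by simp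
    finally show ?thesis using t0 unfolding near_def by (intro conjI) simp
  qed
  moreover have "t ^ card ?E \<le> 1" using t t0 by (simp add: power_le_one)
  ultimately show ?thesis unfolding tube_def by blast
qed

text \<open>
  Labels that become stable or dead only after \<open>d\<close> steps inherit their control with \<open>d\<close> steps delay
  and with a relative error that is enlarged \<open>d\<close> times.
\<close>

lemma tube_depth:
  assumes g: "\<And>n'. N \<le> n' \<Longrightarrow> n' < n \<Longrightarrow> good k a (W n' z)"
    and base: "\<And>n' j. N \<le> n' \<Longrightarrow> n' \<le> n \<Longrightarrow> j \<in> stable \<union> dead \<Longrightarrow> tube b n' j"
    and "N + d \<le> n'" "n' \<le> n" "j \<in> {1..k}" "(\<phi> ^^ d) j \<in> stable \<union> dead"
  shows "tube (((\<lambda>b. 1 + 2 * (b ^ m - 1)) ^^ d) b) n' j"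
  using assms(3-)
proof (induction d arbitrary: n' j)
  case 0
  then show ?case using base by simp
next
  case (Suc d)
  then obtain n'' where n'': "n' = Suc n''" by (metis Suc_le_D add_Suc_right)
  have "tube (((\<lambda>b. 1 + 2 * (b ^ m - 1)) ^^ d) b) n'' (\<phi> j)"
    using Suc.prems n'' \<phi>_mem by (intro Suc.IH) (auto simp: funpow_swap1 simp del: atLeastAtMost_iff)
  then show ?case
    unfolding n'' funpow.simps(2) o_apply
    using Suc.prems n'' by (intro tube_Suc g) auto
qed

end

end

section \<open>Positive activities\<close>

context recursive_sequence
begin

definition w :: "nat \<Rightarrow> real \<Rightarrow> nat set \<Rightarrow> real" where
  "w n x S = boundary_poly k (G n) S x"

lemma W_of_real: "W n (of_real x) S = of_real (w n x S)"
  unfolding W_def w_def by (rule boundary_poly_of_real)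

lemma w_antimono: "0 \<le> x \<Longrightarrow> S \<subseteq> S' \<Longrightarrow> w n x S' \<le> w n x S"
  unfolding w_def by (intro boundary_poly_antimono[OF G_marked])

lemma w_nonneg: "0 \<le> x \<Longrightarrow> 0 \<le> w n x S"
  unfolding w_def by (rule boundary_poly_nonneg)

lemma w_empty_ge_1: "0 \<le> x \<Longrightarrow> 1 \<le> w n x {}"
  unfolding w_def by (rule boundary_poly_ge_1[OF G_marked]) (simp_all add: indep_empty[OF G_marked])

lemma eventually_far: "\<exists>N. \<forall>n\<ge>N. \<forall>S\<subseteq>{1..k}. indep (G n) (mark (G n) ` S)"
proof -
  have "\<forall>\<^sub>F n in sequentially. min_mark_distance k (G n) > 1"
    by (rule order_tendstoD(1)[OF marks_diverge]) (simp add: one_enat_def)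
  then show ?thesis
    unfolding eventually_sequentially using indep_marks[OF G_marked] by blast
qed

text \<open>
  From this time on, marked vertices are pairwise non-adjacent, so no boundary condition is
  impossible.
\<close>

definition burn_in :: nat where
  "burn_in = (SOME N. \<forall>n\<ge>N. \<forall>S\<subseteq>{1..k}. indep (G n) (mark (G n) ` S))"

lemma indep_burn_in: "burn_in \<le> n \<Longrightarrow> S \<subseteq> {1..k} \<Longrightarrow> indep (G n) (mark (G n) ` S)"
  using someI_ex[OF eventually_far] unfolding burn_in_def by blast

lemma w_ge_1: "0 \<le> x \<Longrightarrow> burn_in \<le> n \<Longrightarrow> S \<subseteq> {1..k} \<Longrightarrow> 1 \<le> w n x S"
  unfolding w_def by (intro boundary_poly_ge_1[OF G_marked] indep_burn_in)

lemma ratio_of_real: "ratio (W n (of_real x)) j \<sigma> = of_real (w n x (insert j \<sigma>) / w n x \<sigma>)"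
  unfolding ratio_def W_of_real by simp

text \<open>
  At nonnegative activities all ratios lie in \<open>{0<..1}\<close>, once no two marked vertices are adjacent.
\<close>

lemma w_quotient:
  assumes "0 \<le> x" "burn_in \<le> n" "j \<in> {1..k}" "\<sigma> \<subseteq> {1..k} - {j}"
  shows "0 < w n x (insert j \<sigma>) / w n x \<sigma>" "w n x (insert j \<sigma>) / w n x \<sigma> \<le> 1"
proof -
  have "insert j \<sigma> \<subseteq> {1..k}" "\<sigma> \<subseteq> {1..k}" using assms by auto
  then have "1 \<le> w n x (insert j \<sigma>)" "1 \<le> w n x \<sigma>" using w_ge_1 assms by auto
  moreover have "w n x (insert j \<sigma>) \<le> w n x \<sigma>" using assms by (intro w_antimono) auto
  ultimately show "0 < w n x (insert j \<sigma>) / w n x \<sigma>" "w n x (insert j \<sigma>) / w n x \<sigma> \<le> 1" by auto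
qed

lemma good_real:
  assumes "0 \<le> x" "burn_in \<le> n" "1 \<le> a"
  shows "good k a (W n (of_real x))"
  unfolding good_def
proof (intro ballI allI impI)
  fix j \<sigma> assume "j \<in> {1..k}" "\<sigma> \<subseteq> {1..k} - {j}"
  from w_quotient[OF assms(1,2) this] show "\<exists>t\<le>1. near a (ratio (W n (of_real x)) j \<sigma>) t"
    unfolding ratio_of_real using near_self[OF _ assms(3)] by blast
qed

text \<open>
  The ratio of a stable label is an average of earlier ratios of stable labels. So the smallest
  ratio at time \<open>burn_in\<close> stays a lower bound. A bound independent of \<open>n\<close> is needed to
  turn absolute errors into relative ones before the starting time \<open>N\<close> is chosen in
  \<open>uniform_good\<close>.
\<close>

lemma stable_ratio_lower:
  assumes x: "0 < x"
  shows "\<exists>\<kappa>>0. \<forall>n\<ge>burn_in. \<forall>j\<in>stable. \<forall>\<sigma>\<subseteq>{1..k} - {j}. \<kappa> \<le> w n x (insert j \<sigma>) / w n x \<sigma>"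
proof -
  let ?A = "insert 1 ((\<lambda>(j, \<sigma>). w burn_in x (insert j \<sigma>) / w burn_in x \<sigma>) ` (SIGMA j:stable. Pow ({1..k} - {j})))"
  define \<kappa> where "\<kappa> = Min ?A"
  have "finite stable" unfolding stable_def by simp
  then have fin: "finite ?A" by simp
  have "0 < v" if "v \<in> ?A" for v
    using that w_quotient(1)[of x burn_in] x stable_mem by fastforce
  then have \<kappa>0: "0 < \<kappa>" unfolding \<kappa>_def using Min_in[OF fin] by blast
  have low: "\<kappa> * w n x \<sigma> \<le> w n x (insert j \<sigma>)"
    if "burn_in \<le> n" "j \<in> stable" "\<sigma> \<subseteq> {1..k} - {j}" for n j \<sigma>
    using that
  proof (induction n arbitrary: j \<sigma> rule: dec_induct)
    case base
    have "(j, \<sigma>) \<in> (SIGMA j:stable. Pow ({1..k} - {j}))" using base by simp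
    then have "w burn_in x (insert j \<sigma>) / w burn_in x \<sigma> \<in> ?A" by (intro insertI2 rev_image_eqI) (assumption, simp)
    then have "\<kappa> \<le> w burn_in x (insert j \<sigma>) / w burn_in x \<sigma>" unfolding \<kappa>_def by (rule Min_le[OF fin])
    moreover have "1 \<le> w burn_in x \<sigma>" using base x by (intro w_ge_1) auto
    ultimately show ?case by (simp add: le_divide_eq)
  next
    case (step n)
    have jk: "j \<in> {1..k}" using stable_mem[OF step.prems(1)] .
    obtain i where i: "ends H (\<Phi> j) = {i}" using stable_ends[OF step.prems(1)] by blast
    have im: "i \<in> {1..m}" using ends_sub[OF Phi_mem[OF jk]] i by blast
    have w_Suc: "w (Suc n) x S = (\<Sum>\<tau>\<in>Pow inner_edges. x ^ card \<tau> * (\<Prod>i\<in>{1..m}. w n x (occupied i (\<tau> \<union> \<Phi> ` S))))"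
      if "S \<subseteq> {1..k}" for S
      unfolding w_def G_Suc by (rule boundary_poly_recursion[OF G_marked that])
    have sk: "\<sigma> \<subseteq> {1..k}" "insert j \<sigma> \<subseteq> {1..k}" using step.prems(2) jk by auto
    have "\<kappa> * (x ^ card \<tau> * (\<Prod>i\<in>{1..m}. w n x (occupied i (\<tau> \<union> \<Phi> ` \<sigma>))))
        \<le> x ^ card \<tau> * (\<Prod>i\<in>{1..m}. w n x (occupied i (\<tau> \<union> \<Phi> ` insert j \<sigma>)))"
      if \<tau>: "\<tau> \<in> Pow inner_edges" for \<tau>
    proof -
      have o1: "occupied i (\<tau> \<union> \<Phi> ` insert j \<sigma>) = insert (\<phi> j) (occupied i (\<tau> \<union> \<Phi> ` \<sigma>))"
        unfolding occupied_def \<phi>_def using i by auto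
      have o2: "occupied i' (\<tau> \<union> \<Phi> ` insert j \<sigma>) = occupied i' (\<tau> \<union> \<Phi> ` \<sigma>)" if "i' \<noteq> i" for i'
        unfolding occupied_def using i that by auto
      let ?P = "\<Prod>i\<in>{1..m} - {i}. w n x (occupied i (\<tau> \<union> \<Phi> ` \<sigma>))"
      have "occupied i (\<tau> \<union> \<Phi> ` \<sigma>) \<subseteq> {1..k} - {\<phi> j}"
        using fresh_mark[OF jk step.prems(2)] \<tau> i by simp
      then have "\<kappa> * w n x (occupied i (\<tau> \<union> \<Phi> ` \<sigma>)) \<le> w n x (occupied i (\<tau> \<union> \<Phi> ` insert j \<sigma>))"
        unfolding o1 by (rule step.IH[OF stable_\<phi>[OF step.prems(1)]])
      then have "(\<kappa> * w n x (occupied i (\<tau> \<union> \<Phi> ` \<sigma>))) * ?P \<le> w n x (occupied i (\<tau> \<union> \<Phi> ` insert j \<sigma>)) * ?P"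
        using x by (intro mult_right_mono prod_nonneg) (auto intro: w_nonneg)
      also have Peq: "?P = (\<Prod>i\<in>{1..m} - {i}. w n x (occupied i (\<tau> \<union> \<Phi> ` insert j \<sigma>)))"
        by (intro prod.cong refl) (simp add: o2 del: image_insert)
      also have "w n x (occupied i (\<tau> \<union> \<Phi> ` insert j \<sigma>)) * \<dots> = (\<Prod>i\<in>{1..m}. w n x (occupied i (\<tau> \<union> \<Phi> ` insert j \<sigma>)))"
        by (rule prod.remove[symmetric]) (use im in auto)
      finally have "\<kappa> * (w n x (occupied i (\<tau> \<union> \<Phi> ` \<sigma>)) * (\<Prod>i\<in>{1..m} - {i}. w n x (occupied i (\<tau> \<union> \<Phi> ` \<sigma>))))
          \<le> (\<Prod>i\<in>{1..m}. w n x (occupied i (\<tau> \<union> \<Phi> ` insert j \<sigma>)))"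
        by (simp only: mult.assoc Peq)
      also have "w n x (occupied i (\<tau> \<union> \<Phi> ` \<sigma>)) * (\<Prod>i\<in>{1..m} - {i}. w n x (occupied i (\<tau> \<union> \<Phi> ` \<sigma>)))
          = (\<Prod>i\<in>{1..m}. w n x (occupied i (\<tau> \<union> \<Phi> ` \<sigma>)))"
        by (rule prod.remove[symmetric]) (use im in auto)
      finally show ?thesis using mult_left_mono[of _ _ "x ^ card \<tau>"] x by (simp add: mult.left_commute)
    qed
    then show ?case
      unfolding w_Suc[OF sk(1)] w_Suc[OF sk(2)] sum_distrib_left by (intro sum_mono)
  qed
  have "\<kappa> \<le> w n x (insert j \<sigma>) / w n x \<sigma>"
    if "burn_in \<le> n" "j \<in> stable" "\<sigma> \<subseteq> {1..k} - {j}" for n j \<sigma>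
  proof -
    have "1 \<le> w n x \<sigma>" using that x by (intro w_ge_1) auto
    then show ?thesis using low[OF that] by (simp add: le_divide_eq)
  qed
  then show ?thesis using \<kappa>0 by blast
qed

lemma osc_real_small:
  assumes x: "0 < x" and R: "separating R" and d: "0 < \<delta>"
  shows "\<exists>N\<ge>burn_in. osc N (of_real x) \<le> \<delta>"
proof -
  have near: "near 1 (of_real x) x" using near_self[OF x, of 1] by simp
  have adm: "admissible 1" unfolding admissible_def slack_def by simp
  define q where "q = 1 - doeblin x ^ R"
  have cR: "0 < doeblin x ^ R" "doeblin x ^ R \<le> 1"
    using doeblin_bounds[OF x] by (auto intro: power_le_one)
  then have q: "0 \<le> q" "q < 1" unfolding q_def by auto
  have one: "osc (n + R) (of_real x) \<le> q * osc n (of_real x)" if "burn_in \<le> n" for n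
  proof -
    have "osc (n + R) (of_real x) \<le> rate 1 x R * osc n (of_real x)"
    proof (rule osc_add[OF near adm R])
      show "good k 1 (W (n + s) (of_real x))" for s using good_real[of x "n + s" 1] x that by simp
      show "W n (of_real x) S \<noteq> 0" if "S \<subseteq> {1..k}" for S
        using w_ge_1[of x n S] x that \<open>burn_in \<le> n\<close> by (simp add: W_of_real)
    qed
    moreover have "rate 1 x R = q"
      using rate_def[OF near adm] unfolding q_def slack_def by simp
    ultimately show ?thesis by simp
  qed
  have pw: "osc (burn_in + i * R) (of_real x) \<le> q ^ i * osc burn_in (of_real x)" for i
  proof (induction i)
    case (Suc i)
    have "osc (burn_in + Suc i * R) (of_real x) \<le> q * osc (burn_in + i * R) (of_real x)"
      using one[of "burn_in + i * R"] by (simp add: algebra_simps)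
    also have "\<dots> \<le> q * (q ^ i * osc burn_in (of_real x))" using Suc q(1) by (rule mult_left_mono)
    finally show ?case by (simp add: mult.assoc)
  qed simp
  have "(\<lambda>i. q ^ i * osc burn_in (of_real x)) \<longlonglongrightarrow> 0 * osc burn_in (of_real x)"
    by (intro tendsto_mult tendsto_const LIMSEQ_power_zero) (use q in auto)
  then have "\<forall>\<^sub>F i in sequentially. q ^ i * osc burn_in (of_real x) < \<delta>"
    by (rule order_tendstoD(2)) (use d in simp)
  then obtain i where "q ^ i * osc burn_in (of_real x) < \<delta>"
    using eventually_happens'[OF sequentially_bot] by blast
  then show ?thesis using pw[of i] by (intro exI[of _ "burn_in + i * R"]) auto
qed

section \<open>Uniform control near a positive activity\<close>

lemma ex_admissible:
  assumes x: "0 < x"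
  shows "\<exists>a>1. admissible a \<and> (1 + slack a) ^ R - doeblin x ^ R < 1"
proof -
  have p: "((\<lambda>a::real. a ^ num_factors) \<longlongrightarrow> 1 ^ num_factors) (at_right 1)"
    by (intro tendsto_intros)
  have e: "((\<lambda>a. slack a) \<longlongrightarrow> 32 * (1 ^ num_factors - 1)) (at_right 1)"
    unfolding slack_def by (intro tendsto_intros)
  have r: "((\<lambda>a. (1 + slack a) ^ R - doeblin x ^ R) \<longlongrightarrow> (1 + 32 * (1 ^ num_factors - 1)) ^ R - doeblin x ^ R) (at_right 1)"
    by (intro tendsto_intros e)
  have "\<forall>\<^sub>F a::real in at_right 1. a < 2"
    by (rule order_tendstoD(2)[OF tendsto_ident_at]) simp
  moreover have "\<forall>\<^sub>F a::real in at_right 1. a ^ num_factors < 3 / 2" by (rule order_tendstoD(2)[OF p]) simp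
  moreover have "\<forall>\<^sub>F a in at_right 1. slack a < 1" by (rule order_tendstoD(2)[OF e]) simp
  moreover have "\<forall>\<^sub>F a in at_right 1. (1 + slack a) ^ R - doeblin x ^ R < 1"
    by (rule order_tendstoD(2)[OF r]) (use doeblin_bounds[OF x] in simp)
  ultimately have "\<forall>\<^sub>F a::real in at_right 1.
      a ^ num_factors < 3 / 2 \<and> slack a < 1 \<and> (1 + slack a) ^ R - doeblin x ^ R < 1 \<and> 1 < a \<and> a < 2"
    using eventually_at_right_less[of "1::real"] by eventually_elim simp
  then obtain a where "a ^ num_factors < 3 / 2 \<and> slack a < 1 \<and> (1 + slack a) ^ R - doeblin x ^ R < 1 \<and> 1 < a \<and> a < 2"
    using eventually_happens'[OF trivial_limit_at_right_real] by blast
  then show ?thesis unfolding admissible_def by (intro exI[of _ a]) auto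
qed

text \<open>
  The iterated map is the enlargement of relative errors in \<open>tube_Suc\<close>; it is continuous and
  fixes \<open>1\<close>.
\<close>

lemma ex_inner_tube:
  assumes "1 < (a::real)"
  shows "\<exists>b>1. ((\<lambda>b. 1 + 2 * (b ^ m - 1)) ^^ K) b \<le> a"
proof -
  have "(((\<lambda>b. 1 + 2 * (b ^ m - 1)) ^^ K) \<longlongrightarrow> 1) (at_right (1::real))"
  proof (induction K)
    case 0
    show ?case by (simp add: id_def)
  next
    case (Suc K)
    have "((\<lambda>b. 1 + 2 * (((\<lambda>b. 1 + 2 * (b ^ m - 1)) ^^ K) b ^ m - 1)) \<longlongrightarrow> 1 + 2 * (1 ^ m - 1)) (at_right (1::real))"
      by (intro tendsto_intros Suc)
    then show ?case by (simp add: o_def)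
  qed
  then have "\<forall>\<^sub>F b in at_right (1::real). ((\<lambda>b. 1 + 2 * (b ^ m - 1)) ^^ K) b < a"
    by (rule order_tendstoD(2)) (use assms in simp)
  then have "\<forall>\<^sub>F b in at_right (1::real). 1 < b \<and> ((\<lambda>b. 1 + 2 * (b ^ m - 1)) ^^ K) b < a"
    using eventually_at_right_less[of "1::real"] by eventually_elim auto
  then obtain b where "1 < b \<and> ((\<lambda>b. 1 + 2 * (b ^ m - 1)) ^^ K) b < a"
    using eventually_happens'[OF trivial_limit_at_right_real] by blast
  then show ?thesis by (intro exI[of _ b]) auto
qed

lemma W_tendsto: "((\<lambda>z. W n z S) \<longlongrightarrow> W n z0 S) (nhds z0)"
  unfolding W_def boundary_poly_def by (intro tendsto_sum tendsto_power tendsto_ident_at filterlim_ident)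

lemma ratio_tendsto:
  assumes "W n z0 \<sigma> \<noteq> 0"
  shows "((\<lambda>z. ratio (W n z) j \<sigma>) \<longlongrightarrow> ratio (W n z0) j \<sigma>) (nhds z0)"
  unfolding ratio_def by (intro tendsto_divide W_tendsto assms)

lemma eventually_good:
  assumes x: "0 < x" and n: "burn_in \<le> n" and a: "1 < a"
  shows "\<forall>\<^sub>F z in nhds (of_real x). good k a (W n z)"
proof -
  have "\<forall>\<^sub>F z in nhds (of_real x). \<forall>j\<in>{1..k}. \<forall>\<sigma>\<in>Pow ({1..k} - {j}). \<exists>t\<le>1. near a (ratio (W n z) j \<sigma>) t"
  proof (intro eventually_ball_finite ballI)
    fix j \<sigma> assume j: "j \<in> {1..k}" and s: "\<sigma> \<in> Pow ({1..k} - {j})"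
    define t where "t = w n x (insert j \<sigma>) / w n x \<sigma>"
    have t: "0 < t" "t \<le> 1" unfolding t_def using w_quotient[of x n j \<sigma>] x n j s by auto
    have "1 \<le> w n x \<sigma>" using w_ge_1[of x n \<sigma>] x n s by auto
    then have "((\<lambda>z. ratio (W n z) j \<sigma>) \<longlongrightarrow> of_real t) (nhds (of_real x))"
      using ratio_tendsto[of n "of_real x" \<sigma> j] unfolding ratio_of_real t_def[symmetric] W_of_real by simp
    then have "\<forall>\<^sub>F z in nhds (of_real x). dist (ratio (W n z) j \<sigma>) (of_real t) < (a - 1) * t"
      by (rule tendstoD) (use t a in simp)
    then show "\<forall>\<^sub>F z in nhds (of_real x). \<exists>t\<le>1. near a (ratio (W n z) j \<sigma>) t"
      by eventually_elim (use t in \<open>auto simp: near_def dist_norm\<close>)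
  qed auto
  then show ?thesis unfolding good_def by (rule eventually_mono) auto
qed

text \<open>
  The constants are chosen in the order \<open>a\<close>, \<open>b\<close>, \<open>\<delta>\<close>, \<open>N\<close>: stable labels must stay within
  relative error \<open>b - 1\<close> for all labels to stay within \<open>a - 1\<close>; \<open>\<delta>\<close> is a bound for the oscillation at
  time \<open>N\<close> and for the distance between the ratios at \<open>z\<close> and at \<open>x\<close>. Labels that are neither stable
  nor dead are controlled through stable and dead ones only from time \<open>N + K\<close> on; the finitely
  many times before are covered by continuity in \<open>z\<close>. The induction on \<open>n\<close> is a bootstrap: control up
  to \<open>n\<close> gives contraction up to \<open>n\<close>, hence little total movement, hence control at \<open>n\<close>.
\<close>

lemma uniform_good:
  assumes x: "0 < x" and R: "0 < R" "separating R" and a: "1 < a" "admissible a"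
    and q: "(1 + slack a) ^ R - doeblin x ^ R < 1"
  shows "\<exists>N. \<forall>\<^sub>F z in nhds (of_real x). near a z x \<and> (\<forall>n\<ge>N. good k a (W n z))"
proof -
  let ?\<psi> = "\<lambda>b::real. 1 + 2 * (b ^ m - 1)"
  define q' where "q' = (1 + slack a) ^ R - doeblin x ^ R"
  have "doeblin x ^ R \<le> (1 + slack a) ^ R"
    using doeblin_bounds[OF x] slack_nonneg[of a] a(1) by (intro power_mono) auto
  then have q': "0 \<le> q'" "q' < 1" using q unfolding q'_def by auto
  define C where "C = real R * 2 ^ R / (1 - q')"
  have C: "0 \<le> C" using q' unfolding C_def by simp
  obtain K where K: "\<forall>j\<in>{1..k}. (\<phi> ^^ K) j \<in> stable \<union> dead" using uniform_depth by blast
  obtain b where b: "1 < b" "(?\<psi> ^^ K) b \<le> a" using ex_inner_tube[OF a(1)] by blast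
  from stable_ratio_lower[OF x] obtain \<kappa> where \<kappa>: "0 < \<kappa>"
    "\<forall>n\<ge>burn_in. \<forall>j\<in>stable. \<forall>\<sigma>\<subseteq>{1..k} - {j}. \<kappa> \<le> w n x (insert j \<sigma>) / w n x \<sigma>"
    by (elim exE conjE)
  \<comment> \<open>At \<open>z\<close> the oscillation at time \<open>N\<close> is at most \<open>3 * \<delta>\<close>, the sum of all later ones at most \<open>3 * C * \<delta>\<close>,
    and each step moves a ratio by at most twice the oscillation; passing from \<open>z\<close> to \<open>x\<close> costs
    another \<open>\<delta>\<close>.\<close>
  define \<delta> where "\<delta> = (b - 1) * \<kappa> / (6 * C + 1)"
  have \<delta>: "0 < \<delta>" "(6 * C + 1) * \<delta> = (b - 1) * \<kappa>" using b \<kappa> C unfolding \<delta>_def by auto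
  obtain N where N: "burn_in \<le> N" "osc N (of_real x) \<le> \<delta>" using osc_real_small[OF x R(2) \<delta>(1)] by blast
  have ev1: "\<forall>\<^sub>F z in nhds (of_real x). near a z x"
  proof -
    have "\<forall>\<^sub>F z in nhds (of_real x). dist z (of_real x) < (a - 1) * x"
      by (rule tendstoD[OF filterlim_ident]) (use x a in simp)
    then show ?thesis by eventually_elim (use x in \<open>auto simp: near_def dist_norm\<close>)
  qed
  have ev2: "\<forall>\<^sub>F z in nhds (of_real x). \<forall>n\<in>{N..N + K}. good k a (W n z)"
    using eventually_good[OF x _ a(1)] N(1) by (intro eventually_ball_finite) auto
  have ev3: "\<forall>\<^sub>F z in nhds (of_real x). \<forall>j\<in>stable. \<forall>\<sigma>\<in>Pow ({1..k} - {j}).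
      norm (ratio (W N z) j \<sigma> - ratio (W N (of_real x)) j \<sigma>) \<le> \<delta>"
  proof (intro eventually_ball_finite ballI)
    show "finite stable" unfolding stable_def by simp
    fix j \<sigma> assume j: "j \<in> stable" and s: "\<sigma> \<in> Pow ({1..k} - {j})"
    have "1 \<le> w N x \<sigma>" using w_ge_1[of x N \<sigma>] x N(1) s by auto
    then have "((\<lambda>z. ratio (W N z) j \<sigma>) \<longlongrightarrow> ratio (W N (of_real x)) j \<sigma>) (nhds (of_real x))"
      by (intro ratio_tendsto) (simp add: W_of_real)
    then have "\<forall>\<^sub>F z in nhds (of_real x). dist (ratio (W N z) j \<sigma>) (ratio (W N (of_real x)) j \<sigma>) < \<delta>"
      using \<delta>(1) by (rule tendstoD)
    then show "\<forall>\<^sub>F z in nhds (of_real x). norm (ratio (W N z) j \<sigma> - ratio (W N (of_real x)) j \<sigma>) \<le> \<delta>"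
      by eventually_elim (simp add: dist_norm)
  qed auto
  have main: "good k a (W n z)" if z: "near a z x" and init: "\<forall>n\<in>{N..N + K}. good k a (W n z)"
    and close: "\<forall>j\<in>stable. \<forall>\<sigma>\<in>Pow ({1..k} - {j}). norm (ratio (W N z) j \<sigma> - ratio (W N (of_real x)) j \<sigma>) \<le> \<delta>"
    and n: "N \<le> n" for z n
    using n
  proof (induction n rule: less_induct)
    case (less n)
    show ?case
    proof (cases "n \<le> N + K")
      case True
      then show ?thesis using init less.prems by simp
    next
      case False
      have g: "good k a (W n' z)" if "N \<le> n'" "n' < n" for n' using less.IH that by blast
      have oscN: "osc N z \<le> 3 * \<delta>"
      proof (rule osc_le)
        fix j \<sigma> \<sigma>' assume j: "j \<in> stable" and s: "\<sigma> \<subseteq> {1..k} - {j}" "\<sigma>' \<subseteq> {1..k} - {j}"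
        have "norm (ratio (W N z) j \<sigma> - ratio (W N (of_real x)) j \<sigma>) \<le> \<delta>"
          "norm (ratio (W N z) j \<sigma>' - ratio (W N (of_real x)) j \<sigma>') \<le> \<delta>"
          "norm (ratio (W N (of_real x)) j \<sigma> - ratio (W N (of_real x)) j \<sigma>') \<le> \<delta>"
          using close j s osc_ge[OF j s, of N "of_real x"] N(2) by auto
        then show "norm (ratio (W N z) j \<sigma> - ratio (W N z) j \<sigma>') \<le> 3 * \<delta>"
          by norm
      qed (use \<delta> in simp)
      have sum_osc: "(\<Sum>u<s. osc (N + u) z) \<le> C * (3 * \<delta>)" if s: "s \<le> Suc (n - N)" for s
      proof -
        have "(\<Sum>u<s. osc (N + u) z) \<le> real R * 2 ^ R / (1 - q') * osc (N + 0) z"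
        proof (rule sum_contracting_le[OF _ _ _ q' s])
          show "osc (N + Suc u) z \<le> 2 * osc (N + u) z" if "Suc u \<le> n - N" for u
          proof -
            have "osc (Suc (N + u)) z \<le> (1 + slack a) * osc (N + u) z"
              by (rule osc_Suc[OF z a(2)]) (use g that in auto)
            also have "\<dots> \<le> 2 * osc (N + u) z"
              using a(2) osc_nonneg unfolding admissible_def by (intro mult_right_mono) auto
            finally show ?thesis by simp
          qed
          show "osc (N + (u + R)) z \<le> q' * osc (N + u) z" if "u + R \<le> n - N" for u
          proof -
            have "osc (N + u + R) z \<le> rate a x R * osc (N + u) z"
            proof (rule osc_add[OF z a(2) R(2)])
              show "good k a (W (N + u + s) z)" if "s < R" for s
                using g \<open>u + R \<le> n - N\<close> that by auto
              show "W (N + u) z S \<noteq> 0" if "S \<subseteq> {1..k}" for S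
                by (rule good_nonzero[OF g _ k_pos that])
                   (use \<open>u + R \<le> n - N\<close> R(1) less.prems a(2) in \<open>auto simp: admissible_def\<close>)
            qed
            then show ?thesis using rate_def[OF z a(2)] unfolding q'_def by (simp add: add.assoc)
          qed
        qed (rule osc_nonneg)
        also have "\<dots> \<le> C * (3 * \<delta>)" unfolding C_def[symmetric] using oscN C by (simp add: mult_left_mono)
        finally show ?thesis .
      qed
      have nz: "W n' z S \<noteq> 0" if S: "N \<le> n'" "n' \<le> n" "S \<subseteq> {1..k}" for n' S
      proof (cases "n' < n")
        case True
        then show ?thesis using good_nonzero[OF g _ k_pos] that a(2) unfolding admissible_def by blast
      next
        case False
        then obtain n'' where "n' = Suc n''" "N \<le> n''" "n'' < n"
          using S \<open>\<not> n \<le> N + K\<close> by (cases n') auto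
        then show ?thesis using W_Suc_nonzero[OF g z a(2) that(3)] by simp
      qed
      have base: "tube z b n' j" if n': "N \<le> n'" "n' \<le> n" and j: "j \<in> stable \<union> dead" for n' j
      proof (cases "j \<in> dead")
        case True
        have "near b (ratio (W n' z) j \<sigma>) 1" if "\<sigma> \<subseteq> {1..k} - {j}" for \<sigma>
        proof -
          have "ratio (W n' z) j \<sigma> = 1" by (rule ratio_dead[OF True nz[OF n']]) (use that in auto)
          then show ?thesis using near_self[of 1 b] b(1) by simp
        qed
        then show ?thesis unfolding tube_def[OF z a(2)] by (intro exI[of _ 1]) auto
      next
        case False
        then have js: "j \<in> stable" using j by blast
        define s where "s = n' - N"
        have s: "n' = N + s" "s \<le> n - N" using n' unfolding s_def by auto
        define j' where "j' = (\<phi> ^^ s) j"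
        have j': "j' \<in> stable" unfolding j'_def by (rule stable_pow[OF js])
        define t where "t = w N x (insert j' {}) / w N x {}"
        have t: "\<kappa> \<le> t" "t \<le> 1"
          unfolding t_def using \<kappa>(2)[rule_format, OF N(1) j', of "{}"] w_quotient(2)[OF _ N(1) stable_mem[OF j'], of x "{}"] x
          by auto
        have "near b (ratio (W n' z) j \<sigma>) t" if sg: "\<sigma> \<subseteq> {1..k} - {j}" for \<sigma>
        proof -
          have 1: "norm (ratio (W n' z) j {} - ratio (W N z) j' {}) \<le> 2 * (\<Sum>u<s. osc (N + u) z)"
            unfolding s(1) j'_def by (rule stable_tracking[OF z a(2) _ js]) (use g s in auto)
          have 2: "norm (ratio (W n' z) j \<sigma> - ratio (W n' z) j {}) \<le> osc (N + s) z"
            using osc_ge[OF js sg, of "{}" n'] s(1) by simp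
          have 3: "norm (ratio (W N z) j' {} - of_real t) \<le> \<delta>"
            using close j' unfolding t_def ratio_of_real[symmetric] by auto
          have "osc (N + s) z \<le> 2 * osc (N + s) z" using osc_nonneg by simp
          then have "2 * (\<Sum>u<s. osc (N + u) z) + osc (N + s) z \<le> 2 * (\<Sum>u<Suc s. osc (N + u) z)" by simp
          also have "\<dots> \<le> 2 * (C * (3 * \<delta>))" using sum_osc[of "Suc s"] s(2) by simp
          finally have "2 * (\<Sum>u<s. osc (N + u) z) + osc (N + s) z \<le> 6 * C * \<delta>" by simp
          then have "norm (ratio (W n' z) j \<sigma> - of_real t) \<le> 6 * C * \<delta> + \<delta>"
            using 1 2 3 by norm
          also have "\<dots> = (b - 1) * \<kappa>" using \<delta>(2) by (simp add: algebra_simps)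
          also have "\<dots> \<le> (b - 1) * t" using t b by simp
          finally show ?thesis unfolding near_def using t \<kappa>(1) by simp
        qed
        then show ?thesis unfolding tube_def[OF z a(2)] using t(2) by blast
      qed
      have "tube z ((?\<psi> ^^ K) b) n j" if "j \<in> {1..k}" for j
        by (rule tube_depth[OF z a(2) g base]) (use False that K in auto)
      then show ?thesis
        unfolding good_def tube_def[OF z a(2)] using near_mono[OF _ b(2)] by meson
    qed
  qed
  have "\<forall>\<^sub>F z in nhds (of_real x). near a z x \<and> (\<forall>n\<ge>N. good k a (W n z))"
    using ev1 ev2 ev3 by eventually_elim (use main in blast)
  then show ?thesis by blast
qed

end

section \<open>The limit and its analyticity\<close>

text \<open>
  The real parts of the Taylor coefficients of a holomorphic function are the coefficients of a real
  power series for its real part on the real axis.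
\<close>

lemma real_analytic_onI:
  assumes "\<And>x. x \<in> S \<Longrightarrow> \<exists>r>0. \<exists>f. f holomorphic_on ball (of_real x) r
    \<and> (\<forall>y. \<bar>y - x\<bar> < r \<longrightarrow> \<rho> y = Re (f (of_real y)))"
  shows "real_analytic_on \<rho> S"
  unfolding real_analytic_on_def
proof
  fix x assume "x \<in> S"
  then obtain r f where r: "0 < r" and hol: "f holomorphic_on ball (of_real x) r"
    and \<rho>: "\<And>y. \<bar>y - x\<bar> < r \<Longrightarrow> \<rho> y = Re (f (of_real y))" using assms by blast
  define a where "a = (\<lambda>n. Re ((deriv ^^ n) f (of_real x) / fact n))"
  have "(\<lambda>n. a n * (y - x) ^ n) sums \<rho> y" if y: "\<bar>y - x\<bar> < r" for y
  proof -
    have "(of_real y :: complex) \<in> ball (of_real x) r"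
      using y by (simp add: dist_norm norm_minus_commute flip: of_real_diff)
    from holomorphic_power_series[OF hol this]
    have "(\<lambda>n. Re ((deriv ^^ n) f (of_real x) / fact n * (of_real y - of_real x) ^ n)) sums Re (f (of_real y))"
      by (rule sums_Re)
    moreover have "Re ((deriv ^^ n) f (of_real x) / fact n * (of_real y - of_real x) ^ n) = a n * (y - x) ^ n" for n
    proof -
      have "((of_real y - of_real x) ^ n :: complex) = of_real ((y - x) ^ n)" by simp
      moreover have "Re (c * of_real t) = Re c * t" for c t by simp
      ultimately show ?thesis unfolding a_def by (simp only:)
    qed
    ultimately show ?thesis using \<rho>[OF y] by simp
  qed
  then show "\<exists>r>0. \<exists>a. \<forall>y. \<bar>y - x\<bar> < r \<longrightarrow> (\<lambda>n. a n * (y - x) ^ n) sums \<rho> y"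
    using r by blast
qed

lemma sum_Pow_power:
  fixes x :: "'b::comm_semiring_1"
  assumes "finite A"
  shows "(\<Sum>S\<in>Pow A. x ^ card S) = (1 + x) ^ card A"
  using prod_add[OF assms, of "\<lambda>_. x" "\<lambda>_. 1"] by (simp add: add.commute)

lemma norm_Ln_half_plane:
  assumes "1 / 2 \<le> Re u" "norm u \<le> B" "1 \<le> B"
  shows "norm (Ln u) \<le> ln 2 + ln B + pi"
proof -
  have u: "1 / 2 \<le> norm u" using assms(1) complex_Re_le_cmod order_trans by blast
  then have u0: "u \<noteq> 0" by auto
  have "ln (1 / 2) \<le> ln (norm u)" using u by (intro ln_mono) auto
  then have "- ln 2 \<le> ln (norm u)" by (simp add: ln_div)
  moreover have "ln (norm u) \<le> ln B" using assms u by (intro ln_mono) auto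
  moreover have "0 \<le> ln B" "0 \<le> ln (2::real)" using assms by auto
  ultimately have "\<bar>Re (Ln u)\<bar> \<le> ln 2 + ln B"
    unfolding Re_Ln[OF u0] by linarith
  moreover have "\<bar>Im (Ln u)\<bar> \<le> pi" using mpi_less_Im_Ln[OF u0] Im_Ln_le_pi[OF u0] by simp
  ultimately show ?thesis using cmod_le[of "Ln u"] by linarith
qed

context recursive_sequence
begin

text \<open>
  The power \<open>W n z {} ^ m\<close> collects the independent sets without any glued vertex; the quotient is
  the gain from allowing inner glued vertices to be occupied.
\<close>

definition growth :: "nat \<Rightarrow> complex \<Rightarrow> complex" where
  "growth n z = W (Suc n) z {} / W n z {} ^ m"

lemma growth_bounds:
  assumes g: "good k a (W n z)" and z: "near a z x" and a: "admissible a"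
  shows "1 / 2 \<le> Re (growth n z)" "norm (growth n z) \<le> 2 * weight_bound x"
proof -
  have "weight z (W n z) {} {} = W n z {} ^ m" unfolding weight_def occupied_def by simp
  then have "growth n z = step z (W n z) {} / weight z (W n z) {} {}" unfolding growth_def by (simp add: W_Suc)
  then show "1 / 2 \<le> Re (growth n z)" "norm (growth n z) \<le> 2 * weight_bound x"
    using good_weights(2,3)[OF g z, of "{}"] a unfolding admissible_def by auto
qed

lemma W_holomorphic: "(\<lambda>z. W n z S) holomorphic_on A"
  unfolding W_def boundary_poly_def by (intro holomorphic_intros)

text \<open>
  Taking logarithms, \<open>ln W\<^sub>n({}) / m ^ n\<close> changes in step \<open>n\<close> by \<open>Ln (growth n z) / m ^ (n + 1)\<close>. As \<open>growth\<close>
  stays in a compact part of the right half plane, the principal branch can be used throughout,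
  and the changes form a uniformly convergent series of holomorphic functions.
\<close>

lemma local_free_energy:
  assumes x: "0 < x"
  shows "\<exists>r>0. \<exists>f. f holomorphic_on ball (of_real x) r
    \<and> (\<forall>y. \<bar>y - x\<bar> < r \<longrightarrow> (\<lambda>n. ln (w n y {}) / real m ^ n) \<longlonglongrightarrow> Re (f (of_real y)))"
proof -
  obtain R where R: "0 < R" "separating R" using ex_separating by blast
  obtain a where a: "1 < a" "admissible a" "(1 + slack a) ^ R - doeblin x ^ R < 1"
    using ex_admissible[OF x] by blast
  obtain N where N: "\<forall>\<^sub>F z in nhds (of_real x). near a z x \<and> (\<forall>n\<ge>N. good k a (W n z))"
    using uniform_good[OF x R a] by blast
  have "((\<lambda>z. Re (W N z {})) \<longlongrightarrow> Re (W N (of_real x) {})) (nhds (of_real x))"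
    by (intro tendsto_Re W_tendsto)
  then have "\<forall>\<^sub>F z in nhds (of_real x). 0 < Re (W N z {})"
    by (rule order_tendstoD(1)) (use w_empty_ge_1[of x N] x in \<open>simp add: W_of_real\<close>)
  with N have "\<forall>\<^sub>F z in nhds (of_real x). (near a z x \<and> (\<forall>n\<ge>N. good k a (W n z))) \<and> 0 < Re (W N z {})"
    by (rule eventually_conj)
  then obtain r0 where r0: "0 < r0" "\<And>z. dist z (of_real x) < r0 \<Longrightarrow>
      (near a z x \<and> (\<forall>n\<ge>N. good k a (W n z))) \<and> 0 < Re (W N z {})"
    unfolding eventually_nhds_metric by blast
  define r where "r = min r0 x"
  have r: "0 < r" using r0 x unfolding r_def by simp
  let ?B = "ball (of_real x :: complex) r"
  have near: "near a z x" and g: "\<And>n. N \<le> n \<Longrightarrow> good k a (W n z)" and W0: "0 < Re (W N z {})"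
    if "z \<in> ?B" for z
    using r0(2)[of z] that unfolding r_def by (auto simp: dist_commute)
  define F where "F = (\<lambda>i z. Ln (growth (N + i) z) / of_nat m ^ (N + i + 1))"
  define c where "c = ln 2 + ln (2 * weight_bound x) + pi"
  have hb: "1 / 2 \<le> Re (growth (N + i) z)" "norm (growth (N + i) z) \<le> 2 * weight_bound x" if "z \<in> ?B" for i z
    using growth_bounds[OF g[OF that] near[OF that] a(2)] by auto
  have nonpos: "u \<notin> \<real>\<^sub>\<le>\<^sub>0" if "0 < Re u" for u :: complex
    using that by (auto simp: complex_nonpos_Reals_iff)
  have nz: "W n z {} \<noteq> 0" if "z \<in> ?B" "N \<le> n" for n z
    by (rule good_nonzero[OF g[OF that] _ k_pos]) (use a(2) in \<open>auto simp: admissible_def\<close>)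
  have hol_h: "growth (N + i) holomorphic_on ?B" for i
    unfolding growth_def[abs_def] by (intro holomorphic_intros W_holomorphic) (use nz in auto)
  have hol_F: "F i holomorphic_on ?B" for i
    unfolding F_def
  proof (intro holomorphic_intros)
    show "growth (N + i) z \<notin> \<real>\<^sub>\<le>\<^sub>0" if "z \<in> ?B" for z
      by (rule nonpos) (use hb(1)[OF that, of i] in linarith)
    show "growth (N + i) holomorphic_on ?B" by (rule hol_h)
  qed (use m_ge_2 in auto)
  have F_bound: "norm (F i z) \<le> c * (1 / real m) ^ (N + i + 1)" if "z \<in> ?B" for i z
  proof -
    have "norm (Ln (growth (N + i) z)) \<le> c"
      unfolding c_def by (rule norm_Ln_half_plane[OF hb[OF that]]) (use weight_bound_ge_1[of x] x in simp)
    then show ?thesis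
      using m_ge_2 unfolding F_def
      by (simp add: norm_divide norm_power power_divide norm_mult divide_right_mono)
  qed
  have "summable (\<lambda>i. c * (1 / real m) ^ (N + 1) * (1 / real m) ^ i)"
    using m_ge_2 by (intro summable_mult summable_geometric) simp
  then have summ: "summable (\<lambda>i. c * (1 / real m) ^ (N + i + 1))"
    by (simp add: power_add mult_ac)
  have ul: "uniform_limit ?B (\<lambda>n z. \<Sum>i<n. F i z) (\<lambda>z. \<Sum>i. F i z) sequentially"
    by (rule Weierstrass_m_test[OF F_bound summ])
  have hol_sum: "(\<lambda>z. \<Sum>i. F i z) holomorphic_on ?B"
  proof (rule holomorphic_uniform_sequence)
    show "open ?B" by simp
    show "(\<lambda>z. \<Sum>i<n. F i z) holomorphic_on ?B" for n
      by (intro holomorphic_on_sum hol_F)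
    fix z assume "z \<in> ?B"
    then obtain d where "0 < d" "cball z d \<subseteq> ?B" using open_contains_cball[of ?B] open_ball by blast
    then show "\<exists>d>0. cball z d \<subseteq> ?B \<and> uniform_limit (cball z d) (\<lambda>n z. \<Sum>i<n. F i z) (\<lambda>z. \<Sum>i. F i z) sequentially"
      using uniform_limit_on_subset[OF ul] by blast
  qed
  define f where "f = (\<lambda>z. Ln (W N z {}) / of_nat m ^ N + (\<Sum>i. F i z))"
  have hol_f: "f holomorphic_on ?B"
    unfolding f_def
    by (intro holomorphic_intros hol_sum W_holomorphic nonpos W0) (use m_ge_2 in auto)
  have lim: "(\<lambda>n. ln (w n y {}) / real m ^ n) \<longlonglongrightarrow> Re (f (of_real y))" if y: "\<bar>y - x\<bar> < r" for y
  proof -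
    have yB: "(of_real y :: complex) \<in> ?B"
      using y by (simp add: dist_norm norm_minus_commute flip: of_real_diff)
    have y0: "0 \<le> y" using y unfolding r_def by linarith
    have wp: "0 < w n y {}" for n using w_empty_ge_1[OF y0, of n] by linarith
    have hr: "growth n (of_real y) = of_real (w (Suc n) y {} / w n y {} ^ m)" for n
      unfolding growth_def W_of_real by simp
    have "Re (Ln (W N (of_real y) {}) / of_nat m ^ N + (\<Sum>i<n. F i (of_real y)))
        = ln (w (N + n) y {}) / real m ^ (N + n)" for n
    proof (induction n)
      case 0
      have "Ln (W N (of_real y) {}) / of_nat m ^ N = of_real (ln (w N y {}) / real m ^ N)"
        unfolding W_of_real by (simp add: Ln_of_real wp)
      then show ?case by (simp only: lessThan_0 sum.empty add_0_right Re_complex_of_real)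
    next
      case (Suc n)
      have "F n (of_real y) = of_real (ln (w (Suc (N + n)) y {} / w (N + n) y {} ^ m) / real m ^ (N + n + 1))"
        unfolding F_def hr using wp[of "Suc (N + n)"] wp[of "N + n"]
        by (subst Ln_of_real) simp_all
      then have "Re (F n (of_real y)) = ln (w (Suc (N + n)) y {} / w (N + n) y {} ^ m) / real m ^ (N + n + 1)"
        by (simp only: Re_complex_of_real)
      also have "ln (w (Suc (N + n)) y {} / w (N + n) y {} ^ m)
          = ln (w (Suc (N + n)) y {}) - real m * ln (w (N + n) y {})"
        using wp[of "Suc (N + n)"] wp[of "N + n"] by (simp add: ln_div ln_realpow)
      also have "\<dots> / real m ^ (N + n + 1) = ln (w (Suc (N + n)) y {}) / real m ^ (N + n + 1)
          - ln (w (N + n) y {}) / real m ^ (N + n)"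
        using m_ge_2 by (simp add: field_simps)
      finally show ?case using Suc by simp
    qed
    moreover have "(\<lambda>n. Re (Ln (W N (of_real y) {}) / of_nat m ^ N + (\<Sum>i<n. F i (of_real y))))
        \<longlonglongrightarrow> Re (f (of_real y))"
      unfolding f_def by (intro tendsto_Re tendsto_add tendsto_const tendsto_uniform_limitI[OF ul yB])
    ultimately have "(\<lambda>n. ln (w (N + n) y {}) / real m ^ (N + n)) \<longlonglongrightarrow> Re (f (of_real y))" by simp
    then show ?thesis
      by (subst (asm) (1 2) add.commute) (rule LIMSEQ_offset)
  qed
  show ?thesis by (intro exI[of _ r] exI[of _ f] conjI allI impI r hol_f lim)
qed

definition unmarked :: "nat \<Rightarrow> nat" where
  "unmarked n = card (verts (G n) - mark (G n) ` {1..k})"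

lemma card_verts: "card (verts (G n)) = k + unmarked n"
proof -
  note g = marked_graphsD[OF G_marked[of n]]
  have sub: "mark (G n) ` {1..k} \<subseteq> verts (G n)" using g(4) by blast
  have "card (mark (G n) ` {1..k}) = k" using card_image[OF g(5)] by simp
  then show ?thesis
    unfolding unmarked_def using card_Diff_subset[OF _ sub] card_mono[OF g(1) sub] by simp
qed

lemma unmarked_Suc: "unmarked (Suc n) = card inner_edges + m * unmarked n"
  unfolding unmarked_def G_Suc by (rule card_unmarked_recursion[OF G_marked])

text \<open>
  The limit of the number of vertices divided by \<open>m ^ n\<close>, see \<open>volume_tendsto\<close>.
\<close>

definition volume :: real where
  "volume = real (unmarked 0) + real (card inner_edges) / (real m - 1)"

lemma unmarked_eq: "real (unmarked n) = real m ^ n * volume - real (card inner_edges) / (real m - 1)"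
proof (induction n)
  case (Suc n)
  have "real (unmarked (Suc n)) = real (card inner_edges) + real m * real (unmarked n)"
    unfolding unmarked_Suc by simp
  also have "\<dots> = real m ^ Suc n * volume - real (card inner_edges) / (real m - 1)"
    unfolding Suc using m_ge_2 by (simp add: field_simps)
  finally show ?case .
qed (simp add: volume_def)

lemma volume_tendsto: "(\<lambda>n. real (card (verts (G n))) / real m ^ n) \<longlonglongrightarrow> volume"
proof -
  let ?c = "real k - real (card inner_edges) / (real m - 1)"
  have "(\<lambda>n. volume + ?c * (1 / real m) ^ n) \<longlonglongrightarrow> volume + ?c * 0"
    by (intro tendsto_intros LIMSEQ_power_zero) (use m_ge_2 in simp)
  moreover have "real (card (verts (G n))) / real m ^ n = volume + ?c * (1 / real m) ^ n" for n
    unfolding card_verts of_nat_add unmarked_eq using m_ge_2 by (simp add: field_simps power_divide)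
  ultimately show ?thesis by simp
qed

lemma independence_poly_bounds:
  assumes x: "0 < x"
  shows "w n x {} \<le> independence_poly (G n) x" "independence_poly (G n) x \<le> (1 + x) ^ k * w n x {}"
proof -
  have Z: "independence_poly (G n) x = (\<Sum>S\<in>Pow {1..k}. x ^ card S * w n x S)"
    unfolding w_def by (rule independence_poly_eq[OF G_marked])
  have "(\<Sum>S\<in>{{} :: nat set}. x ^ card S * w n x S) \<le> independence_poly (G n) x"
    unfolding Z by (intro sum_mono2) (use x w_nonneg in auto)
  then show "w n x {} \<le> independence_poly (G n) x" by simp
  have "independence_poly (G n) x \<le> (\<Sum>S\<in>Pow {1..k}. x ^ card S * w n x {})"
    unfolding Z using x by (intro sum_mono mult_left_mono w_antimono) auto
  also have "\<dots> = (1 + x) ^ k * w n x {}"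
    unfolding sum_distrib_right[symmetric] by (subst sum_Pow_power) auto
  finally show "independence_poly (G n) x \<le> (1 + x) ^ k * w n x {}" .
qed

text \<open>
  No volume growth means that there is not a single unmarked vertex. As marked vertices are
  eventually non-adjacent, every set of vertices is then independent.
\<close>

lemma degenerate_poly:
  assumes "volume = 0" "burn_in \<le> n"
  shows "card (verts (G n)) = k" "independence_poly (G n) x = (1 + x) ^ k"
proof -
  have "real (card inner_edges) / (real m - 1) = 0"
  proof -
    have "0 \<le> real (card inner_edges) / (real m - 1)" using m_ge_2 by simp
    then show ?thesis using assms(1) unfolding volume_def by linarith
  qed
  then have "real (unmarked n) = 0" using unmarked_eq[of n] assms(1) by simp
  then have U: "unmarked n = 0" by simp
  then show "card (verts (G n)) = k" by (simp add: card_verts)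
  have e: "verts (G n) - mark (G n) ` {1..k} = {}"
    using U marked_graphsD(1)[OF G_marked[of n]] unfolding unmarked_def by simp
  have "boundary_poly k (G n) S x = 1" if S: "S \<subseteq> {1..k}" for S
  proof -
    have "boundary_sets k (G n) S = {{}}"
      unfolding boundary_sets_def e using indep_burn_in[OF assms(2) S] by auto
    then show ?thesis unfolding boundary_poly_def by simp
  qed
  then have "independence_poly (G n) x = (\<Sum>S\<in>Pow {1..k}. x ^ card S)"
    unfolding independence_poly_eq[OF G_marked] by (intro sum.cong) auto
  then show "independence_poly (G n) x = (1 + x) ^ k" by (simp add: sum_Pow_power)
qed

lemma free_energy_limit:
  assumes x: "0 < x" and v: "volume \<noteq> 0" and lim: "(\<lambda>n. ln (w n x {}) / real m ^ n) \<longlonglongrightarrow> L"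
  shows "(\<lambda>n. ln (independence_poly (G n) x) / real (card (verts (G n)))) \<longlonglongrightarrow> L / volume"
proof -
  have wp: "0 < w n x {}" for n using w_empty_ge_1[of x n] x by simp
  have b: "0 \<le> ln (independence_poly (G n) x) - ln (w n x {})"
    "ln (independence_poly (G n) x) - ln (w n x {}) \<le> real k * ln (1 + x)" for n
  proof -
    note ib = independence_poly_bounds[OF x, of n]
    show "0 \<le> ln (independence_poly (G n) x) - ln (w n x {})" using ib(1) wp[of n] by simp
    have "ln (independence_poly (G n) x) \<le> ln ((1 + x) ^ k * w n x {})"
      using ib wp[of n] by (intro ln_mono) auto
    also have "\<dots> = real k * ln (1 + x) + ln (w n x {})"
      using x wp[of n] by (simp add: ln_mult ln_realpow)
    finally show "ln (independence_poly (G n) x) - ln (w n x {}) \<le> real k * ln (1 + x)" by simp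
  qed
  have "(\<lambda>n. (ln (independence_poly (G n) x) - ln (w n x {})) / real m ^ n) \<longlonglongrightarrow> 0"
  proof (rule tendsto_sandwich[of "\<lambda>_. 0" _ _ "\<lambda>n. real k * ln (1 + x) / real m ^ n"])
    have "(\<lambda>n. real k * ln (1 + x) * (1 / real m) ^ n) \<longlonglongrightarrow> real k * ln (1 + x) * 0"
      by (intro tendsto_intros LIMSEQ_power_zero) (use m_ge_2 in simp)
    then show "(\<lambda>n. real k * ln (1 + x) / real m ^ n) \<longlonglongrightarrow> 0" by (simp add: power_divide)
  qed (use b in \<open>auto intro!: always_eventually divide_right_mono\<close>)
  from tendsto_add[OF lim this]
  have "(\<lambda>n. ln (independence_poly (G n) x) / real m ^ n) \<longlonglongrightarrow> L"
    by (simp add: diff_divide_distrib)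
  from tendsto_divide[OF this volume_tendsto v]
  show ?thesis using m_ge_2 by simp
qed

theorem free_energy:
  "\<exists>\<rho>. (\<forall>x>0. (\<lambda>n. ln (independence_poly (G n) x) / real (card (verts (G n)))) \<longlonglongrightarrow> \<rho> x)
     \<and> real_analytic_on \<rho> {0<..}"
proof -
  define \<rho> where "\<rho> x = lim (\<lambda>n. ln (independence_poly (G n) x) / real (card (verts (G n))))" for x
  have key: "\<exists>r>0. \<exists>f. f holomorphic_on ball (of_real x) r \<and> (\<forall>y. \<bar>y - x\<bar> < r \<longrightarrow>
      (\<lambda>n. ln (independence_poly (G n) y) / real (card (verts (G n)))) \<longlonglongrightarrow> Re (f (of_real y)))"
    if x: "0 < x" for x
  proof (cases "volume = 0")
    case True
    define f where "f = (\<lambda>z::complex. Ln (1 + z))"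
    have "f holomorphic_on ball (of_real x) x"
      unfolding f_def
    proof (intro holomorphic_intros)
      fix z :: complex assume "z \<in> ball (of_real x) x"
      then have "\<bar>Re (of_real x - z)\<bar> < x"
        using abs_Re_le_cmod[of "of_real x - z"] by (simp add: dist_norm)
      then show "1 + z \<notin> \<real>\<^sub>\<le>\<^sub>0" by (auto simp: complex_nonpos_Reals_iff)
    qed
    moreover have "(\<lambda>n. ln (independence_poly (G n) y) / real (card (verts (G n)))) \<longlonglongrightarrow> Re (f (of_real y))"
      if y: "\<bar>y - x\<bar> < x" for y
    proof -
      have y0: "0 < 1 + y" using y by linarith
      have "f (of_real y) = Ln (of_real (1 + y))" unfolding f_def by simp
      then have "Re (f (of_real y)) = ln (1 + y)"
        using Ln_of_real[OF y0] by (simp only: Re_complex_of_real)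
      moreover have "ln (independence_poly (G n) y) / real (card (verts (G n))) = ln (1 + y)"
        if "burn_in \<le> n" for n
        using degenerate_poly[OF True that] k_pos y0 by (simp add: ln_realpow)
      ultimately show ?thesis
        by (intro tendsto_eventually) (auto simp: eventually_sequentially)
    qed
    ultimately show ?thesis using x by blast
  next
    case False
    obtain r f where r: "0 < r" "f holomorphic_on ball (of_real x) r"
      "\<And>y. \<bar>y - x\<bar> < r \<Longrightarrow> (\<lambda>n. ln (w n y {}) / real m ^ n) \<longlonglongrightarrow> Re (f (of_real y))"
      using local_free_energy[OF x] by blast
    have "(\<lambda>z. f z / of_real volume) holomorphic_on ball (of_real x) (min r x)"
      by (intro holomorphic_intros holomorphic_on_subset[OF r(2)]) (use False in auto)
    moreover have "(\<lambda>n. ln (independence_poly (G n) y) / real (card (verts (G n))))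
        \<longlonglongrightarrow> Re (f (of_real y) / of_real volume)" if "\<bar>y - x\<bar> < min r x" for y
    proof -
      have "0 < y" "\<bar>y - x\<bar> < r" using that by linarith+
      from free_energy_limit[OF this(1) False r(3)[OF this(2)]] show ?thesis by simp
    qed
    ultimately show ?thesis using r(1) x by (intro exI[of _ "min r x"]) auto
  qed
  have "(\<lambda>n. ln (independence_poly (G n) x) / real (card (verts (G n)))) \<longlonglongrightarrow> \<rho> x" if x: "0 < x" for x
  proof -
    from key[OF x] obtain r and f :: "complex \<Rightarrow> complex" where "0 < r" and conv: "\<forall>y. \<bar>y - x\<bar> < r \<longrightarrow>
      (\<lambda>n. ln (independence_poly (G n) y) / real (card (verts (G n)))) \<longlonglongrightarrow> Re (f (of_real y))"
      by (elim exE conjE)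
    then have "(\<lambda>n. ln (independence_poly (G n) x) / real (card (verts (G n)))) \<longlonglongrightarrow> Re (f (of_real x))"
      by simp
    from this limI[OF this] show ?thesis unfolding \<rho>_def by simp
  qed
  moreover have "real_analytic_on \<rho> {0<..}"
  proof (rule real_analytic_onI)
    fix x :: real assume "x \<in> {0<..}"
    then have "0 < x" by simp
    from key[OF this] obtain r f where r: "0 < r" "f holomorphic_on ball (of_real x) r"
      and conv: "\<forall>y. \<bar>y - x\<bar> < r \<longrightarrow>
      (\<lambda>n. ln (independence_poly (G n) y) / real (card (verts (G n)))) \<longlonglongrightarrow> Re (f (of_real y))"
      by (elim exE conjE)
    have "\<forall>y. \<bar>y - x\<bar> < r \<longrightarrow> \<rho> y = Re (f (of_real y))"
      unfolding \<rho>_def using conv by (intro allI impI limI) simp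
    then show "\<exists>r>0. \<exists>f. f holomorphic_on ball (of_real x) r \<and> (\<forall>y. \<bar>y - x\<bar> < r \<longrightarrow> \<rho> y = Re (f (of_real y)))"
      using r by blast
  qed
  ultimately show ?thesis by (intro exI[of _ \<rho>] conjI allI impI)
qed

end

theorem corollary1p2:
  fixes k m :: nat
    and H :: "(nat, 'e) hypergraph" and l :: "'e \<Rightarrow> nat" and \<Phi> :: "nat \<Rightarrow> 'e"
    and G0 :: "('a, 'e) vertex marked_graph"
    and G :: "nat \<Rightarrow> ('a, 'e) vertex marked_graph"
  assumes "k \<ge> 1" and "m \<ge> 2"
    and "gluing_data k m H l \<Phi>"
    and "G0 \<in> marked_graphs k"
    and "G 0 = G0" and "\<And>n. G (Suc n) = recursion k H l \<Phi> (G n)"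
    and "\<exists>D. \<forall>n. max_degree (G n) \<le> D"
    and "(\<lambda>n. min_mark_distance k (G n)) \<longlonglongrightarrow> \<infinity>"
  shows "\<exists>\<rho>. (\<forall>x>0. (\<lambda>n. ln (independence_poly (G n) x) / real (card (verts (G n)))) \<longlonglongrightarrow> \<rho> x)
           \<and> real_analytic_on \<rho> {0<..}"
proof -
  interpret recursive_sequence k m H l \<Phi> G
    by unfold_locales (use assms in auto)
  show ?thesis by (rule free_energy)
qed

end
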